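(* Let $n\ge 1$, $N:=2^n$, and consider the $n$-qubit bilinear control system $\Sigma_b$ $$\dot\rho(t) = -\big(i\hat H_u(t) + \gamma(t)\,\Gamma_b\big)\rho(t),\qquad \rho(0)=\rho_0,$$ where $H_u(t)=H_0+\sum_{j=1}^m u_j(t)H_j$ with Hermitian $H_0,H_1,\dots,H_m$ on $(\mathbb C^2)^{\otimes n}$, real piecewise-constant (not necessarily bounded) control amplitudes $u_j(t)$, $\hat H(\rho):=[H,\rho]$, and $$\Gamma_b(\rho) := -\Big(V_b\rho V_b^\dagger - \tfrac12\big(V_b^\dagger V_b\rho+\rho V_b^\dagger V_b\big)\Big),\qquad V_b:=\mathbb 1_2^{\otimes(n-1)}\otimes X/\sqrt2,$$ with $X$ the Pauli $x$ matrix, i.e. bit-flip relaxation on the $n$-th qubit, whose noise amplitude is a piecewise-constant control switchable between two values, $\gamma(t)\in\{0,\gamma_*\}$ with a fixed $\gamma_*>0$. Assume there are no further sources of decoherence, and that $$\langle iH_0, iH_1,\dots,iH_m\rangle_{\mathrm{Lie}} = \mathfrak{su}(N).$$ Then for every density operator $\rho_0\in\mathfrak{pos}_1$, in the limit $\gamma_*\tau\to\infty$, $$\overline{\mathfrak{reach}_{\Sigma_b}(\rho_0)} = \{\rho\in\mathfrak{pos}_1 \,:\, \rho\prec\rho_0\}.$$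
   Context: $\mathfrak{pos}_1$ denotes the set of all density operators on $(\mathbb C^2)^{\otimes n}$. $\langle\cdot\rangle_{\mathrm{Lie}}$ denotes the generated Lie algebra. The reachable set $\mathfrak{reach}_{\Sigma_b}(\rho_0)$ is the set of all states $\rho(\tau)$, $\tau\ge0$, obtainable from $\rho_0$ by solutions of the control system for some admissible controls; its closure is understood as the asymptotic limit $\gamma_*\tau\to\infty$ of the total control duration $\tau$. For density operators, $\rho\prec\rho_0$ ($\rho$ is majorised by $\rho_0$) means that the vector of eigenvalues of $\rho$ is majorised by that of $\rho_0$: with eigenvalues sorted decreasingly, all partial sums of those of $\rho$ are $\le$ the corresponding partial sums of those of $\rho_0$ (total sums are equal). *)

theory Defs
  imports "HOL-Analysis.Analysis" "Jordan_Normal_Form.Char_Poly"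
begin

definition adj :: "complex mat \<Rightarrow> complex mat" where
  "adj A = mat (dim_col A) (dim_row A) (\<lambda>(i,j). cnj (A $$ (j,i)))"

definition mtrace :: "complex mat \<Rightarrow> complex" where
  "mtrace A = (\<Sum>i<dim_row A. A $$ (i,i))"

definition hermitian :: "nat \<Rightarrow> complex mat \<Rightarrow> bool" where
  "hermitian N A \<longleftrightarrow> A \<in> carrier_mat N N \<and> adj A = A"

definition psd :: "nat \<Rightarrow> complex mat \<Rightarrow> bool" where
  "psd N A \<longleftrightarrow> hermitian N A \<and>
     (\<forall>v :: nat \<Rightarrow> complex. 0 \<le> Re (\<Sum>i<N. \<Sum>j<N. cnj (v i) * A $$ (i,j) * v j))"

definition pos1 :: "nat \<Rightarrow> complex mat set" where
  "pos1 N = {\<rho>. psd N \<rho> \<and> mtrace \<rho> = 1}"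

definition comm :: "complex mat \<Rightarrow> complex mat \<Rightarrow> complex mat" where
  "comm A B = A * B - B * A"

definition kron :: "complex mat \<Rightarrow> complex mat \<Rightarrow> complex mat" where
  "kron A B = mat (dim_row A * dim_row B) (dim_col A * dim_col B)
     (\<lambda>(i,j). A $$ (i div dim_row B, j div dim_col B) * B $$ (i mod dim_row B, j mod dim_col B))"

definition pauliX :: "complex mat" where
  "pauliX = mat 2 2 (\<lambda>(i,j). if i \<noteq> j then 1 else 0)"

inductive_set lie_gen :: "complex mat set \<Rightarrow> complex mat set" for S where
  gen: "A \<in> S \<Longrightarrow> A \<in> lie_gen S"
| smult: "A \<in> lie_gen S \<Longrightarrow> complex_of_real r \<cdot>\<^sub>m A \<in> lie_gen S"
| add: "A \<in> lie_gen S \<Longrightarrow> B \<in> lie_gen S \<Longrightarrow> A + B \<in> lie_gen S"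
| bracket: "A \<in> lie_gen S \<Longrightarrow> B \<in> lie_gen S \<Longrightarrow> comm A B \<in> lie_gen S"

definition su :: "nat \<Rightarrow> complex mat set" where
  "su N = {A \<in> carrier_mat N N. adj A = - A \<and> mtrace A = 0}"

definition V_b :: "nat \<Rightarrow> complex mat" where
  "V_b n = complex_of_real (1 / sqrt 2) \<cdot>\<^sub>m kron (1\<^sub>m (2 ^ (n - 1))) pauliX"

definition Gamma_b :: "nat \<Rightarrow> complex mat \<Rightarrow> complex mat" where
  "Gamma_b n \<rho> = - (V_b n * \<rho> * adj (V_b n)
      - complex_of_real (1/2) \<cdot>\<^sub>m (adj (V_b n) * V_b n * \<rho> + \<rho> * (adj (V_b n) * V_b n)))"

fun ctrl_ham :: "complex mat \<Rightarrow> complex mat list \<Rightarrow> real list \<Rightarrow> complex mat" where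
  "ctrl_ham A (H # Hs) (u # us) = ctrl_ham (A + complex_of_real u \<cdot>\<^sub>m H) Hs us"
| "ctrl_ham A _ _ = A"

definition generator :: "nat \<Rightarrow> complex mat \<Rightarrow> real \<Rightarrow> complex mat \<Rightarrow> complex mat" where
  "generator n H \<gamma> \<rho> = - (\<i> \<cdot>\<^sub>m comm H \<rho> + complex_of_real \<gamma> \<cdot>\<^sub>m Gamma_b n \<rho>)"

definition evolves :: "nat \<Rightarrow> (complex mat \<Rightarrow> complex mat) \<Rightarrow> real \<Rightarrow> complex mat \<Rightarrow> complex mat \<Rightarrow> bool" where
  "evolves N L t \<rho> \<rho>' \<longleftrightarrow> 0 \<le> t \<and> (\<exists>f :: real \<Rightarrow> complex mat.
     f 0 = \<rho> \<and> f t = \<rho>' \<and>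
     (\<forall>s\<in>{0..t}. f s \<in> carrier_mat N N \<and>
        (\<forall>i<N. \<forall>j<N. ((\<lambda>r. f r $$ (i,j)) has_vector_derivative (L (f s) $$ (i,j))) (at s within {0..t}))))"

inductive_set reach :: "nat \<Rightarrow> complex mat \<Rightarrow> complex mat list \<Rightarrow> real \<Rightarrow> complex mat \<Rightarrow> complex mat set"
  for n H0 Hs \<gamma>s \<rho>0 where
  start: "\<rho>0 \<in> reach n H0 Hs \<gamma>s \<rho>0"
| step: "\<rho> \<in> reach n H0 Hs \<gamma>s \<rho>0 \<Longrightarrow> length us = length Hs \<Longrightarrow> \<gamma> \<in> {0, \<gamma>s} \<Longrightarrow>
         evolves (2 ^ n) (generator n (ctrl_ham H0 Hs us) \<gamma>) t \<rho> \<rho>' \<Longrightarrow>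
         \<rho>' \<in> reach n H0 Hs \<gamma>s \<rho>0"

definition mat_closure :: "nat \<Rightarrow> complex mat set \<Rightarrow> complex mat set" where
  "mat_closure N S = {\<rho> \<in> carrier_mat N N. \<forall>\<epsilon>>0. \<exists>\<sigma>\<in>S. \<forall>i<N. \<forall>j<N.
      cmod (\<sigma> $$ (i,j) - \<rho> $$ (i,j)) < \<epsilon>}"

definition eigvals_desc :: "complex mat \<Rightarrow> real list" where
  "eigvals_desc A = (THE ls. length ls = dim_row A \<and> sorted_wrt (\<ge>) ls \<and>
      char_poly A = prod_list (map (\<lambda>l. [:- complex_of_real l, 1:]) ls))"

definition majorised :: "complex mat \<Rightarrow> complex mat \<Rightarrow> bool" (infix "\<prec>" 50) where
  "\<rho> \<prec> \<sigma> \<longleftrightarrow> (let a = eigvals_desc \<rho>; b = eigvals_desc \<sigma> in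
      length a = length b \<and>
      (\<forall>k\<le>length a. sum_list (take k a) \<le> sum_list (take k b)) \<and>
      sum_list a = sum_list b)"

end

theory Submission
  imports Defs "Jordan_Normal_Form.Schur_Decomposition"
begin

text \<open>
  Both inclusions rest on the same observation: for a closed set of states, the generators whose
  forward flow preserves the set form a closed convex cone (Lie--Trotter), and the cone is stable
  under commutators of elements whose negatives it also contains.

  For the states majorised by the initial one, Ky Fan's principle shows that they form a closed
  convex set invariant under unitary conjugation, so the cone contains every Hamiltonian and the
  dissipator. Conversely, for the closure of the reachable set, recurrence puts the reversed
  Hamiltonian flows into the cone; hence it contains all of \<open>su(N)\<close>, and the drift can be cancelled
  against the noisy generator to leave the pure dissipator. Conjugating the dissipator by unitaries
  averages any two eigenvalues of a diagonal state, and by Hardy--Littlewood--Polya such averagings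
  reach every majorised spectrum.

  As \<open>N\<close> is not a type, matrices of all sizes are embedded into one Banach space of bounded functions
  on pairs of indices, whose endomorphisms form a Banach algebra with an exponential.
\<close>

section \<open>Unitary matrices and Schur decomposition\<close>

text \<open>The obstacle is that the drift \<open>H0\<close> cannot be switched off and time runs
  forward only, so neither a single control Hamiltonian nor the dissipator alone need be a generator
  that the controls can select. Cones of generators also remove all bookkeeping of control
  sequences.

  The special form of the noise enters through one fact: \<open>V_b n\<close> is a Hermitian
  involution \<open>Z\<close> divided by sqrt 2, so the dissipator is (Z rho Z - rho)/2 and its flow
  mixes rho with Z rho Z, the weight of the latter rising from 0 towards 1/2. The value 1/2 appears
  only in the limit of infinite noise time. Weights up to 1/2 suffice because the averagings never
  reverse the order of two eigenvalues. As \<open>Z\<close> is also traceless, every traceless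
  Hermitian involution is a unitary conjugate of it, and since \<open>N\<close> is even, the swap of
  two basis vectors extends to such an involution. The restriction to \<open>su N\<close> costs only
  a global phase, which conjugation does not see.\<close>

lemma adj_dim [simp]: "dim_row (adj A) = dim_col A" "dim_col (adj A) = dim_row A"
  by (simp_all add: adj_def)

lemma adj_index [simp]: "i < dim_col A \<Longrightarrow> j < dim_row A \<Longrightarrow> adj A $$ (i,j) = cnj (A $$ (j,i))"
  by (simp add: adj_def)

lemma adj_carrier [simp, intro]: "A \<in> carrier_mat n m \<Longrightarrow> adj A \<in> carrier_mat m n"
  by (rule carrier_matI) auto

lemma adj_adj [simp]: "adj (adj A) = A"
  by (rule eq_matI) auto

lemma mult_index:
  assumes "A \<in> carrier_mat n m" "B \<in> carrier_mat m k" "i < n" "j < k"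
  shows "(A * B) $$ (i,j) = (\<Sum>l<m. A $$ (i,l) * B $$ (l,j))"
  using assms by (auto simp: scalar_prod_def lessThan_atLeast0 intro!: sum.cong)

lemma adj_mult:
  assumes "A \<in> carrier_mat n m" "B \<in> carrier_mat m k"
  shows "adj (A * B) = adj B * adj A"
proof (rule eq_matI)
  fix i j assume "i < dim_row (adj B * adj A)" "j < dim_col (adj B * adj A)"
  then have ij: "i < k" "j < n" using assms by auto
  then have "adj (A * B) $$ (i,j) = cnj ((A * B) $$ (j,i))"
    using assms by (subst adj_index) auto
  also have "\<dots> = (\<Sum>l<m. adj B $$ (i,l) * adj A $$ (l,j))"
    using assms ij by (auto simp: mult_index[OF assms ij(2,1)] mult.commute intro!: sum.cong)
  also have "\<dots> = (adj B * adj A) $$ (i,j)"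
    using assms ij by (subst mult_index[of _ k m _ n]) auto
  finally show "adj (A * B) $$ (i,j) = (adj B * adj A) $$ (i,j)" .
qed (use assms in auto)

lemma adj_one [simp]: "adj (1\<^sub>m n) = 1\<^sub>m n"
  by (rule eq_matI) auto

lemma adj_add: "A \<in> carrier_mat n m \<Longrightarrow> B \<in> carrier_mat n m \<Longrightarrow> adj (A + B) = adj A + adj B"
  by (rule eq_matI) auto

lemma adj_minus: "A \<in> carrier_mat n m \<Longrightarrow> B \<in> carrier_mat n m \<Longrightarrow> adj (A - B) = adj A - adj B"
  by (rule eq_matI) auto

lemma adj_uminus [simp]: "adj (- A) = - adj A"
  by (rule eq_matI) auto

lemma adj_smult [simp]: "adj (c \<cdot>\<^sub>m A) = cnj c \<cdot>\<^sub>m adj A"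
  by (rule eq_matI) auto

lemma square_mult_carrier [simp]:
  "A \<in> carrier_mat n n \<Longrightarrow> B \<in> carrier_mat n n \<Longrightarrow> A * B \<in> carrier_mat n n"
  by (rule mult_carrier_mat)

definition unitary :: "nat \<Rightarrow> complex mat \<Rightarrow> bool" where
  "unitary N U \<longleftrightarrow> U \<in> carrier_mat N N \<and> adj U * U = 1\<^sub>m N"

lemma unitary_carrier [dest]: "unitary N U \<Longrightarrow> U \<in> carrier_mat N N"
  by (simp add: unitary_def)

lemma unitary_adj_mult: "unitary N U \<Longrightarrow> adj U * U = 1\<^sub>m N"
  by (simp add: unitary_def)

lemma unitary_mult_adj: "unitary N U \<Longrightarrow> U * adj U = 1\<^sub>m N"
  by (auto simp: unitary_def intro: mat_mult_left_right_inverse[of "adj U" N U])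

lemma unitary_adj: "unitary N U \<Longrightarrow> unitary N (adj U)"
  using unitary_mult_adj by (auto simp: unitary_def)

lemma unitary_one [simp]: "unitary N (1\<^sub>m N)"
  by (auto simp: unitary_def)

definition uconj :: "complex mat \<Rightarrow> complex mat \<Rightarrow> complex mat" where
  "uconj U A = U * A * adj U"

lemma uconj_dim: "dim_row (uconj U A) = dim_row U" "dim_col (uconj U A) = dim_row U"
  by (simp_all add: uconj_def)

lemma uconj_carrier [simp, intro]:
  "U \<in> carrier_mat n m \<Longrightarrow> A \<in> carrier_mat m m \<Longrightarrow> uconj U A \<in> carrier_mat n n"
  by (auto simp: uconj_def)

lemma uconj_one [simp]: "A \<in> carrier_mat N N \<Longrightarrow> uconj (1\<^sub>m N) A = A"
  by (simp add: uconj_def)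

lemma uconj_uconj:
  assumes "U \<in> carrier_mat n n" "V \<in> carrier_mat n n" "A \<in> carrier_mat n n"
  shows "uconj U (uconj V A) = uconj (U * V) A"
  using assms unfolding uconj_def adj_mult[OF assms(1,2)]
  by (auto simp: assoc_mult_mat[of _ n n _ n _ n])

lemma uconj_mult:
  assumes "unitary n U" "A \<in> carrier_mat n n" "B \<in> carrier_mat n n"
  shows "uconj U A * uconj U B = uconj U (A * B)"
proof -
  have U: "U \<in> carrier_mat n n" "adj U \<in> carrier_mat n n" using assms by auto
  have "uconj U A * uconj U B = U * A * (adj U * U) * B * adj U"
    using U assms unfolding uconj_def
    by (auto simp: assoc_mult_mat[of _ n n _ n _ n])
  also have "\<dots> = uconj U (A * B)"
    using U assms by (simp add: uconj_def unitary_adj_mult assoc_mult_mat[of _ n n _ n _ n])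
  finally show ?thesis .
qed

lemma unitary_mult:
  assumes "unitary N U" "unitary N V"
  shows "unitary N (U * V)"
proof -
  have c: "U \<in> carrier_mat N N" "adj U \<in> carrier_mat N N" "V \<in> carrier_mat N N" "adj V \<in> carrier_mat N N"
    using assms by auto
  have "adj (U * V) * (U * V) = adj V * (adj U * U) * V"
    using c by (simp add: adj_mult[of _ N N _ N] assoc_mult_mat[of _ N N _ N _ N])
  then show ?thesis using c assms by (simp add: unitary_def)
qed

lemma uconj_inverse:
  assumes "unitary n U" "A \<in> carrier_mat n n"
  shows "uconj (adj U) (uconj U A) = A" "uconj U (uconj (adj U) A) = A"
  using assms by (auto simp: uconj_uconj[of _ n] unitary_adj_mult unitary_mult_adj unitary_carrier)

lemma adj_uconj:
  assumes "U \<in> carrier_mat n n" "A \<in> carrier_mat n n"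
  shows "adj (uconj U A) = uconj U (adj A)"
  using assms by (simp add: uconj_def adj_mult[of _ n n _ n] assoc_mult_mat[of _ n n _ n _ n])

lemma uconj_add:
  assumes "U \<in> carrier_mat n n" "A \<in> carrier_mat n n" "B \<in> carrier_mat n n"
  shows "uconj U (A + B) = uconj U A + uconj U B"
  using assms by (simp add: uconj_def mult_add_distrib_mat[of _ n n _ n] add_mult_distrib_mat[of _ n n _ _ n])

lemma uconj_minus:
  assumes "U \<in> carrier_mat n n" "A \<in> carrier_mat n n" "B \<in> carrier_mat n n"
  shows "uconj U (A - B) = uconj U A - uconj U B"
  using assms by (simp add: uconj_def mult_minus_distrib_mat[of _ n n _ n] minus_mult_distrib_mat[of _ n n _ _ n])

lemma uconj_smult:
  assumes "U \<in> carrier_mat n n" "A \<in> carrier_mat n n"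
  shows "uconj U (c \<cdot>\<^sub>m A) = c \<cdot>\<^sub>m uconj U A"
  using assms by (simp add: uconj_def mult_smult_distrib[of _ n n _ n] mult_smult_assoc_mat[of _ n n _ n])

lemma uconj_uminus:
  assumes "U \<in> carrier_mat n n" "A \<in> carrier_mat n n"
  shows "uconj U (- A) = - uconj U A"
  using assms by (simp add: uconj_def)

text \<open>Complete \<open>v\<close> to a basis, orthogonalise and normalise; Gram-Schmidt keeps
  the first vector, so only a scalar separates it from the first column. This is the deflation step
  of the Schur form.\<close>

lemma unitary_first_column:
  assumes v: "v \<in> carrier_vec n" "v \<noteq> 0\<^sub>v n"
  obtains W c where "unitary n W" "col W 0 = c \<cdot>\<^sub>v v"
proof -
  interpret cof_vec_space n "TYPE(complex)" .
  define b where "b = basis_completion v"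
  define ws where "ws = gram_schmidt n b"
  note bc = basis_completion[OF v, folded b_def]
  have n0: "n > 0" using v by (cases n) (auto intro!: eq_vecI)
  obtain vs where bv: "b = v # vs" using bc(6,7) n0 by (cases b) auto
  from gram_schmidt_result[OF bc(2,4,5) refl, folded ws_def]
  have ws: "set ws \<subseteq> carrier_vec n" "corthogonal ws" "length ws = n"
    using bc(6) by auto
  have hd: "hd ws = v" using gram_schmidt_hd[OF v(1), of vs] by (simp add: ws_def bv)
  have wsc: "ws ! j \<in> carrier_vec n" if "j < n" for j using ws that by auto
  \<comment> \<open>Gram-Schmidt yields orthogonal but not unit vectors; \<open>r j\<close> is the
    norm of the j-th one.\<close>
  define r where "r j = complex_of_real (sqrt (Re (ws ! j \<bullet>c ws ! j)))" for j
  have ne: "ws ! j \<bullet>c ws ! j \<noteq> 0" if "j < n" for j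
    using corthogonalD[OF ws(2), of j j] that ws(3) by auto
  have r2: "r j * r j = ws ! j \<bullet>c ws ! j" for j
  proof -
    have "ws ! j \<bullet>c ws ! j \<ge> 0" by (rule conjugate_square_ge_0_vec)
    then show ?thesis by (auto simp: r_def complex_eq_iff less_eq_complex_def)
  qed
  have r0: "r j \<noteq> 0" if "j < n" for j using r2[of j] ne[OF that] by auto
  have rc: "cnj (r j) = r j" for j by (simp add: r_def)
  define W where "W = mat n n (\<lambda>(i,j). ws ! j $ i / r j)"
  have W: "W \<in> carrier_mat n n" by (simp add: W_def)
  have "adj W * W = 1\<^sub>m n"
  proof (rule eq_matI)
    fix i j assume "i < dim_row (1\<^sub>m n :: complex mat)" "j < dim_col (1\<^sub>m n :: complex mat)"
    then have ij: "i < n" "j < n" by auto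
    have "(adj W * W) $$ (i,j) = (\<Sum>k<n. ws ! j $ k * cnj (ws ! i $ k) / (r i * r j))"
      using W ij by (subst mult_index[of _ n n _ n]) (auto simp: W_def rc intro!: sum.cong)
    also have "\<dots> = (ws ! j \<bullet>c ws ! i) / (r i * r j)"
      using wsc[OF ij(1)] wsc[OF ij(2)]
      by (simp add: scalar_prod_def lessThan_atLeast0 sum_divide_distrib)
    also have "\<dots> = 1\<^sub>m n $$ (i,j)"
      using ij corthogonalD[OF ws(2), of j i] ws(3) r2[of j] r0 ne by auto
    finally show "(adj W * W) $$ (i,j) = 1\<^sub>m n $$ (i,j)" .
  qed (use W in auto)
  then have "unitary n W" using W by (simp add: unitary_def)
  moreover have "col W 0 = (1 / r 0) \<cdot>\<^sub>v v"
  proof -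
    have "ws ! 0 = v" using hd n0 ws(3) by (metis hd_conv_nth length_greater_0_conv)
    then show ?thesis using n0 v by (intro eq_vecI) (auto simp: W_def)
  qed
  ultimately show ?thesis by (rule that)
qed

text \<open>Deflation: a unitary whose first column is an eigenvector for \<open>e\<close> splits
  off a 1 by 1 block, and the induction hypothesis triangularises the rest. The diagonal follows the
  order of \<open>es\<close>, which later allows a decreasing spectrum to be prescribed.\<close>

lemma unitary_schur:
  assumes "A \<in> carrier_mat n n" "char_poly A = (\<Prod>e\<leftarrow>es. [:- e, 1:])"
  shows "\<exists>U T. unitary n U \<and> T \<in> carrier_mat n n \<and> upper_triangular T \<and> diag_mat T = es \<and> A = uconj U T"
  using assms
proof (induct es arbitrary: n A)
  case Nil
  with degree_monic_char_poly[of A n] have "n = 0" by auto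
  with Nil show ?case
    by (intro exI[of _ "1\<^sub>m n"] exI[of _ A]) (auto simp: diag_mat_def)
next
  case (Cons e es n A)
  note A = Cons(2)
  have cp: "char_poly A = [: -e, 1 :] * (\<Prod>e \<leftarrow> es. [:- e, 1:])" using Cons(3) by auto
  have mon: "monic (\<Prod>e\<leftarrow> es. [:- e, 1:])" by (rule monic_prod_list) auto
  have "degree (char_poly A) = Suc (degree (\<Prod>e\<leftarrow> es. [:- e, 1:]))" unfolding cp
    by (subst degree_mult_eq, insert mon, auto)
  with degree_monic_char_poly[OF A] obtain m where n: "n = 1 + m" by (cases n) auto
  have "eigenvalue A e" unfolding eigenvalue_root_char_poly[OF A] cp by simp
  then obtain v where v: "v \<in> carrier_vec n" "v \<noteq> 0\<^sub>v n" "A *\<^sub>v v = e \<cdot>\<^sub>v v"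
    using A unfolding eigenvalue_def eigenvector_def by auto
  obtain W c where W: "unitary n W" "col W 0 = c \<cdot>\<^sub>v v" using unitary_first_column[OF v(1,2)] .
  have Wc: "W \<in> carrier_mat n n" "adj W \<in> carrier_mat n n" using W(1) by auto
  define A' where "A' = uconj (adj W) A"
  have A': "A' \<in> carrier_mat n n" using A Wc by (auto simp: A'_def)
  have AA': "A = uconj W A'" using uconj_inverse[OF W(1) A] by (simp add: A'_def)
  \<comment> \<open>The first column of \<open>W\<close> is an eigenvector, and the columns of
    \<open>W\<close> are orthonormal.\<close>
  have col0: "A' $$ (i,0) = (if i = 0 then e else 0)" if i: "i < n" for i
  proof -
    have colAW: "col (A * W) 0 = e \<cdot>\<^sub>v col W 0"
    proof -
      have "col (A * W) 0 = A *\<^sub>v col W 0" using A Wc n by (intro col_mult2) auto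
      also have "\<dots> = c \<cdot>\<^sub>v (A *\<^sub>v v)" unfolding W(2) by (rule mult_mat_vec[OF A v(1)])
      also have "\<dots> = e \<cdot>\<^sub>v col W 0" by (simp only: W(2) v(3) smult_smult_assoc mult.commute)
      finally show ?thesis .
    qed
    have "(A * W) $$ (k,0) = e * W $$ (k,0)" if "k < n" for k
      using arg_cong[OF colAW, of "\<lambda>v. v $ k"] that A Wc n by simp
    then have "A' $$ (i,0) = e * (\<Sum>k<n. adj W $$ (i,k) * W $$ (k,0))"
      using A Wc n i unfolding A'_def uconj_def adj_adj assoc_mult_mat[OF Wc(2) A Wc(1)]
      by (subst mult_index[of _ n n _ n]) (auto simp: sum_distrib_left algebra_simps intro!: sum.cong)
    also have "(\<Sum>k<n. adj W $$ (i,k) * W $$ (k,0)) = (adj W * W) $$ (i,0)"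
      using Wc i n by (subst mult_index[of _ n n _ n]) auto
    finally show ?thesis using unitary_adj_mult[OF W(1)] i n by auto
  qed
  define E where "E = mat 1 1 (\<lambda>_. e)"
  define A2 where "A2 = mat 1 m (\<lambda>(i,j). A' $$ (0, Suc j))"
  define A3 where "A3 = mat m m (\<lambda>(i,j). A' $$ (Suc i, Suc j))"
  have E: "E \<in> carrier_mat 1 1" and A2: "A2 \<in> carrier_mat 1 m" and A3: "A3 \<in> carrier_mat m m"
    by (auto simp: E_def A2_def A3_def)
  have A'b: "A' = four_block_mat E A2 (0\<^sub>m m 1) A3"
    using A' n by (intro eq_matI) (auto simp: four_block_mat_def Let_def E_def A2_def A3_def col0)
  have "similar_mat A' A"
    unfolding similar_mat_def
    by (rule exI[of _ "adj W"], rule exI[of _ W], rule similar_mat_witI[of _ _ n])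
       (use A A' W Wc in \<open>auto simp: A'_def uconj_def unitary_mult_adj unitary_adj_mult\<close>)
  then have "char_poly A' = [: -e,1 :] * (\<Prod> e \<leftarrow> es. [:- e, 1:])"
    using char_poly_similar cp by metis
  also have "char_poly A' = char_poly E * char_poly A3"
    unfolding A'b by (rule char_poly_four_block_zeros_col[OF E A2 A3])
  also have "char_poly E = [: -e,1 :]"
    by (simp add: E_def char_poly_defs det_def sign_def)
  finally have cp3: "char_poly A3 = (\<Prod> e \<leftarrow> es. [:- e, 1:])"
    by (metis mult_cancel_left pCons_eq_0_iff zero_neq_one)
  from Cons(1)[OF A3 cp3] obtain V T where V: "unitary m V" and T: "T \<in> carrier_mat m m"
    "upper_triangular T" "diag_mat T = es" and A3V: "A3 = uconj V T" by auto
  have Vc: "V \<in> carrier_mat m m" "adj V \<in> carrier_mat m m" using V by auto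
  define P where "P = four_block_mat (1\<^sub>m 1) (0\<^sub>m 1 m) (0\<^sub>m m 1) V"
  have adjP: "adj P = four_block_mat (1\<^sub>m 1) (0\<^sub>m 1 m) (0\<^sub>m m 1) (adj V)"
    unfolding P_def using Vc
    by (intro eq_matI) (auto simp: four_block_mat_def Let_def)
  have P: "P \<in> carrier_mat n n" unfolding P_def n by (rule four_block_carrier_mat) (use Vc in auto)
  \<comment> \<open>The remaining unitary \<open>V\<close> acts on the last \<open>m\<close>
    coordinates only, so undoing it changes the row \<open>A2\<close> to \<open>A2 * V\<close> and
    turns \<open>A3\<close> into the triangular \<open>T\<close>.\<close>
  define S where "S = four_block_mat E (A2 * V) (0\<^sub>m m 1) T"
  have S: "S \<in> carrier_mat n n" unfolding S_def n by (rule four_block_carrier_mat) (use E T(1) in auto)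
  have AV: "A2 * V \<in> carrier_mat 1 m" using A2 Vc by auto
  have "adj P * P = four_block_mat (1\<^sub>m 1) (0\<^sub>m 1 m) (0\<^sub>m m 1) (1\<^sub>m m)"
    unfolding adjP unfolding P_def using Vc V
    by (subst mult_four_block_mat[of _ 1 1 _ m _ m _ _ 1 _ m]) (auto simp: unitary_adj_mult)
  also have "\<dots> = 1\<^sub>m n"
    by (intro eq_matI) (auto simp: n four_block_mat_def Let_def)
  finally have uP: "unitary n P" using P by (simp add: unitary_def)
  have "uconj P S = A'"
  proof -
    have "P * S = four_block_mat (1\<^sub>m 1 * E + 0\<^sub>m 1 m * 0\<^sub>m m 1) (1\<^sub>m 1 * (A2 * V) + 0\<^sub>m 1 m * T)
        (0\<^sub>m m 1 * E + V * 0\<^sub>m m 1) (0\<^sub>m m 1 * (A2 * V) + V * T)"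
      unfolding P_def S_def
      by (rule mult_four_block_mat[OF one_carrier_mat zero_carrier_mat zero_carrier_mat Vc(1) E AV zero_carrier_mat T(1)])
    moreover have "1\<^sub>m 1 * E + 0\<^sub>m 1 m * 0\<^sub>m m 1 = E" using E by simp
    moreover have "1\<^sub>m 1 * (A2 * V) + 0\<^sub>m 1 m * T = A2 * V"
      using left_mult_one_mat[OF AV] left_mult_zero_mat[OF T(1), of 1] right_add_zero_mat[OF AV] by simp
    moreover have "0\<^sub>m m 1 * E + V * 0\<^sub>m m 1 = 0\<^sub>m m 1"
      using left_mult_zero_mat[OF E, of m] right_mult_zero_mat[OF Vc(1), of 1] by simp
    moreover have "0\<^sub>m m 1 * (A2 * V) + V * T = V * T"
      using left_mult_zero_mat[OF AV, of m] left_add_zero_mat[of "V * T" m m] Vc T(1) by simp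
    ultimately have PS: "P * S = four_block_mat E (A2 * V) (0\<^sub>m m 1) (V * T)" by simp
    have VT: "V * T \<in> carrier_mat m m" using Vc T(1) by simp
    have "P * S * adj P = four_block_mat (E * 1\<^sub>m 1 + A2 * V * 0\<^sub>m m 1) (E * 0\<^sub>m 1 m + A2 * V * adj V)
        (0\<^sub>m m 1 * 1\<^sub>m 1 + V * T * 0\<^sub>m m 1) (0\<^sub>m m 1 * 0\<^sub>m 1 m + V * T * adj V)"
      unfolding PS adjP
      by (rule mult_four_block_mat[OF E AV zero_carrier_mat VT one_carrier_mat zero_carrier_mat zero_carrier_mat Vc(2)])
    moreover have "E * 1\<^sub>m 1 + A2 * V * 0\<^sub>m m 1 = E"
      using right_mult_zero_mat[OF AV, of 1] E by simp
    moreover have "E * 0\<^sub>m 1 m + A2 * V * adj V = A2"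
      using A2 Vc right_mult_zero_mat[OF E, of m]
      by (simp add: assoc_mult_mat[of _ 1 m _ m _ m] unitary_mult_adj[OF V])
    moreover have "0\<^sub>m m 1 * 1\<^sub>m 1 + V * T * 0\<^sub>m m 1 = 0\<^sub>m m 1"
      using right_mult_zero_mat[OF VT, of 1] by simp
    moreover have "0\<^sub>m m 1 * 0\<^sub>m 1 m + V * T * adj V = A3"
    proof -
      have "V * T * adj V \<in> carrier_mat m m" using Vc VT by simp
      then show ?thesis by (simp add: A3V uconj_def)
    qed
    ultimately show ?thesis unfolding uconj_def A'b by simp
  qed
  then have "A = uconj (W * P) S" using AA' uconj_uconj[OF Wc(1) P S] by simp
  moreover have "unitary n (W * P)" using unitary_mult W(1) uP by blast
  moreover have "upper_triangular S"
    unfolding S_def by (intro upper_triangular_four_block[OF E T(1) _ T(2)]) (auto simp: E_def)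
  moreover have "diag_mat S = e # es"
    unfolding S_def using diag_four_block_mat[OF E T(1)] T(3)
    by (simp add: E_def diag_mat_def)
  ultimately show ?case using S by blast
qed

section \<open>Spectral decomposition and the Ky Fan inequality\<close>

definition dg :: "nat \<Rightarrow> (nat \<Rightarrow> complex) \<Rightarrow> complex mat" where
  "dg N f = mat N N (\<lambda>(i,j). if i = j then f i else 0)"

lemma dg_carrier [simp, intro]: "dg N f \<in> carrier_mat N N"
  by (simp add: dg_def)

lemma dg_dim [simp]: "dim_row (dg N f) = N" "dim_col (dg N f) = N"
  by (simp_all add: dg_def)

lemma dg_index [simp]: "i < N \<Longrightarrow> j < N \<Longrightarrow> dg N f $$ (i,j) = (if i = j then f i else 0)"
  by (simp add: dg_def)

lemma adj_dg [simp]: "adj (dg N f) = dg N (\<lambda>i. cnj (f i))"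
  by (rule eq_matI) auto

lemma dg_cong: "(\<And>i. i < N \<Longrightarrow> f i = g i) \<Longrightarrow> dg N f = dg N g"
  by (rule eq_matI) auto

lemma dg_mult: "dg N f * dg N g = dg N (\<lambda>i. f i * g i)"
proof (rule eq_matI)
  fix i j assume "i < dim_row (dg N (\<lambda>i. f i * g i))" "j < dim_col (dg N (\<lambda>i. f i * g i))"
  then have ij: "i < N" "j < N" by auto
  have "(dg N f * dg N g) $$ (i,j) = (\<Sum>l<N. dg N f $$ (i,l) * dg N g $$ (l,j))"
    by (rule mult_index[OF _ _ ij]) auto
  also have "\<dots> = (\<Sum>l<N. if l = i then (if i = j then f i * g i else 0) else 0)"
    by (rule sum.cong) (use ij in auto)
  finally show "(dg N f * dg N g) $$ (i,j) = dg N (\<lambda>i. f i * g i) $$ (i,j)" using ij by simp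
qed auto

lemma dg_const_one: "dg N (\<lambda>_. 1) = 1\<^sub>m N"
  by (rule eq_matI) auto

lemma unitary_dg:
  assumes "\<And>i. i < N \<Longrightarrow> cmod (f i) = 1"
  shows "unitary N (dg N f)"
proof -
  have "adj (dg N f) * dg N f = dg N (\<lambda>i. cnj (f i) * f i)" by (simp add: dg_mult)
  also have "\<dots> = dg N (\<lambda>_. 1)"
    by (rule dg_cong) (use assms in \<open>simp add: mult.commute[of "cnj _"] complex_norm_square[symmetric]\<close>)
  finally show ?thesis by (simp add: unitary_def dg_const_one)
qed

lemma uconj_index:
  assumes "U \<in> carrier_mat N N" "A \<in> carrier_mat N N" "i < N" "j < N"
  shows "uconj U A $$ (i,j) = (\<Sum>k<N. \<Sum>l<N. U $$ (i,k) * A $$ (k,l) * cnj (U $$ (j,l)))"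
proof -
  have "uconj U A $$ (i,j) = (\<Sum>l<N. (U * A) $$ (i,l) * adj U $$ (l,j))"
    unfolding uconj_def by (rule mult_index) (use assms in auto)
  also have "\<dots> = (\<Sum>l<N. \<Sum>k<N. U $$ (i,k) * A $$ (k,l) * cnj (U $$ (j,l)))"
    by (rule sum.cong) (use assms in \<open>auto simp: mult_index[OF assms(1,2,3)] sum_distrib_right simp del: index_mult_mat(1)\<close>)
  finally show ?thesis by (subst sum.swap)
qed

lemma uconj_dg_index:
  assumes "U \<in> carrier_mat N N" "i < N" "j < N"
  shows "uconj U (dg N f) $$ (i,j) = (\<Sum>k<N. U $$ (i,k) * f k * cnj (U $$ (j,k)))"
proof -
  have "(\<Sum>l<N. U $$ (i,k) * dg N f $$ (k,l) * cnj (U $$ (j,l)))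
      = (\<Sum>l<N. if l = k then U $$ (i,k) * f k * cnj (U $$ (j,k)) else 0)" if "k < N" for k
    by (rule sum.cong) (use that in auto)
  then show ?thesis using assms by (simp add: uconj_index)
qed

lemma unitary_col_norm:
  assumes "unitary N U" "j < N"
  shows "(\<Sum>i<N. (cmod (U $$ (i,j)))\<^sup>2) = 1"
proof -
  have c: "U \<in> carrier_mat N N" using assms by auto
  have "complex_of_real (\<Sum>i<N. (cmod (U $$ (i,j)))\<^sup>2) = (\<Sum>i<N. adj U $$ (j,i) * U $$ (i,j))"
    unfolding of_real_sum
    by (rule sum.cong) (use c assms in \<open>auto simp: mult.commute[of "cnj _"] complex_norm_square[symmetric]\<close>)
  also have "\<dots> = (adj U * U) $$ (j,j)" by (rule mult_index[symmetric]) (use c assms in auto)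
  also have "\<dots> = 1" using assms by (simp add: unitary_adj_mult)
  finally show ?thesis using of_real_eq_1_iff by blast
qed

lemma unitary_row_norm:
  assumes "unitary N U" "i < N"
  shows "(\<Sum>j<N. (cmod (U $$ (i,j)))\<^sup>2) = 1"
proof -
  have "U \<in> carrier_mat N N" using assms by auto
  then show ?thesis using unitary_col_norm[OF unitary_adj[OF assms(1)] assms(2)] assms by simp
qed

lemma unitary_entry_le:
  assumes "unitary N U" "i < N" "j < N"
  shows "cmod (U $$ (i,j)) \<le> 1"
proof -
  have "(cmod (U $$ (i,j)))\<^sup>2 \<le> (\<Sum>i<N. (cmod (U $$ (i,j)))\<^sup>2)"
    by (rule member_le_sum) (use assms in auto)
  then show ?thesis using unitary_col_norm[OF assms(1,3)] using abs_square_le_1[of "cmod (U $$ (i,j))"] by simp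
qed

text \<open>Go down the diagonal: once the earlier rows vanish to the right of the diagonal, column
  \<open>i\<close> has only its diagonal entry, which therefore has modulus 1 and leaves nothing for
  the rest of row \<open>i\<close>.\<close>

lemma upper_triangular_unitary:
  assumes U: "unitary N T" and ut: "upper_triangular T"
  shows "T = dg N (\<lambda>i. T $$ (i,i))" "\<And>i. i < N \<Longrightarrow> cmod (T $$ (i,i)) = 1"
proof -
  have c: "T \<in> carrier_mat N N" using U by auto
  have main: "cmod (T $$ (i,i)) = 1 \<and> (\<forall>j<N. i < j \<longrightarrow> T $$ (i,j) = 0)" if "i < N" for i
    using that
  proof (induction i rule: less_induct)
    case (less i)
    have "T $$ (k,i) = 0" if "k < N" "k \<noteq> i" for k
      using that less ut c by (cases k i rule: linorder_cases) auto
    then have "(\<Sum>k<N. (cmod (T $$ (k,i)))\<^sup>2) = (\<Sum>k<N. if k = i then (cmod (T $$ (i,i)))\<^sup>2 else 0)"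
      by (intro sum.cong) auto
    then have d: "(cmod (T $$ (i,i)))\<^sup>2 = 1" using unitary_col_norm[OF U less(2)] less(2) by simp
    have "(\<Sum>j<N. (cmod (T $$ (i,j)))\<^sup>2) = (cmod (T $$ (i,i)))\<^sup>2 + (\<Sum>j\<in>{..<N}-{i}. (cmod (T $$ (i,j)))\<^sup>2)"
      by (rule sum.remove) (use less in auto)
    then have "(\<Sum>j\<in>{..<N}-{i}. (cmod (T $$ (i,j)))\<^sup>2) = 0"
      using unitary_row_norm[OF U less(2)] d by simp
    then have "\<forall>j\<in>{..<N}-{i}. (cmod (T $$ (i,j)))\<^sup>2 = 0" by (subst (asm) sum_nonneg_eq_0_iff) auto
    moreover have "cmod (T $$ (i,i)) = 1" by (rule power2_eq_imp_eq) (use d in auto)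
    ultimately show ?case by auto
  qed
  then show "\<And>i. i < N \<Longrightarrow> cmod (T $$ (i,i)) = 1" by blast
  show "T = dg N (\<lambda>i. T $$ (i,i))"
  proof (rule eq_matI)
    fix i j assume "i < dim_row (dg N (\<lambda>i. T $$ (i,i)))" "j < dim_col (dg N (\<lambda>i. T $$ (i,i)))"
    then show "T $$ (i,j) = dg N (\<lambda>i. T $$ (i,i)) $$ (i,j)"
      using main ut c by (cases i j rule: linorder_cases) auto
  qed (use c in auto)
qed

text \<open>The triangular Schur factor is itself unitary, hence diagonal. The real phases later
  supply a skew-Hermitian logarithm of \<open>U\<close>.\<close>

lemma unitary_decomp:
  assumes "unitary N U"
  obtains P \<theta> where "unitary N P" "U = uconj P (dg N (\<lambda>j. cis (\<theta> j)))"
proof -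
  have c: "U \<in> carrier_mat N N" using assms by auto
  obtain as where as: "char_poly U = (\<Prod>a\<leftarrow>as. [:- a, 1:])" using char_poly_factorized[OF c] by blast
  from unitary_schur[OF c as] obtain P T where P: "unitary N P" and T: "T \<in> carrier_mat N N"
    "upper_triangular T" and UP: "U = uconj P T" by blast
  have "T = uconj (adj P) U" using uconj_inverse[OF P T(1)] UP by simp
  then have "unitary N T"
    using unitary_mult[OF unitary_mult[OF unitary_adj[OF P] assms] P] by (simp add: uconj_def)
  note * = upper_triangular_unitary[OF this T(2)]
  have "T = dg N (\<lambda>j. cis (Arg (T $$ (j,j))))"
  proof -
    have "cis (Arg (T $$ (j,j))) = T $$ (j,j)" if "j < N" for j
    proof -
      have "T $$ (j,j) \<noteq> 0" using *(2)[OF that] by force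
      then show ?thesis using cis_Arg[of "T $$ (j,j)"] *(2)[OF that] by (simp add: sgn_eq)
    qed
    then show ?thesis by (subst *(1)) (rule dg_cong, simp)
  qed
  then have "U = uconj P (dg N (\<lambda>j. cis (Arg (T $$ (j,j)))))" using UP by simp
  with P show ?thesis by (rule that)
qed

text \<open>The triangular Schur factor is again Hermitian, hence diagonal and real, and it keeps
  the order of \<open>as\<close>.\<close>

lemma hermitian_decomp:
  assumes h: "hermitian N A" and cp: "char_poly A = (\<Prod>a\<leftarrow>as. [:- a, 1:])"
  shows "\<exists>P. unitary N P \<and> A = uconj P (dg N (\<lambda>i. as ! i)) \<and> (\<forall>a\<in>set as. Im a = 0) \<and> length as = N"
proof -
  have c: "A \<in> carrier_mat N N" "adj A = A" using h by (auto simp: hermitian_def)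
  from unitary_schur[OF c(1) cp] obtain P T where P: "unitary N P" and T: "T \<in> carrier_mat N N"
    "upper_triangular T" "diag_mat T = as" and AP: "A = uconj P T" by blast
  have "T = uconj (adj P) A" using uconj_inverse[OF P T(1)] AP by simp
  then have "adj T = T" using adj_uconj[of "adj P" N A] P c by auto
  then have Ts: "T $$ (j,i) = cnj (T $$ (i,j))" if "i < N" "j < N" for i j
    using that T(1) adj_index[of j T i] by auto
  have len: "length as = N" using T by (auto simp: diag_mat_def)
  have nth: "as ! i = T $$ (i,i)" if "i < N" for i using T that by (auto simp: diag_mat_def)
  have "T = dg N (\<lambda>i. as ! i)"
  proof (rule eq_matI)
    fix i j assume "i < dim_row (dg N (\<lambda>i. as ! i))" "j < dim_col (dg N (\<lambda>i. as ! i))"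
    then have ij: "i < N" "j < N" by auto
    have "T $$ (i,j) = 0" if "i \<noteq> j"
    proof (cases "i < j")
      case True
      then have "T $$ (j,i) = 0" using upper_triangularD[OF T(2)] T(1) ij by auto
      then show ?thesis using Ts[of j i] ij by simp
    next
      case False
      then show ?thesis using upper_triangularD[OF T(2)] T(1) ij that by auto
    qed
    then show "T $$ (i,j) = dg N (\<lambda>i. as ! i) $$ (i,j)" using ij nth by auto
  qed (use T in auto)
  moreover have "\<forall>a\<in>set as. Im a = 0"
  proof
    fix a assume "a \<in> set as"
    then obtain i where i: "i < N" "a = T $$ (i,i)" using nth len by (metis in_set_conv_nth)
    show "Im a = 0" using arg_cong[OF Ts[OF i(1) i(1)], of Im] i(2) by simp
  qed
  ultimately show ?thesis using P AP len by blast
qed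

section \<open>Sorted spectra of Hermitian matrices\<close>

lemma char_poly_uconj_dg:
  assumes "unitary N P"
  shows "char_poly (uconj P (dg N f)) = (\<Prod>i\<leftarrow>[0..<N]. [:- f i, 1:])"
proof -
  have c: "P \<in> carrier_mat N N" using assms by auto
  have "similar_mat (uconj P (dg N f)) (dg N f)"
    unfolding similar_mat_def
    by (rule exI[of _ P], rule exI[of _ "adj P"], rule similar_mat_witI[of _ _ N])
       (use c assms in \<open>auto simp: uconj_def unitary_mult_adj unitary_adj_mult\<close>)
  then have "char_poly (uconj P (dg N f)) = char_poly (dg N f)" by (rule char_poly_similar)
  also have "\<dots> = (\<Prod>a\<leftarrow>diag_mat (dg N f). [:- a, 1:])"
    by (rule char_poly_upper_triangular[of _ N]) auto
  also have "diag_mat (dg N f) = map f [0..<N]" by (auto simp: diag_mat_def)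
  finally show ?thesis by (simp add: o_def)
qed

lemma poly_linear_factors_zero:
  "poly (\<Prod>l\<leftarrow>xs. [:- complex_of_real l, 1:]) (complex_of_real x) = 0 \<longleftrightarrow> x \<in> set xs"
  by (induction xs) (auto simp: algebra_simps)

text \<open>Makes the description in \<open>eigvals_desc\<close> unambiguous: the head of a
  decreasing list is the largest root, and its factor can be cancelled on both sides.\<close>

lemma sorted_desc_linear_factors_unique:
  assumes "sorted_wrt (\<ge>) xs" "sorted_wrt (\<ge>) ys"
    "(\<Prod>l\<leftarrow>xs. [:- complex_of_real l, 1:]) = (\<Prod>l\<leftarrow>ys. [:- complex_of_real l, 1:])"
  shows "xs = ys"
  using assms
proof (induction xs arbitrary: ys)
  case Nil
  have "y \<notin> set ys" for y
    using poly_linear_factors_zero[of ys y] Nil(3) by simp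
  then show ?case by (cases ys) auto
next
  case (Cons x xs)
  have set_eq: "y \<in> set (x # xs) \<longleftrightarrow> y \<in> set ys" for y
    using poly_linear_factors_zero[of ys y] poly_linear_factors_zero[of "x # xs" y] Cons(4) by metis
  obtain y ys' where ys: "ys = y # ys'" using set_eq[of x] by (cases ys) auto
  have "x = y"
  proof (rule antisym)
    have "y \<in> insert x (set xs)" using set_eq[of y] by (simp add: ys)
    then show "y \<le> x" using Cons(2) by auto
    have "x \<in> insert y (set ys')" using set_eq[of x] by (simp add: ys)
    then show "x \<le> y" using Cons(3) by (auto simp: ys)
  qed
  then have "[:- complex_of_real x, 1:] * (\<Prod>l\<leftarrow>xs. [:- complex_of_real l, 1:])
      = [:- complex_of_real x, 1:] * (\<Prod>l\<leftarrow>ys'. [:- complex_of_real l, 1:])"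
    using Cons(4) by (simp add: ys)
  moreover have "[:- complex_of_real x, 1:] \<noteq> 0" by simp
  ultimately have "(\<Prod>l\<leftarrow>xs. [:- complex_of_real l, 1:]) = (\<Prod>l\<leftarrow>ys'. [:- complex_of_real l, 1:])"
    using mult_left_cancel by blast
  then show ?case using Cons(1)[of ys'] Cons(2,3) \<open>x = y\<close> by (auto simp: ys)
qed

lemma eigvals_desc_uconj:
  assumes "unitary N P" "length ls = N" "sorted_wrt (\<ge>) ls"
  shows "eigvals_desc (uconj P (dg N (\<lambda>i. complex_of_real (ls ! i)))) = ls"
proof -
  let ?A = "uconj P (dg N (\<lambda>i. complex_of_real (ls ! i)))"
  have c: "P \<in> carrier_mat N N" using assms by auto
  have "map (\<lambda>l. [:- complex_of_real l, 1:]) ls = map (\<lambda>i. [:- complex_of_real (ls ! i), 1:]) [0..<N]"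
    using assms(2) by (intro nth_equalityI) auto
  then have cp: "char_poly ?A = prod_list (map (\<lambda>l. [:- complex_of_real l, 1:]) ls)"
    by (simp add: char_poly_uconj_dg[OF assms(1)])
  have "dim_row ?A = N" using c by (simp add: uconj_def)
  then show ?thesis
    unfolding eigvals_desc_def using cp assms(2,3)
    by (intro the_equality) (auto intro: sorted_desc_linear_factors_unique)
qed

text \<open>Sorting only permutes the linear factors of the characteristic polynomial, and the Schur
  form accepts them in any order.\<close>

lemma eigvals_desc_hermitian:
  assumes "hermitian N A"
  obtains P where "unitary N P" "A = uconj P (dg N (\<lambda>i. complex_of_real (eigvals_desc A ! i)))"
    "length (eigvals_desc A) = N" "sorted_wrt (\<ge>) (eigvals_desc A)"
proof -
  have c: "A \<in> carrier_mat N N" using assms by (auto simp: hermitian_def)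
  obtain as where as: "char_poly A = (\<Prod>a\<leftarrow>as. [:- a, 1:])" using char_poly_factorized[OF c] by blast
  have im: "\<forall>a\<in>set as. Im a = 0" using hermitian_decomp[OF assms as] by blast
  define ls where "ls = rev (sort (map Re as))"
  have sls: "sorted_wrt (\<ge>) ls" by (simp add: ls_def sorted_wrt_rev)
  have "map complex_of_real (map Re as) = as"
    using im by (intro nth_equalityI) (auto simp: complex_eq_iff)
  then have "mset (map complex_of_real ls) = mset as"
    by (metis ls_def mset_map mset_rev mset_sort)
  then have "mset (map (\<lambda>a. [:- a, 1:]) (map complex_of_real ls)) = mset (map (\<lambda>a. [:- a, 1:]) as)"
    by (metis mset_map)
  then have "char_poly A = (\<Prod>a\<leftarrow>map complex_of_real ls. [:- a, 1:])"
    unfolding as by (metis prod_mset_prod_list)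
  from hermitian_decomp[OF assms this] obtain P where P: "unitary N P"
    "A = uconj P (dg N (\<lambda>i. map complex_of_real ls ! i))" and len: "length ls = N" by auto
  have A: "A = uconj P (dg N (\<lambda>i. complex_of_real (ls ! i)))"
    unfolding P(2) using len by (auto intro!: arg_cong[of _ _ "uconj P"] dg_cong)
  have "eigvals_desc A = ls" unfolding A by (rule eigvals_desc_uconj[OF P(1) len sls])
  then show ?thesis using that P(1) A len sls by simp
qed

section \<open>Traces, and partial sums of the diagonal under unitary conjugation\<close>

lemma mtrace_mult_commute:
  assumes "A \<in> carrier_mat N N" "B \<in> carrier_mat N N"
  shows "mtrace (A * B) = mtrace (B * A)"
proof -
  have "mtrace (A * B) = (\<Sum>i<N. \<Sum>l<N. A $$ (i,l) * B $$ (l,i))"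
    using assms by (auto simp: mtrace_def mult_index[OF assms] intro!: sum.cong simp del: index_mult_mat(1))
  also have "\<dots> = (\<Sum>l<N. \<Sum>i<N. B $$ (l,i) * A $$ (i,l))" by (subst sum.swap) (simp add: mult.commute)
  also have "\<dots> = mtrace (B * A)"
    using assms by (auto simp: mtrace_def mult_index[OF assms(2,1)] intro!: sum.cong simp del: index_mult_mat(1))
  finally show ?thesis .
qed

lemma mtrace_uconj:
  assumes "unitary N U" "A \<in> carrier_mat N N"
  shows "mtrace (uconj U A) = mtrace A"
proof -
  have U: "U \<in> carrier_mat N N" "adj U \<in> carrier_mat N N" using assms by auto
  have "mtrace (uconj U A) = mtrace (adj U * (U * A))"
    unfolding uconj_def by (rule mtrace_mult_commute) (use U assms in auto)
  also have "adj U * (U * A) = adj U * U * A"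
    using U assms by (simp add: assoc_mult_mat[of _ N N _ N _ N])
  finally show ?thesis using assms by (simp add: unitary_adj_mult)
qed

lemma mtrace_dg [simp]: "mtrace (dg N f) = (\<Sum>i<N. f i)"
  by (simp add: mtrace_def)

text \<open>Subtracting a threshold \<open>c\<close> makes the terms before \<open>k\<close>
  nonnegative and the later ones nonpositive, so moving all weight to the first \<open>k\<close>
  indices can only increase the sum. The threshold cancels because the weights add up to
  \<open>k\<close>.\<close>

lemma weighted_sum_le_top:
  fixes a w :: "nat \<Rightarrow> real"
  assumes anti: "\<And>i j. i \<le> j \<Longrightarrow> j < N \<Longrightarrow> a j \<le> a i"
    and w: "\<And>j. j < N \<Longrightarrow> 0 \<le> w j" "\<And>j. j < N \<Longrightarrow> w j \<le> 1"
    and k: "(\<Sum>j<N. w j) = real k" "k \<le> N"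
  shows "(\<Sum>j<N. w j * a j) \<le> (\<Sum>j<k. a j)"
proof -
  \<comment> \<open>At \<open>k = N\<close> there is no entry \<open>a k\<close>, and the last entry
    serves as threshold.\<close>
  define c where "c = (if k < N then a k else a (N - 1))"
  have up: "a j \<ge> c" if "j < k" for j using that k(2) anti[of j k] anti[of j "N - 1"] by (auto simp: c_def)
  have dn: "a j \<le> c" if "k \<le> j" "j < N" for j using that anti[of k j] by (auto simp: c_def)
  have "(\<Sum>j<N. w j * (a j - c)) \<le> (\<Sum>j<N. if j < k then a j - c else 0)"
  proof (rule sum_mono)
    fix j assume j: "j \<in> {..<N}"
    show "w j * (a j - c) \<le> (if j < k then a j - c else 0)"
    proof (cases "j < k")
      case True
      then show ?thesis using mult_right_mono[of "w j" 1 "a j - c"] w(2)[of j] up[of j] j by simp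
    next
      case False
      then show ?thesis using w(1)[of j] dn[of j] j by (simp add: mult_nonneg_nonpos)
    qed
  qed
  also have "\<dots> = (\<Sum>j<k. a j - c)"
    using k(2) by (intro sum.mono_neutral_cong_right) auto
  finally show ?thesis
    using k(1) by (simp add: algebra_simps sum_subtractf flip: sum_distrib_left)
qed

text \<open>The diagonal entries are the eigenvalues \<open>a j\<close> weighted by the squared
  moduli of the entries of \<open>U * W\<close>. Summed over \<open>k\<close> rows, each weight is
  at most 1 by the column norms, and the total is \<open>k\<close> by the row norms.\<close>

lemma ky_fan_le:
  fixes a :: "nat \<Rightarrow> real"
  assumes W: "unitary N W" and U: "unitary N U" and "k \<le> N"
    and anti: "\<And>i j. i \<le> j \<Longrightarrow> j < N \<Longrightarrow> a j \<le> a i"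
  shows "(\<Sum>i<k. Re (uconj U (uconj W (dg N (\<lambda>i. complex_of_real (a i)))) $$ (i,i))) \<le> (\<Sum>j<k. a j)"
proof -
  define V where "V = U * W"
  have c: "U \<in> carrier_mat N N" "W \<in> carrier_mat N N" using U W by auto
  have V: "unitary N V" unfolding V_def using U W by (rule unitary_mult)
  then have Vc: "V \<in> carrier_mat N N" by auto
  define w where "w j = (\<Sum>i<k. (cmod (V $$ (i,j)))\<^sup>2)" for j
  have *: "Re (v * complex_of_real r * cnj v) = (cmod v)\<^sup>2 * r" for v r
  proof -
    have "v * complex_of_real r * cnj v = complex_of_real ((cmod v)\<^sup>2 * r)"
      using complex_norm_square[of v] by (simp add: mult_ac)
    then show ?thesis by (simp only: Re_complex_of_real)
  qed
  have "Re (uconj U (uconj W (dg N (\<lambda>i. complex_of_real (a i)))) $$ (i,i))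
      = (\<Sum>j<N. (cmod (V $$ (i,j)))\<^sup>2 * a j)" if "i < k" for i
  proof -
    have "uconj U (uconj W (dg N (\<lambda>i. complex_of_real (a i)))) $$ (i,i)
        = (\<Sum>j<N. V $$ (i,j) * complex_of_real (a j) * cnj (V $$ (i,j)))"
      using that \<open>k \<le> N\<close> c Vc by (simp add: uconj_uconj[of _ N] uconj_dg_index flip: V_def)
    also have "Re \<dots> = (\<Sum>j<N. (cmod (V $$ (i,j)))\<^sup>2 * a j)"
      unfolding Re_sum by (rule sum.cong) (rule refl, rule *)
    finally show ?thesis .
  qed
  then have "(\<Sum>i<k. Re (uconj U (uconj W (dg N (\<lambda>i. complex_of_real (a i)))) $$ (i,i)))
      = (\<Sum>i<k. \<Sum>j<N. (cmod (V $$ (i,j)))\<^sup>2 * a j)" by simp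
  also have "\<dots> = (\<Sum>j<N. w j * a j)"
    by (subst sum.swap) (simp add: w_def sum_distrib_right)
  also have "\<dots> \<le> (\<Sum>j<k. a j)"
  proof (rule weighted_sum_le_top[OF anti])
    show "0 \<le> w j" for j by (simp add: w_def sum_nonneg)
    show "w j \<le> 1" if "j < N" for j
    proof -
      have "w j \<le> (\<Sum>i<N. (cmod (V $$ (i,j)))\<^sup>2)"
        unfolding w_def by (rule sum_mono2) (use \<open>k \<le> N\<close> in auto)
      then show ?thesis using unitary_col_norm[OF V that] by simp
    qed
    show "(\<Sum>j<N. w j) = real k"
      unfolding w_def using unitary_row_norm[OF V] \<open>k \<le> N\<close> by (subst sum.swap) simp
  qed (use \<open>k \<le> N\<close> in auto)
  finally show ?thesis .
qed

lemma sum_swap_pairs: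
  "(\<Sum>i\<in>A. \<Sum>j\<in>B. \<Sum>k\<in>C. \<Sum>l\<in>D. f i j k l) = (\<Sum>k\<in>C. \<Sum>l\<in>D. \<Sum>i\<in>A. \<Sum>j\<in>B. f i j k l)"
  (is "?L = ?R")
proof -
  have "?L = (\<Sum>p\<in>A\<times>B. \<Sum>q\<in>C\<times>D. f (fst p) (snd p) (fst q) (snd q))"
    by (simp only: sum.cartesian_product' fst_conv snd_conv)
  also have "\<dots> = (\<Sum>q\<in>C\<times>D. \<Sum>p\<in>A\<times>B. f (fst p) (snd p) (fst q) (snd q))" by (rule sum.swap)
  also have "\<dots> = ?R" by (simp only: sum.cartesian_product' fst_conv snd_conv)
  finally show ?thesis .
qed

lemma psd_uconj:
  assumes "psd N A" "U \<in> carrier_mat N N"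
  shows "psd N (uconj U A)"
proof -
  have A: "A \<in> carrier_mat N N" "adj A = A" using assms by (auto simp: psd_def hermitian_def)
  have "0 \<le> Re (\<Sum>i<N. \<Sum>j<N. cnj (v i) * uconj U A $$ (i,j) * v j)" for v
  proof -
    \<comment> \<open>The quadratic form at \<open>v\<close> becomes that of \<open>A\<close> at
      \<open>w\<close>, which is \<open>adj U\<close> applied to \<open>v\<close>.\<close>
    define w where "w l = (\<Sum>j<N. cnj (U $$ (j,l)) * v j)" for l
    have "(\<Sum>i<N. \<Sum>j<N. cnj (v i) * uconj U A $$ (i,j) * v j)
        = (\<Sum>i<N. \<Sum>j<N. \<Sum>k<N. \<Sum>l<N. cnj (v i) * U $$ (i,k) * A $$ (k,l) * cnj (U $$ (j,l)) * v j)"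
      using A assms by (intro sum.cong refl) (simp add: uconj_index sum_distrib_left sum_distrib_right mult.assoc)
    also have "\<dots> = (\<Sum>k<N. \<Sum>l<N. \<Sum>i<N. \<Sum>j<N. cnj (v i) * U $$ (i,k) * A $$ (k,l) * cnj (U $$ (j,l)) * v j)"
      by (rule sum_swap_pairs)
    also have "\<dots> = (\<Sum>k<N. \<Sum>l<N. cnj (w k) * A $$ (k,l) * w l)"
    proof (intro sum.cong refl)
      fix k l
      have "cnj (w k) * A $$ (k,l) * w l
          = (\<Sum>i<N. U $$ (i,k) * cnj (v i)) * (\<Sum>j<N. A $$ (k,l) * (cnj (U $$ (j,l)) * v j))"
        by (simp only: w_def cnj_sum complex_cnj_mult complex_cnj_cnj sum_distrib_left mult.assoc)
      also have "\<dots> = (\<Sum>i<N. \<Sum>j<N. (U $$ (i,k) * cnj (v i)) * (A $$ (k,l) * (cnj (U $$ (j,l)) * v j)))"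
        by (rule sum_product)
      finally show "(\<Sum>i<N. \<Sum>j<N. cnj (v i) * U $$ (i,k) * A $$ (k,l) * cnj (U $$ (j,l)) * v j)
          = cnj (w k) * A $$ (k,l) * w l"
        by (simp only: mult_ac)
    qed
    finally show ?thesis using assms(1) by (simp add: psd_def)
  qed
  then show ?thesis
    using A assms(2) by (auto simp: psd_def hermitian_def adj_uconj)
qed

section \<open>The Banach algebra of endomorphisms\<close>

text \<open>A separate type lets composition be the multiplication, so that it becomes a Banach
  algebra with unit and the generic \<open>exp\<close> applies.\<close>

typedef (overloaded) 'a endo = "UNIV :: ('a::real_normed_vector \<Rightarrow>\<^sub>L 'a) set" ..

setup_lifting type_definition_endo

instantiation endo :: (real_normed_vector) real_vector
begin
lift_definition zero_endo :: "'a endo" is 0 .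
lift_definition plus_endo :: "'a endo \<Rightarrow> 'a endo \<Rightarrow> 'a endo" is "(+)" .
lift_definition minus_endo :: "'a endo \<Rightarrow> 'a endo \<Rightarrow> 'a endo" is "(-)" .
lift_definition uminus_endo :: "'a endo \<Rightarrow> 'a endo" is "uminus" .
lift_definition scaleR_endo :: "real \<Rightarrow> 'a endo \<Rightarrow> 'a endo" is "scaleR" .
instance by standard (transfer; simp add: algebra_simps; fail)+
end

instantiation endo :: (real_normed_vector) real_normed_vector
begin
lift_definition norm_endo :: "'a endo \<Rightarrow> real" is norm .
definition "dist_endo (x :: 'a endo) y = norm (x - y)"
definition "sgn_endo (x :: 'a endo) = x /\<^sub>R norm x"
definition "uniformity_endo = (INF e\<in>{0<..}. principal {(x :: 'a endo, y). dist x y < e})"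
definition "open_endo (U :: 'a endo set) = (\<forall>x\<in>U. \<forall>\<^sub>F (x', y) in uniformity. x' = x \<longrightarrow> y \<in> U)"
instance
proof
  show "dist x y = norm (x - y)" for x y :: "'a endo" by (simp add: dist_endo_def)
  show "sgn x = x /\<^sub>R norm x" for x :: "'a endo" by (simp add: sgn_endo_def)
  show "norm (a *\<^sub>R x) = \<bar>a\<bar> * norm x" for a and x :: "'a endo" by transfer simp
  show "norm (x + y) \<le> norm x + norm y" for x y :: "'a endo" by transfer (rule norm_triangle_ineq)
  show "norm x = 0 \<longleftrightarrow> x = 0" for x :: "'a endo" by transfer simp
qed (simp_all only: uniformity_endo_def open_endo_def)
end

text \<open>The sort \<open>perfect_space\<close> excludes the zero space, on which the identity
  would be 0 instead of an element of norm 1.\<close>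

instantiation endo :: ("{real_normed_vector, perfect_space}") real_normed_algebra_1
begin
lift_definition one_endo :: "'a endo" is id_blinfun .
lift_definition times_endo :: "'a endo \<Rightarrow> 'a endo \<Rightarrow> 'a endo" is blinfun_compose .
instance
proof
  fix a b c :: "'a endo" and r :: real
  show "a * b * c = a * (b * c)" by transfer (auto intro!: blinfun_eqI)
  show "(a + b) * c = a * c + b * c" by transfer (auto intro!: blinfun_eqI simp: blinfun.bilinear_simps)
  show "a * (b + c) = a * b + a * c" by transfer (auto intro!: blinfun_eqI simp: blinfun.bilinear_simps)
  show "r *\<^sub>R a * b = r *\<^sub>R (a * b)" by transfer (auto intro!: blinfun_eqI simp: blinfun.bilinear_simps)
  show "a * r *\<^sub>R b = r *\<^sub>R (a * b)" by transfer (auto intro!: blinfun_eqI simp: blinfun.bilinear_simps)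
  show "1 * a = a" by transfer (auto intro!: blinfun_eqI)
  show "a * 1 = a" by transfer (auto intro!: blinfun_eqI)
  show "norm (1 :: 'a endo) = 1" by transfer simp
  show "norm (a * b) \<le> norm a * norm b" by transfer (rule norm_blinfun_compose)
  show "(0 :: 'a endo) \<noteq> 1" by transfer (metis norm_blinfun_id norm_zero zero_neq_one)
qed
end

lift_definition app :: "'a::real_normed_vector endo \<Rightarrow> 'a \<Rightarrow> 'a" is blinfun_apply .

lemma endo_eqI: "(\<And>x. app A x = app B x) \<Longrightarrow> A = B"
  by transfer (rule blinfun_eqI)

lemma bounded_bilinear_app: "bounded_bilinear (app :: 'a::real_normed_vector endo \<Rightarrow> _)"
proof -
  have "\<exists>K. \<forall>(a :: 'a endo) b. norm (app a b) \<le> norm a * norm b * K"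
    by (rule exI[of _ 1]) (auto, transfer, rule norm_blinfun)
  then show ?thesis
    by unfold_locales (transfer; simp add: blinfun.bilinear_simps; fail)+
qed

interpretation app: bounded_bilinear app by (rule bounded_bilinear_app)

lemma app_times [simp]: "app (A * B) x = app A (app B x)"
  by transfer simp

lemma app_one [simp]: "app 1 x = x"
  by transfer simp

instance endo :: ("{banach}") banach
proof
  fix X :: "nat \<Rightarrow> 'a endo" assume X: "Cauchy X"
  have d: "dist (Rep_endo a) (Rep_endo b) = dist a b" for a b :: "'a endo"
    by (simp add: dist_norm minus_endo.rep_eq norm_endo.rep_eq)
  have "Cauchy (\<lambda>n. Rep_endo (X n))" using X by (simp add: Cauchy_def d)
  then obtain L where L: "(\<lambda>n. Rep_endo (X n)) \<longlonglongrightarrow> L" using Cauchy_convergent convergent_def by blast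
  have "X \<longlonglongrightarrow> Abs_endo L"
  proof (rule metric_LIMSEQ_I)
    fix r :: real assume "r > 0"
    from metric_LIMSEQ_D[OF L this] show "\<exists>no. \<forall>n\<ge>no. dist (X n) (Abs_endo L) < r"
      by (simp add: d[symmetric] Abs_endo_inverse)
  qed
  then show "convergent X" by (auto simp: convergent_def)
qed

text \<open>Over a discrete index type every function is continuous, so the bounded continuous
  functions on pairs of indices are simply the bounded ones.\<close>

instance prod :: (discrete_topology, discrete_topology) discrete_topology
proof
  fix A :: "('a \<times> 'b) set"
  show "open A" unfolding open_prod_def
  proof
    fix x assume "x \<in> A"
    then show "\<exists>S T. open S \<and> open T \<and> x \<in> S \<times> T \<and> S \<times> T \<subseteq> A"
      by (intro exI[of _ "{fst x}"] exI[of _ "{snd x}"]) (auto simp: open_discrete)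
  qed
qed

text \<open>Needed for the identity on \<open>cbfun\<close> to have norm 1. A small nonzero constant
  added to a function gives a different function nearby.\<close>

instance bcontfun :: (topological_space, "{real_normed_vector, perfect_space}") perfect_space
proof
  fix f :: "'a \<Rightarrow>\<^sub>C 'b"
  show "\<not> open {f}"
  proof
    assume "open {f}"
    then obtain e where e: "e > 0" "\<And>g. dist g f < e \<Longrightarrow> g = f" by (auto simp: open_dist)
    have "\<not> open {0 :: 'b}" by (rule not_open_singleton)
    then obtain c :: 'b where c: "c \<noteq> 0" by (metis UNIV_eq_I open_UNIV singletonI)
    define g where "g = f + (e / 2 / norm c) *\<^sub>R const_bcontfun c"
    have ne: "apply_bcontfun g undefined \<noteq> apply_bcontfun f undefined" using c e(1) by (simp add: g_def)
    have "norm (const_bcontfun c :: 'a \<Rightarrow>\<^sub>C 'b) \<le> norm c" by (rule norm_bound) simp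
    then have "dist g f \<le> e / 2" using c e(1)
      by (simp add: g_def dist_norm field_simps)
    then have "g = f" using e by (intro e(2)) simp
    with ne show False by simp
  qed
qed

section \<open>The exponential in a Banach algebra: derivatives, continuity, the Lie-Trotter
  formula\<close>

lemma exp_scaleR_has_vector_derivative_left:
  fixes A :: "'a::{real_normed_algebra_1, banach}"
  shows "((\<lambda>t. exp (t *\<^sub>R A)) has_vector_derivative A * exp (t *\<^sub>R A)) (at t within T)"
  using exp_scaleR_has_vector_derivative_right[of A t T]
  by (simp add: exp_times_scaleR_commute)

lemma exp_scaleR_comp_has_vector_derivative:
  fixes A :: "'a::{real_normed_algebra_1, banach}"
  shows "((\<lambda>t. exp ((a + b * t) *\<^sub>R A)) has_vector_derivative b *\<^sub>R (A * exp ((a + b * t) *\<^sub>R A))) (at t within T)"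
proof -
  have "((\<lambda>t. a + b * t) has_vector_derivative b) (at t within T)"
    by (auto intro!: derivative_eq_intros simp: has_real_derivative_iff_has_vector_derivative[symmetric])
  from vector_diff_chain_within[OF this exp_scaleR_has_vector_derivative_left[of A "a + b * t"]]
  show ?thesis by (simp add: o_def)
qed

text \<open>Interpolate along \<open>exp (s *\<^sub>R A) * exp ((1 - s) *\<^sub>R B)\<close>: its
  derivative is the same product with \<open>A - B\<close> in the middle, and the mean value
  inequality bounds the increment.\<close>

lemma exp_diff_norm_le:
  fixes A B :: "'a::{real_normed_algebra_1, banach}"
  shows "norm (exp A - exp B) \<le> exp (norm A + norm B) * norm (A - B)"
proof -
  define f where "f s = exp (s *\<^sub>R A) * exp ((1 - s) *\<^sub>R B)" for s :: real
  define f' where "f' s = exp (s *\<^sub>R A) * (A - B) * exp ((1 - s) *\<^sub>R B)" for s :: real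
  have d: "(f has_vector_derivative f' s) (at s within {0..1})" for s
  proof -
    have "(f has_vector_derivative exp (s *\<^sub>R A) * ((- 1) *\<^sub>R (B * exp ((1 + (- 1) * s) *\<^sub>R B)))
        + (A * exp (s *\<^sub>R A)) * exp ((1 + (- 1) * s) *\<^sub>R B)) (at s within {0..1})"
      unfolding f_def
      using has_vector_derivative_mult[OF exp_scaleR_has_vector_derivative_left[of A s]
          exp_scaleR_comp_has_vector_derivative[of 1 "-1" B s "{0..1}"]] by simp
    then show ?thesis
      by (simp add: f'_def algebra_simps exp_times_scaleR_commute)
  qed
  have b: "norm (f' s) \<le> exp (norm A + norm B) * norm (A - B)" if s: "s \<in> {0..1}" for s
  proof -
    have "norm (exp (s *\<^sub>R A)) \<le> exp (s * norm A)" "norm (exp ((1 - s) *\<^sub>R B)) \<le> exp ((1 - s) * norm B)"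
      using norm_exp[of "s *\<^sub>R A"] norm_exp[of "(1 - s) *\<^sub>R B"] s by auto
    moreover have "s * norm A \<le> norm A" "(1 - s) * norm B \<le> norm B"
      using s by (auto intro: mult_left_le_one_le)
    ultimately have "norm (exp (s *\<^sub>R A)) \<le> exp (norm A)" "norm (exp ((1 - s) *\<^sub>R B)) \<le> exp (norm B)"
      by (meson exp_le_cancel_iff order_trans)+
    then have "norm (exp (s *\<^sub>R A)) * norm (A - B) * norm (exp ((1 - s) *\<^sub>R B))
        \<le> exp (norm A) * norm (A - B) * exp (norm B)"
      by (intro mult_mono) auto
    moreover have "norm (f' s) \<le> norm (exp (s *\<^sub>R A)) * norm (A - B) * norm (exp ((1 - s) *\<^sub>R B))"
      unfolding f'_def by (meson norm_mult_ineq order_trans mult_right_mono norm_ge_zero)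
    ultimately show ?thesis by (simp add: exp_add mult_ac)
  qed
  have "norm (f 1 - f 0) \<le> exp (norm A + norm B) * norm (A - B) * norm (1 - 0 :: real)"
    by (rule differentiable_bound[of "{0..1}" f "\<lambda>s h. h *\<^sub>R f' s"])
      (use d b in \<open>auto simp: has_vector_derivative_def mult.commute[of _ "norm (f' _)"] intro!: onorm_bound mult_right_mono\<close>)
  then show ?thesis by (simp add: f_def)
qed

lemma tendsto_exp_banach:
  fixes A :: "'a::{real_normed_algebra_1, banach}"
  assumes "(f \<longlongrightarrow> A) F"
  shows "((\<lambda>x. exp (f x)) \<longlongrightarrow> exp A) F"
proof -
  have "((\<lambda>x. exp (norm (f x) + norm A) * norm (f x - A)) \<longlongrightarrow> exp (norm A + norm A) * norm (A - A)) F"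
    by (intro tendsto_intros assms)
  then have z: "((\<lambda>x. exp (norm (f x) + norm A) * norm (f x - A)) \<longlongrightarrow> 0) F" by simp
  have "((\<lambda>x. exp (f x) - exp A) \<longlongrightarrow> 0) F"
    by (rule Lim_null_comparison[OF always_eventually z]) (use exp_diff_norm_le in blast)
  then show ?thesis by (simp add: LIM_zero_iff)
qed

lemma norm_power_diff_le:
  fixes a b :: "'a::real_normed_algebra_1"
  assumes "norm a \<le> c" "norm b \<le> c" "1 \<le> c"
  shows "norm (a ^ k - b ^ k) \<le> real k * c ^ k * norm (a - b)"
proof (induction k)
  case (Suc k)
  have "a ^ Suc k - b ^ Suc k = a * (a ^ k - b ^ k) + (a - b) * b ^ k" by (simp add: algebra_simps)
  then have "norm (a ^ Suc k - b ^ Suc k) \<le> norm a * norm (a ^ k - b ^ k) + norm (a - b) * norm (b ^ k)"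
    by (metis norm_mult_ineq norm_triangle_mono)
  also have "\<dots> \<le> c * (real k * c ^ k * norm (a - b)) + norm (a - b) * c ^ k"
    using assms Suc power_mono[OF assms(2), of k] norm_power_ineq[of b k]
    by (intro add_mono mult_mono) auto
  also have "norm (a - b) * c ^ k \<le> norm (a - b) * c ^ Suc k"
    using assms(3) by (intro mult_left_mono) (auto intro: power_increasing)
  finally show ?case by (simp add: algebra_simps)
qed simp

lemma exp_of_nat_mult_banach:
  fixes A :: "'a::{real_normed_algebra_1, banach}"
  shows "exp (real k *\<^sub>R A) = exp A ^ k"
proof (induction k)
  case (Suc k)
  have "exp (real (Suc k) *\<^sub>R A) = exp (A + real k *\<^sub>R A)" by (simp add: algebra_simps)
  also have "\<dots> = exp A * exp (real k *\<^sub>R A)" by (rule exp_add_commuting) simp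
  finally show ?case using Suc by simp
qed simp

text \<open>The one-step error \<open>F t\<close> is o(t), since both curves have the same value and
  derivative at 0. Telescoping the powers multiplies it by the number of steps and a bounded factor,
  which still leaves a null sequence.\<close>

theorem lie_trotter:
  fixes A B :: "'a::{real_normed_algebra_1, banach}"
  shows "(\<lambda>k. (exp ((1 / real (Suc k)) *\<^sub>R A) * exp ((1 / real (Suc k)) *\<^sub>R B)) ^ Suc k) \<longlonglongrightarrow> exp (A + B)"
proof -
  define h where "h k = 1 / real (Suc k)" for k
  define F where "F t = exp (t *\<^sub>R A) * exp (t *\<^sub>R B) - exp (t *\<^sub>R (A + B))" for t :: real
  define c where "c = norm A + norm B"
  have "(F has_vector_derivative exp (0 *\<^sub>R A) * (B * exp (0 *\<^sub>R B)) + (A * exp (0 *\<^sub>R A)) * exp (0 *\<^sub>R B)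
      - (A + B) * exp (0 *\<^sub>R (A + B))) (at 0)"
    unfolding F_def by (intro has_vector_derivative_diff has_vector_derivative_mult exp_scaleR_has_vector_derivative_left)
  then have "(F has_vector_derivative 0) (at 0)" by simp
  then have "((\<lambda>t. norm (F t) / norm t) \<longlongrightarrow> 0) (at 0)"
    unfolding has_vector_derivative_def has_derivative_at by (simp add: F_def)
  moreover have "(\<lambda>t. norm (F t) / norm t) = (\<lambda>t. norm (F t /\<^sub>R t))"
    by (simp add: divide_inverse mult.commute)
  ultimately have "((\<lambda>t. norm (F t /\<^sub>R t)) \<longlongrightarrow> 0) (at 0)" by (simp only:)
  then have lim: "((\<lambda>t. F t /\<^sub>R t) \<longlongrightarrow> 0) (at 0)" by (rule tendsto_norm_zero_cancel)
  have "filterlim h (at 0) sequentially"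
    unfolding filterlim_at h_def using LIMSEQ_inverse_real_of_nat by (auto simp: inverse_eq_divide)
  from tendsto_norm[OF filterlim_compose[OF lim this]]
  have "(\<lambda>k. norm (real (Suc k) *\<^sub>R F (h k))) \<longlonglongrightarrow> 0" by (simp add: h_def)
  then have z: "(\<lambda>k. exp c * norm (real (Suc k) *\<^sub>R F (h k))) \<longlonglongrightarrow> 0"
    using tendsto_mult_right_zero by blast
  have b: "norm ((exp (h k *\<^sub>R A) * exp (h k *\<^sub>R B)) ^ Suc k - exp (A + B)) \<le> exp c * norm (real (Suc k) *\<^sub>R F (h k))" for k
  proof -
    have h0: "h k > 0" "real (Suc k) * h k = 1" by (auto simp: h_def)
    have c0: "c \<ge> 0" by (simp add: c_def)
    have "norm (exp (h k *\<^sub>R A) * exp (h k *\<^sub>R B)) \<le> exp (h k * norm A) * exp (h k * norm B)"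
      using norm_exp[of "h k *\<^sub>R A"] norm_exp[of "h k *\<^sub>R B"] h0
      by (intro order_trans[OF norm_mult_ineq] mult_mono) auto
    then have 1: "norm (exp (h k *\<^sub>R A) * exp (h k *\<^sub>R B)) \<le> exp (h k * c)"
      by (simp add: c_def algebra_simps exp_add)
    have "norm (exp (h k *\<^sub>R (A + B))) \<le> exp (h k * norm (A + B))"
      using norm_exp[of "h k *\<^sub>R (A + B)"] h0 by simp
    also have "\<dots> \<le> exp (h k * c)"
      using h0 norm_triangle_ineq[of A B] by (simp add: c_def)
    finally have 2: "norm (exp (h k *\<^sub>R (A + B))) \<le> exp (h k * c)" .
    have 3: "exp (h k * c) \<ge> 1" using h0 c0 by simp
    have "exp (A + B) = exp (real (Suc k) *\<^sub>R (h k *\<^sub>R (A + B)))" using h0 by simp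
    then have 4: "exp (A + B) = exp (h k *\<^sub>R (A + B)) ^ Suc k"
      unfolding exp_of_nat_mult_banach .
    \<comment> \<open>The growth over all steps together is \<open>exp c\<close>, whatever the
      number of steps.\<close>
    have "exp (h k * c) ^ Suc k = exp (real (Suc k) * (h k * c))" by (simp only: exp_of_nat_mult)
    then have 5: "exp (h k * c) ^ Suc k = exp c" using h0(2) by (metis mult.assoc mult_1)
    show ?thesis
      unfolding 4 using norm_power_diff_le[OF 1 2 3, of "Suc k"] unfolding 5 by (simp add: F_def mult_ac)
  qed
  have "(\<lambda>k. (exp (h k *\<^sub>R A) * exp (h k *\<^sub>R B)) ^ Suc k - exp (A + B)) \<longlonglongrightarrow> 0"
    by (rule Lim_null_comparison[OF always_eventually z]) (use b in blast)
  then show ?thesis by (simp add: LIM_zero_iff h_def)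
qed

section \<open>Superoperators as endomorphisms\<close>

text \<open>The Banach space instance for \<open>bcontfun\<close> below asks for a metric on the
  index type. Distinct naturals are at distance at least 1, so this metric induces the discrete
  topology.\<close>

instantiation nat :: metric_space
begin
definition "dist_nat (m :: nat) n = \<bar>real m - real n\<bar>"
definition "uniformity_nat = (INF e\<in>{0<..}. principal {(x :: nat, y). dist x y < e})"
instance
proof
  fix U :: "nat set"
  have "{(x :: nat, y). dist x y < 1} = {(x, y). x = y}" by (auto simp: dist_nat_def)
  then have "\<forall>\<^sub>F (x', y) in uniformity. x' = (y :: nat)"
    unfolding uniformity_nat_def
    by (intro eventually_INF1[of 1]) (auto simp: eventually_principal)
  then have "\<forall>\<^sub>F (x', y) in uniformity. x' = x \<longrightarrow> y \<in> U" if "x \<in> U" for x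
    by (rule eventually_mono) (use that in auto)
  then show "open U \<longleftrightarrow> (\<forall>x\<in>U. \<forall>\<^sub>F (x', y) in uniformity. x' = x \<longrightarrow> y \<in> U)"
    by (auto simp: open_discrete)
qed (auto simp: dist_nat_def uniformity_nat_def)
end

instance bcontfun :: (metric_space, banach) banach ..

type_synonym cbfun = "(nat \<times> nat) \<Rightarrow>\<^sub>C complex"

lemma finite_support_bcontfun:
  fixes f :: "'a::discrete_topology \<Rightarrow> 'b::real_normed_vector"
  assumes "finite {x. f x \<noteq> 0}"
  shows "f \<in> bcontfun"
proof -
  have "range f \<subseteq> insert 0 (f ` {x. f x \<noteq> 0})" by auto
  then have "bounded (range f)" using assms by (meson finite_imageI finite_imp_bounded finite_insert finite_subset)
  then show ?thesis by (simp add: bcontfun_def)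
qed

text \<open>The guard replaces the unspecified values of \<open>$$\<close> outside the block by 0,
  so that the sup norm is the largest modulus of an entry.\<close>

definition emb :: "nat \<Rightarrow> complex mat \<Rightarrow> cbfun" where
  "emb N A = Bcontfun (\<lambda>p. if p \<in> {..<N} \<times> {..<N} then A $$ p else 0)"

lemma emb_apply: "apply_bcontfun (emb N A) p = (if p \<in> {..<N} \<times> {..<N} then A $$ p else 0)"
proof -
  have "finite {p. (if p \<in> {..<N} \<times> {..<N} then A $$ p else 0) \<noteq> 0}"
    by (rule finite_subset[of _ "{..<N} \<times> {..<N}"]) auto
  from finite_support_bcontfun[OF this] show ?thesis by (simp add: emb_def Bcontfun_inverse)
qed

definition unemb :: "nat \<Rightarrow> cbfun \<Rightarrow> complex mat" where
  "unemb N x = mat N N (apply_bcontfun x)"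

lemma unemb_carrier [simp, intro]: "unemb N x \<in> carrier_mat N N"
  by (simp add: unemb_def)

lemma unemb_emb [simp]: "A \<in> carrier_mat N N \<Longrightarrow> unemb N (emb N A) = A"
  by (rule eq_matI) (auto simp: unemb_def emb_apply)

lemma emb_add: "A \<in> carrier_mat N N \<Longrightarrow> B \<in> carrier_mat N N \<Longrightarrow> emb N (A + B) = emb N A + emb N B"
  by (rule bcontfun_eqI) (auto simp: emb_apply)

lemma emb_minus: "A \<in> carrier_mat N N \<Longrightarrow> B \<in> carrier_mat N N \<Longrightarrow> emb N (A - B) = emb N A - emb N B"
  by (rule bcontfun_eqI) (auto simp: emb_apply)

lemma emb_smult: "A \<in> carrier_mat N N \<Longrightarrow> emb N (complex_of_real r \<cdot>\<^sub>m A) = r *\<^sub>R emb N A"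
  by (rule bcontfun_eqI) (auto simp: emb_apply scaleR_conv_of_real)

lemma unemb_add: "unemb N (x + y) = unemb N x + unemb N y"
  by (rule eq_matI) (auto simp: unemb_def)

lemma unemb_scaleR: "unemb N (r *\<^sub>R x) = complex_of_real r \<cdot>\<^sub>m unemb N x"
  by (rule eq_matI) (auto simp: unemb_def scaleR_conv_of_real)

lemma emb_inject: "A \<in> carrier_mat N N \<Longrightarrow> B \<in> carrier_mat N N \<Longrightarrow> emb N A = emb N B \<longleftrightarrow> A = B"
  by (metis unemb_emb)

lemma bounded_linear_apply_bcontfun: "bounded_linear (\<lambda>x. apply_bcontfun x p)"
  by (rule bounded_linear_intro[of _ 1]) (auto intro: norm_bounded)

lemma norm_entry_le: "i < N \<Longrightarrow> j < N \<Longrightarrow> cmod (A $$ (i,j)) \<le> norm (emb N A)"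
  using norm_bounded[of "emb N A" "(i,j)"] by (simp add: emb_apply)

lemma norm_emb_le:
  assumes "\<And>i j. i < N \<Longrightarrow> j < N \<Longrightarrow> cmod (A $$ (i,j)) \<le> c" "0 \<le> c"
  shows "norm (emb N A) \<le> c"
  by (rule norm_bound) (use assms in \<open>auto simp: emb_apply\<close>)

definition single :: "nat \<times> nat \<Rightarrow> complex \<Rightarrow> cbfun" where
  "single p c = Bcontfun (\<lambda>q. if q = p then c else 0)"

lemma single_apply: "apply_bcontfun (single p c) q = (if q = p then c else 0)"
proof -
  have "finite {q. (if q = p then c else 0) \<noteq> 0}"
    by (rule finite_subset[of _ "{p}"]) auto
  from finite_support_bcontfun[OF this] show ?thesis by (simp add: single_def Bcontfun_inverse)
qed

lemma bounded_linear_single: "bounded_linear (single p)"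
proof (rule bounded_linear_intro[of _ 1])
  show "norm (single p c) \<le> norm c * 1" for c by (rule norm_bound) (simp add: single_apply)
qed (auto intro!: bcontfun_eqI simp: single_apply)

lemma apply_bcontfun_sum: "apply_bcontfun (sum f S) p = (\<Sum>i\<in>S. apply_bcontfun (f i) p)"
  by (rule linear_sum[OF bounded_linear.linear[OF bounded_linear_apply_bcontfun]])

lemma emb_eq_sum_single: "emb N A = (\<Sum>p\<in>{..<N}\<times>{..<N}. single p (A $$ p))"
  by (rule bcontfun_eqI) (auto simp: emb_apply apply_bcontfun_sum single_apply)

text \<open>Real-linearity is the matching notion because the endomorphisms of \<open>cbfun\<close>
  are bounded real-linear maps.\<close>

definition superop :: "nat \<Rightarrow> (complex mat \<Rightarrow> complex mat) \<Rightarrow> bool" where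
  "superop N M \<longleftrightarrow>
     (\<forall>A\<in>carrier_mat N N. M A \<in> carrier_mat N N) \<and>
     (\<forall>A\<in>carrier_mat N N. \<forall>B\<in>carrier_mat N N. M (A + B) = M A + M B) \<and>
     (\<forall>r. \<forall>A\<in>carrier_mat N N. M (complex_of_real r \<cdot>\<^sub>m A) = complex_of_real r \<cdot>\<^sub>m M A)"

definition op :: "nat \<Rightarrow> (complex mat \<Rightarrow> complex mat) \<Rightarrow> cbfun endo" where
  "op N M = Abs_endo (Blinfun (\<lambda>x. emb N (M (unemb N x))))"

text \<open>Only the finitely many coordinates in the block enter, so the map is a finite sum of
  linear maps on the complex plane composed with bounded coordinate evaluations.\<close>

lemma bounded_linear_superop:
  assumes "superop N M"
  shows "bounded_linear (\<lambda>x. emb N (M (unemb N x)))" (is "bounded_linear ?f")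
proof -
  have lin: "linear ?f"
    using assms by (intro linearI) (auto simp: superop_def unemb_add unemb_scaleR emb_add emb_smult)
  have sum_eq: "?f x = (\<Sum>p\<in>{..<N}\<times>{..<N}. ?f (single p (apply_bcontfun x p)))" for x
  proof -
    have "unemb N x = unemb N (emb N (unemb N x))" by simp
    also have "emb N (unemb N x) = (\<Sum>p\<in>{..<N}\<times>{..<N}. single p (apply_bcontfun x p))"
      unfolding emb_eq_sum_single by (rule sum.cong) (auto simp: unemb_def)
    finally show ?thesis by (simp add: linear_sum[OF lin])
  qed
  have bl: "bounded_linear (\<lambda>x. ?f (single p (apply_bcontfun x p)))" for p
  proof -
    have "linear (\<lambda>c. ?f (single p c))"
      using linear_compose[OF bounded_linear.linear[OF bounded_linear_single] lin] by (simp add: o_def)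
    then have "bounded_linear (\<lambda>c. ?f (single p c))" by (simp add: linear_conv_bounded_linear)
    from bounded_linear_compose[OF this bounded_linear_apply_bcontfun] show ?thesis .
  qed
  have eq: "?f = (\<lambda>x. \<Sum>p\<in>{..<N}\<times>{..<N}. ?f (single p (apply_bcontfun x p)))"
    by (rule ext) (rule sum_eq)
  show ?thesis by (subst eq) (rule bounded_linear_sum, rule bl)
qed

lemma app_op: "superop N M \<Longrightarrow> app (op N M) x = emb N (M (unemb N x))"
  by (simp add: op_def app.rep_eq Abs_endo_inverse bounded_linear_Blinfun_apply bounded_linear_superop)

section \<open>Linear matrix differential equations and exponential flows\<close>

lemma has_vector_derivative_emb:
  assumes "\<And>i j. i < N \<Longrightarrow> j < N \<Longrightarrow> ((\<lambda>r. f r $$ (i,j)) has_vector_derivative D $$ (i,j)) F"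
  shows "((\<lambda>r. emb N (f r)) has_vector_derivative emb N D) F"
proof -
  have "((\<lambda>r. single p (f r $$ p)) has_vector_derivative single p (D $$ p)) F"
    if "p \<in> {..<N} \<times> {..<N}" for p
    using assms[of "fst p" "snd p"] that
    by (auto intro: bounded_linear.has_vector_derivative[OF bounded_linear_single])
  then show ?thesis
    unfolding emb_eq_sum_single by (rule has_vector_derivative_sum)
qed

text \<open>Transporting the solution back by the inverse exponential gives a curve with derivative
  zero.\<close>

lemma linear_ode_unique:
  fixes L :: "'a::{banach, perfect_space} endo"
  assumes d: "\<And>s. s \<in> {0..t} \<Longrightarrow> (g has_vector_derivative app L (g s)) (at s within {0..t})" and t: "0 \<le> t"
  shows "g t = app (exp (t *\<^sub>R L)) (g 0)"
proof -
  \<comment> \<open>The shape \<open>0 + (-1) * s\<close> fits the affine argument in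
    \<open>exp_scaleR_comp_has_vector_derivative\<close>.\<close>
  define h where "h s = app (exp ((0 + (-1) * s) *\<^sub>R L)) (g s)" for s
  have "(h has_derivative (\<lambda>_. 0)) (at s within {0..t})" if s: "s \<in> {0..t}" for s
  proof -
    have "(h has_vector_derivative app (exp ((0 + (-1) * s) *\<^sub>R L)) (app L (g s))
        + app ((-1) *\<^sub>R (L * exp ((0 + (-1) * s) *\<^sub>R L))) (g s)) (at s within {0..t})"
      unfolding h_def
      by (rule app.has_vector_derivative[OF exp_scaleR_comp_has_vector_derivative d[OF s]])
    moreover have "app (exp ((0 + (-1) * s) *\<^sub>R L)) (app L (g s)) = app (L * exp ((0 + (-1) * s) *\<^sub>R L)) (g s)"
      by (simp add: exp_times_scaleR_commute[symmetric] flip: app_times scaleR_minus_left)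
    ultimately show ?thesis by (simp add: has_vector_derivative_def app.scaleR_left app.minus_left)
  qed
  then have "h t = h 0" using t by (intro has_derivative_zero_unique[of "{0..t}"]) auto
  then have "app (exp (t *\<^sub>R L)) (h t) = app (exp (t *\<^sub>R L)) (g 0)" by (simp add: h_def)
  then show ?thesis
    by (simp add: h_def exp_minus_inverse flip: app_times)
qed

lemma app_exp_has_vector_derivative:
  "((\<lambda>s. app (exp (s *\<^sub>R L)) x) has_vector_derivative app L (app (exp (s *\<^sub>R L)) x)) (at s within T)"
  using bounded_linear.has_vector_derivative[OF app.bounded_linear_left[of x] exp_scaleR_has_vector_derivative_left[of L s T]]
  by simp

text \<open>The embedded matrices, encoded as the fixed points of the cut-off to the block; as the
  fixed points of a continuous map they are closed.\<close>

definition blk :: "nat \<Rightarrow> cbfun set" where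
  "blk N = {x. emb N (unemb N x) = x}"

lemma emb_in_blk [simp, intro]: "A \<in> carrier_mat N N \<Longrightarrow> emb N A \<in> blk N"
  by (simp add: blk_def)

lemma superop_id: "superop N (\<lambda>A. A)"
  by (simp add: superop_def)

text \<open>The cut-off to the block commutes with \<open>op N M\<close>, so the cut-off trajectory
  solves the same equation with the same initial value.\<close>

lemma exp_op_blk:
  assumes "superop N M" "x \<in> blk N" "0 \<le> t"
  shows "app (exp (t *\<^sub>R op N M)) x \<in> blk N"
proof -
  define g where "g s = app (op N (\<lambda>A. A)) (app (exp (s *\<^sub>R op N M)) x)" for s
  have "(g has_vector_derivative app (op N M) (g s)) (at s within {0..t})" for s
  proof -
    have "app (op N (\<lambda>A. A)) (app (op N M) y) = app (op N M) (app (op N (\<lambda>A. A)) y)" for y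
      using assms(1) by (simp add: app_op superop_id) (simp add: superop_def)
    then show ?thesis
      unfolding g_def
      using bounded_linear.has_vector_derivative[OF app.bounded_linear_right app_exp_has_vector_derivative[of "op N M" x s]]
      by metis
  qed
  then have "g t = app (exp (t *\<^sub>R op N M)) (g 0)" using assms(3) by (rule linear_ode_unique)
  then show ?thesis using assms(2) by (simp add: g_def app_op superop_id blk_def)
qed

section \<open>Cones of generators preserving a closed set\<close>

text \<open>Forward times only, because the dissipative flow is not reversible within the
  states.\<close>

definition preserves :: "'a::{banach,perfect_space} set \<Rightarrow> 'a endo \<Rightarrow> bool" where
  "preserves R L \<longleftrightarrow> (\<forall>t\<ge>0. \<forall>x\<in>R. app (exp (t *\<^sub>R L)) x \<in> R)"

lemma preservesD: "preserves R L \<Longrightarrow> 0 \<le> t \<Longrightarrow> x \<in> R \<Longrightarrow> app (exp (t *\<^sub>R L)) x \<in> R"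
  by (simp add: preserves_def)

lemma preserves_scaleR: "preserves R L \<Longrightarrow> 0 \<le> r \<Longrightarrow> preserves R (r *\<^sub>R L)"
  by (simp add: preserves_def)

lemma preserves_tendsto:
  assumes "closed R" "\<And>k. preserves R (f k)" "f \<longlonglongrightarrow> L"
  shows "preserves R L"
  unfolding preserves_def
proof (intro allI impI ballI)
  fix t :: real and x assume "0 \<le> t" "x \<in> R"
  then have "\<forall>k. app (exp (t *\<^sub>R f k)) x \<in> R" using assms(2) by (simp add: preserves_def)
  moreover have "(\<lambda>k. app (exp (t *\<^sub>R f k)) x) \<longlonglongrightarrow> app (exp (t *\<^sub>R L)) x"
    by (intro app.tendsto tendsto_exp_banach tendsto_scaleR assms(3) tendsto_const)
  ultimately show "app (exp (t *\<^sub>R L)) x \<in> R"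
    using closed_sequentially[OF assms(1), of "\<lambda>k. app (exp (t *\<^sub>R f k)) x"] by blast
qed

lemma preserves_add:
  assumes "closed R" "preserves R L" "preserves R M"
  shows "preserves R (L + M)"
  unfolding preserves_def
proof (intro allI impI ballI)
  fix t :: real and x assume t: "0 \<le> t" and x: "x \<in> R"
  define G where "G k = exp ((1 / real (Suc k)) *\<^sub>R t *\<^sub>R L) * exp ((1 / real (Suc k)) *\<^sub>R t *\<^sub>R M)" for k
  have "app (G k) y \<in> R" if "y \<in> R" for y k
    using assms(2,3) t that by (simp add: G_def preserves_def)
  then have "app (G k ^ m) x \<in> R" for k m
    using x by (induction m) auto
  moreover have "(\<lambda>k. app (G k ^ Suc k) x) \<longlonglongrightarrow> app (exp (t *\<^sub>R L + t *\<^sub>R M)) x"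
    unfolding G_def by (intro app.tendsto lie_trotter tendsto_const)
  ultimately have "app (exp (t *\<^sub>R L + t *\<^sub>R M)) x \<in> R"
    using closed_sequentially[OF assms(1), of "\<lambda>k. app (G k ^ Suc k) x"] by blast
  then show "app (exp (t *\<^sub>R (L + M))) x \<in> R" by (simp add: scaleR_add_right)
qed

lemma exp_conj_banach:
  fixes E F M :: "'a::{real_normed_algebra_1, banach}"
  assumes "E * F = 1" "F * E = 1"
  shows "exp (E * M * F) = E * exp M * F"
proof -
  have bl: "bounded_linear (\<lambda>X. E * X * F)"
    by (rule bounded_linear_compose[OF bounded_linear_mult_left bounded_linear_mult_right])
  have pow: "(E * M * F) ^ n = E * M ^ n * F" for n
  proof (induction n)
    case (Suc n)
    have "(E * M * F) ^ Suc n = E * M * (F * E) * M ^ n * F" unfolding power_Suc Suc by (simp only: mult.assoc)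
    then show ?case by (simp add: assms(2) mult.assoc)
  qed (simp add: assms(1))
  have "exp (E * M * F) = (\<Sum>n. E * (M ^ n /\<^sub>R fact n) * F)"
    by (simp add: exp_def pow)
  also have "\<dots> = E * exp M * F"
    unfolding exp_def using bounded_linear.suminf[OF bl summable_exp_generic[of M]] by simp
  finally show ?thesis .
qed

text \<open>The flow of the conjugated generator runs \<open>L\<close> backwards for time
  \<open>s\<close>, then \<open>M\<close>, then \<open>L\<close> forwards.\<close>

lemma preserves_conj:
  assumes "preserves R L" "preserves R (- L)" "preserves R M" "0 \<le> s"
  shows "preserves R (exp (s *\<^sub>R L) * M * exp (s *\<^sub>R (- L)))"
  unfolding preserves_def
proof (intro allI impI ballI)
  fix t :: real and x assume t: "0 \<le> t" and x: "x \<in> R"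
  have 1: "exp (s *\<^sub>R L) * exp (s *\<^sub>R (- L)) = 1" "exp (s *\<^sub>R (- L)) * exp (s *\<^sub>R L) = 1"
    by (simp_all add: exp_minus_inverse flip: exp_add_commuting)
  have "t *\<^sub>R (exp (s *\<^sub>R L) * M * exp (s *\<^sub>R (- L))) = exp (s *\<^sub>R L) * (t *\<^sub>R M) * exp (s *\<^sub>R (- L))" by simp
  then have "app (exp (t *\<^sub>R (exp (s *\<^sub>R L) * M * exp (s *\<^sub>R (- L))))) x
      = app (exp (s *\<^sub>R L)) (app (exp (t *\<^sub>R M)) (app (exp (s *\<^sub>R (- L))) x))"
    by (simp only: exp_conj_banach[OF 1] app_times)
  also have "\<dots> \<in> R"
    by (intro preservesD[OF assms(1,4)] preservesD[OF assms(3) t] preservesD[OF assms(2,4)] x)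
  finally show "app (exp (t *\<^sub>R (exp (s *\<^sub>R L) * M * exp (s *\<^sub>R (- L))))) x \<in> R" .
qed

lemma vector_derivative_tendsto_seq:
  fixes f :: "real \<Rightarrow> 'a::real_normed_vector"
  assumes "(f has_vector_derivative D) (at 0)"
  shows "(\<lambda>k. real (Suc k) *\<^sub>R (f (1 / real (Suc k)) - f 0)) \<longlonglongrightarrow> D"
proof -
  have lim: "((\<lambda>h. norm (f (0 + h) - f 0 - h *\<^sub>R D) / norm h) \<longlongrightarrow> 0) (at 0)"
    using assms unfolding has_vector_derivative_def has_derivative_at by blast
  have "filterlim (\<lambda>k. 1 / real (Suc k)) (at 0) sequentially"
    unfolding filterlim_at using LIMSEQ_inverse_real_of_nat by (auto simp: inverse_eq_divide)
  from filterlim_compose[OF lim this]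
  have "(\<lambda>k. norm (f (1 / real (Suc k)) - f 0 - (1 / real (Suc k)) *\<^sub>R D) / norm (1 / real (Suc k))) \<longlonglongrightarrow> 0"
    by (simp only: add_0)
  moreover have "norm (f h - f 0 - h *\<^sub>R D) / norm h = norm (inverse h *\<^sub>R (f h - f 0) - D)" if "h > 0" for h
  proof -
    have "inverse h *\<^sub>R (f h - f 0) - D = inverse h *\<^sub>R (f h - f 0 - h *\<^sub>R D)"
      using that by (simp add: scaleR_diff_right)
    then show ?thesis using that by (simp add: divide_inverse)
  qed
  ultimately have "(\<lambda>k. norm (inverse (1 / real (Suc k)) *\<^sub>R (f (1 / real (Suc k)) - f 0) - D)) \<longlonglongrightarrow> 0"
    by (simp only: of_nat_0_less_iff zero_less_Suc divide_pos_pos zero_less_one)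
  then have "(\<lambda>k. inverse (1 / real (Suc k)) *\<^sub>R (f (1 / real (Suc k)) - f 0) - D) \<longlonglongrightarrow> 0"
    by (rule tendsto_norm_zero_cancel)
  then show ?thesis by (simp only: LIM_zero_iff inverse_divide div_by_1)
qed

text \<open>The bracket is the derivative at 0 of the curve of conjugates of \<open>M\<close> along
  the flow of \<open>L\<close>. Its difference quotients are positive multiples of a conjugate of
  \<open>M\<close> plus \<open>- M\<close>: reversibility of \<open>L\<close> is used for the
  conjugation, that of \<open>M\<close> for the subtraction.\<close>

lemma preserves_bracket:
  assumes "closed R" "preserves R L" "preserves R (- L)" "preserves R M" "preserves R (- M)"
  shows "preserves R (L * M - M * L)"
proof -
  define f where "f s = exp (s *\<^sub>R L) * M * exp (s *\<^sub>R (- L))" for s :: real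
  have "(f has_vector_derivative exp (0 *\<^sub>R L) * M * (- L * exp (0 *\<^sub>R (- L)))
      + (exp (0 *\<^sub>R L) * 0 + (L * exp (0 *\<^sub>R L)) * M) * exp (0 *\<^sub>R (- L))) (at 0)"
    unfolding f_def
    by (intro has_vector_derivative_mult exp_scaleR_has_vector_derivative_left has_vector_derivative_const)
  then have "(f has_vector_derivative L * M - M * L) (at 0)" by simp
  from vector_derivative_tendsto_seq[OF this] show ?thesis
  proof (rule preserves_tendsto[OF assms(1), rotated])
    fix k
    have "preserves R (f (1 / real (Suc k)) + - M)"
      unfolding f_def by (intro preserves_add preserves_conj assms) simp
    then show "preserves R (real (Suc k) *\<^sub>R (f (1 / real (Suc k)) - f 0))"
      by (intro preserves_scaleR) (simp_all add: f_def)
  qed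
qed

section \<open>Recurrence of bounded orbits in the finite-dimensional block\<close>

lemma finite_coordinates_convergent_subseq:
  fixes g :: "nat \<Rightarrow> 'p \<Rightarrow> complex"
  assumes "finite S" "\<And>p k. p \<in> S \<Longrightarrow> cmod (g k p) \<le> C"
  shows "\<exists>r. strict_mono r \<and> (\<forall>p\<in>S. convergent (\<lambda>k. g (r k) p))"
  using assms
proof (induction S)
  case empty
  then show ?case by (auto intro: exI[of _ id] simp: strict_mono_def)
next
  case (insert q S)
  then obtain r where r: "strict_mono r" "\<forall>p\<in>S. convergent (\<lambda>k. g (r k) p)" by auto
  have "bounded (range (\<lambda>k. g (r k) q))" using insert(4) by (auto simp: bounded_iff)
  then obtain l r' where r': "strict_mono r'" "((\<lambda>k. g (r k) q) \<circ> r') \<longlonglongrightarrow> l"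
    using bounded_imp_convergent_subsequence by blast
  have "convergent (\<lambda>k. g ((r \<circ> r') k) p)" if "p \<in> S" for p
    using convergent_subseq_convergent[of "\<lambda>k. g (r k) p" r'] r(2) r'(1) that by (auto simp: o_def)
  moreover have "convergent (\<lambda>k. g ((r \<circ> r') k) q)" using r'(2) by (auto simp: o_def convergent_def)
  ultimately show ?case using strict_mono_o[OF r(1) r'(1)] by blast
qed

lemma blk_diff: "x \<in> blk N \<Longrightarrow> y \<in> blk N \<Longrightarrow> x - y \<in> blk N"
proof -
  assume xy: "x \<in> blk N" "y \<in> blk N"
  have "unemb N (x - y) = unemb N x - unemb N y" by (rule eq_matI) (auto simp: unemb_def)
  with xy show ?thesis by (simp add: blk_def emb_minus)
qed

text \<open>Finitely many bounded coordinates have a common convergent subsequence, and two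
  consecutive terms far out in it are close.\<close>

lemma blk_recurrence:
  assumes y: "\<And>k::nat. y k \<in> blk N" "\<And>k. norm (y k) \<le> C" and "0 < \<epsilon>"
  obtains k l where "k < l" "norm (y k - y l) < \<epsilon>"
proof -
  have "cmod (apply_bcontfun (y k) p) \<le> C" for k p
    using norm_bounded[of "y k" p] y(2)[of k] by linarith
  then obtain r where r: "strict_mono r" "\<forall>p\<in>{..<N}\<times>{..<N}. convergent (\<lambda>k. apply_bcontfun (y (r k)) p)"
    using finite_coordinates_convergent_subseq[of "{..<N}\<times>{..<N}" "\<lambda>k. apply_bcontfun (y k)" C] by auto
  define l where "l p = lim (\<lambda>k. apply_bcontfun (y (r k)) p)" for p
  have l: "(\<lambda>k. apply_bcontfun (y (r k)) p) \<longlonglongrightarrow> l p" if "p \<in> {..<N}\<times>{..<N}" for p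
    using r(2) that unfolding l_def convergent_LIMSEQ_iff by blast
  have sum_eq: "y k = (\<Sum>p\<in>{..<N}\<times>{..<N}. single p (apply_bcontfun (y k) p))" for k
  proof -
    have "y k = emb N (unemb N (y k))" using y(1)[of k] by (simp add: blk_def)
    also have "\<dots> = (\<Sum>p\<in>{..<N}\<times>{..<N}. single p (apply_bcontfun (y k) p))"
      unfolding emb_eq_sum_single by (rule sum.cong) (auto simp: unemb_def)
    finally show ?thesis .
  qed
  have "(\<lambda>k. \<Sum>p\<in>{..<N}\<times>{..<N}. single p (apply_bcontfun (y (r k)) p))
      \<longlonglongrightarrow> (\<Sum>p\<in>{..<N}\<times>{..<N}. single p (l p))"
    by (rule tendsto_sum) (rule bounded_linear.tendsto[OF bounded_linear_single l])
  moreover have "(\<lambda>k. y (r k)) = (\<lambda>k. \<Sum>p\<in>{..<N}\<times>{..<N}. single p (apply_bcontfun (y (r k)) p))"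
    by (rule ext) (rule sum_eq)
  ultimately have "(\<lambda>k. y (r k)) \<longlonglongrightarrow> (\<Sum>p\<in>{..<N}\<times>{..<N}. single p (l p))" by (simp only:)
  then have "Cauchy (\<lambda>k. y (r k))" by (rule LIMSEQ_imp_Cauchy)
  from metric_CauchyD[OF this \<open>0 < \<epsilon>\<close>] obtain m
    where m: "\<forall>i\<ge>m. \<forall>j\<ge>m. dist (y (r i)) (y (r j)) < \<epsilon>" by blast
  have "dist (y (r m)) (y (r (Suc m))) < \<epsilon>" using m[rule_format, of m "Suc m"] by simp
  moreover have "r m < r (Suc m)" using r(1) by (simp add: strict_mono_Suc_iff)
  ultimately show ?thesis using that by (simp add: dist_norm)
qed

text \<open>
  Poincare recurrence: a bounded flow returns arbitrarily close to its starting point, so running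
  it backwards is approximated by running it forwards.
\<close>

lemma preserves_uminus:
  assumes R: "closed R" "R \<subseteq> blk N" and M: "superop N M" and pres: "preserves R (op N M)"
    and bd: "\<And>t x. x \<in> blk N \<Longrightarrow> norm (app (exp (t *\<^sub>R op N M)) x) \<le> c * norm x"
  shows "preserves R (- op N M)"
  unfolding preserves_def
proof (intro allI impI ballI)
  fix t :: real and x assume t: "0 \<le> t" and x: "x \<in> R"
  define L where "L = op N M"
  have semigroup: "app (exp (s *\<^sub>R L)) (app (exp (u *\<^sub>R L)) z) = app (exp ((s + u) *\<^sub>R L)) z" for s u z
    by (simp add: scaleR_add_left exp_add_commuting)
  define y where "y k = app (exp ((real k * t) *\<^sub>R L)) x" for k
  have xb: "x \<in> blk N" using x R by blast
  have yR: "y k \<in> R" for k using preservesD[OF pres _ x] t by (simp add: y_def L_def)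
  have yb: "y k \<in> blk N" for k using yR R by blast
  have "app (exp (t *\<^sub>R (- L))) x \<in> closure R"
    unfolding closure_approachable
  proof (intro allI impI)
    fix e :: real assume e: "0 < e"
    \<comment> \<open>Chosen so that \<open>\<bar>c\<bar> * d < e\<close> for every real
      \<open>c\<close>.\<close>
    define d where "d = e / (\<bar>c\<bar> + 1)"
    have d: "0 < d" using e by (simp add: d_def)
    obtain k l where kl: "k < l" "norm (y k - y l) < d"
      using blk_recurrence[of y N "c * norm x" d] yb bd[OF xb] d by (auto simp: y_def L_def)
    \<comment> \<open>Shifting time by \<open>s\<close> moves \<open>y k\<close> to the wanted
      backward point and \<open>y l\<close> to the orbit point \<open>y (l - Suc k)\<close>, which
      lies in \<open>R\<close>. As the bound \<open>bd\<close> covers negative times, the two stay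
      close up to the factor \<open>c\<close>.\<close>
    define s where "s = - (real (Suc k) * t)"
    have "app (exp (s *\<^sub>R L)) (y k) = app (exp (t *\<^sub>R (- L))) x"
      unfolding y_def semigroup by (simp add: s_def algebra_simps)
    moreover have "app (exp (s *\<^sub>R L)) (y l) = y (l - Suc k)"
    proof -
      have "s + real l * t = real (l - Suc k) * t" using kl(1) by (simp add: s_def of_nat_diff algebra_simps)
      then show ?thesis unfolding y_def semigroup by simp
    qed
    ultimately have "dist (y (l - Suc k)) (app (exp (t *\<^sub>R (- L))) x) = norm (app (exp (s *\<^sub>R L)) (y k - y l))"
      by (simp add: dist_norm norm_minus_commute app.diff_right)
    also have "\<dots> \<le> c * norm (y k - y l)" unfolding L_def by (rule bd) (intro blk_diff yb)
    also have "\<dots> \<le> \<bar>c\<bar> * norm (y k - y l)" by (intro mult_right_mono) auto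
    also have "\<dots> \<le> \<bar>c\<bar> * d" using kl(2) by (intro mult_left_mono) auto
    also have "\<dots> < e" using e by (simp add: d_def field_simps)
    finally show "\<exists>z\<in>R. dist z (app (exp (t *\<^sub>R (- L))) x) < e" using yR by blast
  qed
  then show "app (exp (t *\<^sub>R (- op N M))) x \<in> R" using R(1) by (simp add: L_def)
qed

section \<open>Algebra of superoperators, commutators and the flow of a skew-Hermitian
  matrix\<close>

lemma op_eqI:
  assumes "superop N M" "superop N M'" "\<And>A. A \<in> carrier_mat N N \<Longrightarrow> M A = M' A"
  shows "op N M = op N M'"
  by (rule endo_eqI) (use assms in \<open>simp add: app_op\<close>)

lemma superop_add: "superop N M \<Longrightarrow> superop N M' \<Longrightarrow> superop N (\<lambda>A. M A + M' A)"
proof -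
  assume M: "superop N M" "superop N M'"
  have "M (A + B) + M' (A + B) = (M A + M' A) + (M B + M' B)" if "A \<in> carrier_mat N N" "B \<in> carrier_mat N N" for A B
  proof -
    have "M A \<in> carrier_mat N N" "M B \<in> carrier_mat N N" "M' A \<in> carrier_mat N N" "M' B \<in> carrier_mat N N"
      "M (A + B) = M A + M B" "M' (A + B) = M' A + M' B" using M that by (auto simp: superop_def)
    then show ?thesis by (intro eq_matI) auto
  qed
  then show ?thesis using M
    by (auto simp: superop_def add_smult_distrib_left_mat[of _ N N])
qed

lemma op_add: "superop N M \<Longrightarrow> superop N M' \<Longrightarrow> op N (\<lambda>A. M A + M' A) = op N M + op N M'"
proof (rule endo_eqI)
  fix x assume M: "superop N M" "superop N M'"
  then have "emb N (M (unemb N x) + M' (unemb N x)) = emb N (M (unemb N x)) + emb N (M' (unemb N x))"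
    by (intro emb_add) (auto simp: superop_def)
  with M show "app (op N (\<lambda>A. M A + M' A)) x = app (op N M + op N M') x"
    by (simp add: app_op superop_add app.add_left)
qed

lemma superop_smult: "superop N M \<Longrightarrow> superop N (\<lambda>A. complex_of_real r \<cdot>\<^sub>m M A)"
  unfolding superop_def
  by (auto simp: smult_smult_assoc mult.commute add_smult_distrib_left_mat[of _ N N])

lemma op_smult: "superop N M \<Longrightarrow> op N (\<lambda>A. complex_of_real r \<cdot>\<^sub>m M A) = r *\<^sub>R op N M"
proof (rule endo_eqI)
  fix x assume M: "superop N M"
  then have "emb N (complex_of_real r \<cdot>\<^sub>m M (unemb N x)) = r *\<^sub>R emb N (M (unemb N x))"
    by (intro emb_smult) (auto simp: superop_def)
  with M show "app (op N (\<lambda>A. complex_of_real r \<cdot>\<^sub>m M A)) x = app (r *\<^sub>R op N M) x"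
    by (simp add: app_op superop_smult app.scaleR_left)
qed

lemma superop_comp: "superop N M \<Longrightarrow> superop N M' \<Longrightarrow> superop N (\<lambda>A. M (M' A))"
  unfolding superop_def by simp

lemma op_comp: "superop N M \<Longrightarrow> superop N M' \<Longrightarrow> op N (\<lambda>A. M (M' A)) = op N M * op N M'"
  by (rule endo_eqI) (simp add: app_op superop_comp, simp add: superop_def)

lemma comm_carrier [simp]: "A \<in> carrier_mat N N \<Longrightarrow> B \<in> carrier_mat N N \<Longrightarrow> comm A B \<in> carrier_mat N N"
  unfolding comm_def by (rule minus_carrier_mat) simp

lemma comm_add_right:
  "A \<in> carrier_mat N N \<Longrightarrow> B \<in> carrier_mat N N \<Longrightarrow> C \<in> carrier_mat N N \<Longrightarrow> comm A (B + C) = comm A B + comm A C"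
  by (intro eq_matI)
    (auto simp: comm_def mult_add_distrib_mat[of _ N N _ N] add_mult_distrib_mat[of _ N N _ _ N] simp del: index_mult_mat(1))

lemma comm_add_left:
  "A \<in> carrier_mat N N \<Longrightarrow> B \<in> carrier_mat N N \<Longrightarrow> C \<in> carrier_mat N N \<Longrightarrow> comm (A + B) C = comm A C + comm B C"
  by (intro eq_matI)
    (auto simp: comm_def mult_add_distrib_mat[of _ N N _ N] add_mult_distrib_mat[of _ N N _ _ N] simp del: index_mult_mat(1))

lemma comm_smult_right:
  "A \<in> carrier_mat N N \<Longrightarrow> B \<in> carrier_mat N N \<Longrightarrow> comm A (c \<cdot>\<^sub>m B) = c \<cdot>\<^sub>m comm A B"
  by (intro eq_matI)
    (auto simp: comm_def mult_smult_distrib[of _ N N _ N] mult_smult_assoc_mat[of _ N N _ N] algebra_simps simp del: index_mult_mat(1))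

lemma comm_smult_left:
  "A \<in> carrier_mat N N \<Longrightarrow> B \<in> carrier_mat N N \<Longrightarrow> comm (c \<cdot>\<^sub>m A) B = c \<cdot>\<^sub>m comm A B"
  by (intro eq_matI)
    (auto simp: comm_def mult_smult_distrib[of _ N N _ N] mult_smult_assoc_mat[of _ N N _ N] algebra_simps simp del: index_mult_mat(1))

text \<open>The Jacobi identity in the form that turns a bracket of matrices into a bracket of
  superoperators. The minus sign is a real scalar so that the closure properties of
  \<open>superop\<close> apply.\<close>

lemma comm_jacobi:
  assumes "A \<in> carrier_mat N N" "B \<in> carrier_mat N N" "X \<in> carrier_mat N N"
  shows "comm (comm A B) X = comm A (comm B X) + complex_of_real (-1) \<cdot>\<^sub>m comm B (comm A X)"
  using assms
  by (intro eq_matI)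
    (auto simp: comm_def mult_minus_distrib_mat[of _ N N _ N] minus_mult_distrib_mat[of _ N N _ _ N]
      assoc_mult_mat[of _ N N _ N _ N] simp del: index_mult_mat(1))

lemma superop_comm: "A \<in> carrier_mat N N \<Longrightarrow> superop N (comm A)"
  by (auto simp: superop_def comm_add_right comm_smult_right)

lemma op_comm_add:
  "A \<in> carrier_mat N N \<Longrightarrow> B \<in> carrier_mat N N \<Longrightarrow> op N (comm (A + B)) = op N (comm A) + op N (comm B)"
  by (subst op_add[symmetric]) (simp_all add: op_eqI superop_comm superop_add comm_add_left)

lemma op_comm_smult:
  "A \<in> carrier_mat N N \<Longrightarrow> op N (comm (complex_of_real r \<cdot>\<^sub>m A)) = r *\<^sub>R op N (comm A)"
  by (subst op_smult[symmetric]) (simp_all add: op_eqI superop_comm superop_smult comm_smult_left)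

lemma op_comm_comm:
  assumes "A \<in> carrier_mat N N" "B \<in> carrier_mat N N"
  shows "op N (comm (comm A B)) = op N (comm A) * op N (comm B) - op N (comm B) * op N (comm A)"
proof -
  note s = superop_comm[OF assms(1)] superop_comm[OF assms(2)]
  have "op N (comm (comm A B)) = op N (\<lambda>X. comm A (comm B X) + complex_of_real (-1) \<cdot>\<^sub>m comm B (comm A X))"
    by (rule op_eqI[OF superop_comm superop_add[OF superop_comp[OF s] superop_smult[OF superop_comp[OF s(2,1)]]]])
       (use assms in \<open>simp_all only: comm_carrier comm_jacobi\<close>)
  also have "\<dots> = op N (comm A) * op N (comm B) + (-1) *\<^sub>R (op N (comm B) * op N (comm A))"
    by (simp only: op_add[OF superop_comp[OF s] superop_smult[OF superop_comp[OF s(2,1)]]]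
        op_smult[OF superop_comp[OF s(2,1)]] op_comp[OF s] op_comp[OF s(2,1)])
  finally show ?thesis by simp
qed

text \<open>In the eigenbasis given by \<open>P\<close> the commutator acts entrywise, multiplying
  entry (i,j) by the imaginary unit times \<open>\<theta> i - \<theta> j\<close>. Its flow
  multiplies that entry by \<open>cis (s * (\<theta> i - \<theta> j))\<close>, which is conjugation
  by the diagonal unitary \<open>C s\<close>; uniqueness of solutions identifies this with the
  exponential.\<close>

lemma exp_op_comm:
  assumes P: "unitary N P" and X: "X \<in> carrier_mat N N" and t: "0 \<le> t"
  shows "app (exp (t *\<^sub>R op N (comm (uconj P (dg N (\<lambda>j. \<i> * complex_of_real (\<theta> j))))))) (emb N X)
    = emb N (uconj (uconj P (dg N (\<lambda>j. cis (t * \<theta> j)))) X)"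
proof -
  define D where "D = dg N (\<lambda>j. \<i> * complex_of_real (\<theta> j))"
  define A where "A = uconj P D"
  define Y where "Y = uconj (adj P) X"
  define C where "C s = dg N (\<lambda>j. cis (s * \<theta> j))" for s
  define G where "G s = uconj (C s) Y" for s
  have Pc: "P \<in> carrier_mat N N" "adj P \<in> carrier_mat N N" using P by auto
  have c: "D \<in> carrier_mat N N" "Y \<in> carrier_mat N N" "C s \<in> carrier_mat N N" "G s \<in> carrier_mat N N" for s
    using Pc X by (auto simp: D_def Y_def C_def G_def)
  have Ac: "A \<in> carrier_mat N N" using Pc c by (auto simp: A_def)
  have G_index: "G s $$ (i,j) = cis (s * (\<theta> i - \<theta> j)) * Y $$ (i,j)" if "i < N" "j < N" for s i j
  proof -
    have "G s $$ (i,j) = (\<Sum>k<N. \<Sum>l<N. if k = i \<and> l = j then cis (s * \<theta> i) * Y $$ (i,j) * cnj (cis (s * \<theta> j)) else 0)"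
      unfolding G_def uconj_index[OF c(3) c(2) that]
      by (intro sum.cong refl) (use that in \<open>auto simp: C_def\<close>)
    also have "\<dots> = (\<Sum>k<N. if k = i then cis (s * \<theta> i) * Y $$ (i,j) * cnj (cis (s * \<theta> j)) else 0)"
      by (intro sum.cong refl) (use that in \<open>auto\<close>)
    also have "\<dots> = cis (s * \<theta> i) * cis (- (s * \<theta> j)) * Y $$ (i,j)" using that by (simp add: cis_cnj mult_ac)
    finally show ?thesis by (simp add: cis_mult algebra_simps)
  qed
  have comm_index: "comm D (G s) $$ (i,j) = \<i> * complex_of_real (\<theta> i - \<theta> j) * G s $$ (i,j)" if "i < N" "j < N" for s i j
  proof -
    have "(D * G s) $$ (i,j) = (\<Sum>l<N. if l = i then \<i> * complex_of_real (\<theta> i) * G s $$ (i,j) else 0)"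
      unfolding mult_index[OF c(1) c(4) that] by (intro sum.cong refl) (use that in \<open>auto simp: D_def\<close>)
    moreover have "(G s * D) $$ (i,j) = (\<Sum>l<N. if l = j then G s $$ (i,j) * (\<i> * complex_of_real (\<theta> j)) else 0)"
      unfolding mult_index[OF c(4) c(1) that] by (intro sum.cong refl) (use that in \<open>auto simp: D_def\<close>)
    moreover have "comm D (G s) $$ (i,j) = (D * G s) $$ (i,j) - (G s * D) $$ (i,j)"
      unfolding comm_def by (rule index_minus_mat) (use c(1) c(4)[of s] that in auto)
    ultimately show ?thesis using that by (simp add: algebra_simps)
  qed
  define f where "f s = uconj P (G s)" for s
  have deriv: "((\<lambda>s. emb N (f s)) has_vector_derivative app (op N (comm A)) (emb N (f s))) (at s within {0..t})" for s
  proof -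
    have "((\<lambda>r. f r $$ (i,j)) has_vector_derivative uconj P (comm D (G s)) $$ (i,j)) (at s within {0..t})"
      if "i < N" "j < N" for i j
    proof -
      have "((\<lambda>r. P $$ (i,k) * G r $$ (k,l) * cnj (P $$ (j,l))) has_vector_derivative
          P $$ (i,k) * comm D (G s) $$ (k,l) * cnj (P $$ (j,l))) (at s within {0..t})" if kl: "k < N" "l < N" for k l
      proof -
        have "((\<lambda>r. cis (r * (\<theta> k - \<theta> l))) has_vector_derivative (\<theta> k - \<theta> l) *\<^sub>R (\<i> * cis (s * (\<theta> k - \<theta> l)))) (at s within {0..t})"
        proof -
          have "exp (r *\<^sub>R (\<i> * complex_of_real (\<theta> k - \<theta> l))) = cis (r * (\<theta> k - \<theta> l))" for r
            by (simp add: cis_conv_exp scaleR_conv_of_real mult_ac)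
          then show ?thesis
            using exp_scaleR_has_vector_derivative_left[of "\<i> * complex_of_real (\<theta> k - \<theta> l)" s "{0..t}"]
            by (simp add: scaleR_conv_of_real mult_ac)
        qed
        from has_vector_derivative_mult_left[OF this, of "Y $$ (k,l)"]
        have "((\<lambda>r. G r $$ (k,l)) has_vector_derivative comm D (G s) $$ (k,l)) (at s within {0..t})"
          unfolding comm_index[OF kl] G_index[OF kl] by (simp add: scaleR_conv_of_real mult_ac)
        from has_vector_derivative_mult_left[OF has_vector_derivative_mult_right[OF this]]
        show ?thesis .
      qed
      then show ?thesis
        unfolding f_def using that Pc c
        by (simp add: uconj_index) (intro has_vector_derivative_sum, simp)
    qed
    from has_vector_derivative_emb[of N f _ "at s within {0..t}", OF this]
    have "((\<lambda>s. emb N (f s)) has_vector_derivative emb N (uconj P (comm D (G s)))) (at s within {0..t})" by simp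
    moreover have "uconj P (comm D (G s)) = comm A (f s)"
      using P Pc c by (simp add: comm_def A_def f_def uconj_mult uconj_minus[of _ N])
    ultimately show ?thesis using Ac c Pc by (simp add: app_op superop_comm f_def)
  qed
  have "emb N (f t) = app (exp (t *\<^sub>R op N (comm A))) (emb N (f 0))"
    by (rule linear_ode_unique[OF deriv t])
  moreover have "f s = uconj (uconj P (C s)) X" for s
    unfolding f_def G_def Y_def uconj_def[of P "C s"] using Pc c X
    by (simp add: uconj_uconj[of _ N] assoc_mult_mat[of _ N N _ N _ N])
  moreover have "f 0 = X"
  proof -
    have "C 0 = 1\<^sub>m N" by (simp add: C_def dg_const_one)
    then show ?thesis using uconj_inverse[OF P X] c by (simp add: f_def G_def Y_def)
  qed
  ultimately show ?thesis by (simp add: A_def D_def C_def)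
qed

section \<open>Hamiltonian and dissipative flows\<close>

lemma hermitian_smult_skew:
  assumes "A \<in> carrier_mat N N" "adj A = - A"
  shows "hermitian N (- \<i> \<cdot>\<^sub>m A)"
proof -
  have "adj (- \<i> \<cdot>\<^sub>m A) = - \<i> \<cdot>\<^sub>m A" using assms by (intro eq_matI) auto
  then show ?thesis using assms by (simp add: hermitian_def)
qed

lemma uconj_smult_dg:
  "U \<in> carrier_mat N N \<Longrightarrow> c \<cdot>\<^sub>m uconj U (dg N f) = uconj U (dg N (\<lambda>i. c * f i))"
  by (subst uconj_smult[symmetric, of _ N]) (auto intro!: arg_cong[of _ _ "uconj U"] eq_matI)

lemma skew_decomp:
  assumes "A \<in> carrier_mat N N" "adj A = - A"
  obtains P \<theta> where "unitary N P" "A = uconj P (dg N (\<lambda>j. \<i> * complex_of_real (\<theta> j)))"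
proof -
  obtain P where P: "unitary N P"
    "- \<i> \<cdot>\<^sub>m A = uconj P (dg N (\<lambda>i. complex_of_real (eigvals_desc (- \<i> \<cdot>\<^sub>m A) ! i)))"
    using eigvals_desc_hermitian[OF hermitian_smult_skew[OF assms]] by metis
  have "A = \<i> \<cdot>\<^sub>m (- \<i> \<cdot>\<^sub>m A)" by (rule eq_matI) auto
  also have "\<dots> = uconj P (dg N (\<lambda>i. \<i> * complex_of_real (eigvals_desc (- \<i> \<cdot>\<^sub>m A) ! i)))"
    by (subst P(2), rule uconj_smult_dg) (use P(1) in auto)
  finally show ?thesis using that P(1) by blast
qed

text \<open>A crude bound, counting the terms of the double sum; recurrence asks only for one that
  is the same for all unitaries.\<close>

lemma norm_emb_uconj_le:
  assumes U: "unitary N U" and X: "X \<in> carrier_mat N N"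
  shows "norm (emb N (uconj U X)) \<le> real (N * N) * norm (emb N X)"
proof (rule norm_emb_le)
  fix i j assume ij: "i < N" "j < N"
  have "cmod (U $$ (i,k) * X $$ (k,l) * cnj (U $$ (j,l))) \<le> norm (emb N X)" if "k < N" "l < N" for k l
  proof -
    have "cmod (U $$ (i,k)) * cmod (X $$ (k,l)) * cmod (U $$ (j,l)) \<le> 1 * norm (emb N X) * 1"
      using ij that by (intro mult_mono unitary_entry_le[OF U] norm_entry_le) auto
    then show ?thesis by (simp add: norm_mult)
  qed
  then have "(\<Sum>k<N. \<Sum>l<N. cmod (U $$ (i,k) * X $$ (k,l) * cnj (U $$ (j,l)))) \<le> (\<Sum>k<N. \<Sum>l<N. norm (emb N X))"
    by (intro sum_mono) auto
  moreover have "cmod (uconj U X $$ (i,j)) \<le> (\<Sum>k<N. \<Sum>l<N. cmod (U $$ (i,k) * X $$ (k,l) * cnj (U $$ (j,l))))"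
    unfolding uconj_index[OF unitary_carrier[OF U] X ij] by (intro order_trans[OF norm_sum] sum_mono norm_sum)
  ultimately show "cmod (uconj U X $$ (i,j)) \<le> real (N * N) * norm (emb N X)" by simp
qed simp

lemma blkE:
  assumes "x \<in> blk N"
  obtains X where "X \<in> carrier_mat N N" "x = emb N X"
  using assms that[of "unemb N x"] by (simp add: blk_def)

text \<open>The flow conjugates by unitaries, so the bound is uniform in time. Negative times, which
  recurrence needs, are covered by the flow of \<open>- A\<close>.\<close>

lemma norm_exp_op_comm_le:
  assumes A: "A \<in> carrier_mat N N" "adj A = - A" and x: "x \<in> blk N"
  shows "norm (app (exp (t *\<^sub>R op N (comm A))) x) \<le> real (N * N) * norm x"
proof -
  obtain X where X: "X \<in> carrier_mat N N" "x = emb N X" using blkE[OF x] .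
  have main: "norm (app (exp (s *\<^sub>R op N (comm B))) x) \<le> real (N * N) * norm x"
    if B: "B \<in> carrier_mat N N" "adj B = - B" and s: "0 \<le> s" for s B
  proof -
    obtain P \<theta> where P: "unitary N P" "B = uconj P (dg N (\<lambda>j. \<i> * complex_of_real (\<theta> j)))"
      using skew_decomp[OF B] .
    have "unitary N (uconj P (dg N (\<lambda>j. cis (s * \<theta> j))))"
      unfolding uconj_def by (intro unitary_mult unitary_adj P(1) unitary_dg) simp
    from norm_emb_uconj_le[OF this X(1)] show ?thesis
      unfolding P(2) X(2) exp_op_comm[OF P(1) X(1) s] .
  qed
  show ?thesis
  proof (cases "0 \<le> t")
    case True
    then show ?thesis by (rule main[OF A])
  next
    case False
    define B where "B = complex_of_real (- 1) \<cdot>\<^sub>m A"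
    have B: "B \<in> carrier_mat N N" "adj B = - B" using A by (auto simp: B_def intro!: eq_matI)
    have "op N (comm B) = - op N (comm A)" unfolding B_def op_comm_smult[OF A(1)] by simp
    then show ?thesis using main[OF B, of "- t"] False by simp
  qed
qed

lemma preserves_comm_uminus:
  assumes "closed R" "R \<subseteq> blk N" "A \<in> carrier_mat N N" "adj A = - A" "preserves R (op N (comm A))"
  shows "preserves R (- op N (comm A))"
  using norm_exp_op_comm_le[OF assms(3,4)]
  by (intro preserves_uminus[OF assms(1,2) superop_comm[OF assms(3)] assms(5)])

text \<open>The induction carries skew-Hermiticity along because it bounds the flows, and reversal
  rests on that bound. Reversal is used for negative scalars and for brackets.\<close>

lemma preserves_lie_gen:
  assumes R: "closed R" "R \<subseteq> blk N"
    and S: "\<And>A. A \<in> S \<Longrightarrow> A \<in> carrier_mat N N \<and> adj A = - A \<and> preserves R (op N (comm A))"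
    and A: "A \<in> lie_gen S"
  shows "A \<in> carrier_mat N N \<and> adj A = - A \<and> preserves R (op N (comm A))"
  using A
proof induction
  case (gen A)
  then show ?case by (rule S)
next
  case (smult A r)
  then have A: "A \<in> carrier_mat N N" "adj A = - A" "preserves R (op N (comm A))" by auto
  have "preserves R (r *\<^sub>R op N (comm A))"
  proof (cases "0 \<le> r")
    case True
    then show ?thesis using A by (intro preserves_scaleR)
  next
    case False
    then have "preserves R ((- r) *\<^sub>R (- op N (comm A)))"
      using preserves_comm_uminus[OF R A] by (intro preserves_scaleR) auto
    then show ?thesis by simp
  qed
  moreover have "adj (complex_of_real r \<cdot>\<^sub>m A) = - (complex_of_real r \<cdot>\<^sub>m A)"
    using A by (intro eq_matI) auto
  ultimately show ?case using A by (simp add: op_comm_smult)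
next
  case (add A B)
  then have *: "A \<in> carrier_mat N N" "adj A = - A" "B \<in> carrier_mat N N" "adj B = - B"
    "preserves R (op N (comm A))" "preserves R (op N (comm B))" by auto
  have "adj (A + B) = - (A + B)" unfolding adj_add[OF *(1,3)] *(2,4) using * by (intro eq_matI) auto
  then show ?case using * R by (simp add: op_comm_add preserves_add)
next
  case (bracket A B)
  then have *: "A \<in> carrier_mat N N" "adj A = - A" "B \<in> carrier_mat N N" "adj B = - B"
    "preserves R (op N (comm A))" "preserves R (op N (comm B))" by auto
  have "adj (comm A B) = - B * - A - - A * - B"
    unfolding comm_def
    by (subst adj_minus[of _ N N]) (use * in \<open>simp_all add: adj_mult[of _ N N _ N]\<close>)
  also have "\<dots> = - comm A B"
    unfolding comm_def using *(1,3)
    by (intro eq_matI) (auto simp del: index_mult_mat(1))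
  finally have "adj (comm A B) = - comm A B" .
  moreover have "preserves R (op N (comm (comm A B)))"
    unfolding op_comm_comm[OF *(1,3)]
    using * R by (intro preserves_bracket preserves_comm_uminus)
  ultimately show ?case using * by simp
qed

section \<open>Invariance under unitary conjugation\<close>

definition uinv :: "nat \<Rightarrow> cbfun set \<Rightarrow> bool" where
  "uinv N R \<longleftrightarrow> (\<forall>U X. unitary N U \<longrightarrow> X \<in> carrier_mat N N \<longrightarrow> emb N X \<in> R \<longrightarrow> emb N (uconj U X) \<in> R)"

lemma uinvD: "uinv N R \<Longrightarrow> unitary N U \<Longrightarrow> X \<in> carrier_mat N N \<Longrightarrow> emb N X \<in> R \<Longrightarrow> emb N (uconj U X) \<in> R"
  by (simp add: uinv_def)

text \<open>Every unitary is a phase times the exponential of an element of \<open>su N\<close>, and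
  the phase drops out of the conjugation.\<close>

lemma preserves_su_imp_uinv:
  assumes "\<And>A. A \<in> su N \<Longrightarrow> preserves R (op N (comm A))"
  shows "uinv N R"
  unfolding uinv_def
proof (intro allI impI)
  fix U X assume U: "unitary N U" and X: "X \<in> carrier_mat N N" "emb N X \<in> R"
  obtain P \<theta> where P: "unitary N P" and UP: "U = uconj P (dg N (\<lambda>j. cis (\<theta> j)))"
    using unitary_decomp[OF U] .
  have Pc: "P \<in> carrier_mat N N" using P by auto
  \<comment> \<open>Subtracting the mean phase makes the logarithm traceless.\<close>
  define m where "m = (\<Sum>j<N. \<theta> j) / real N"
  define A where "A = uconj P (dg N (\<lambda>j. \<i> * complex_of_real (\<theta> j - m)))"
  have tr: "(\<Sum>j<N. \<theta> j - m) = 0" by (simp add: sum_subtractf m_def)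
  have "mtrace A = \<i> * complex_of_real (\<Sum>j<N. \<theta> j - m)"
    unfolding A_def mtrace_uconj[OF P dg_carrier] mtrace_dg of_real_sum sum_distrib_left by simp
  moreover have "adj A = uconj P (dg N (\<lambda>j. - (\<i> * complex_of_real (\<theta> j - m))))"
    unfolding A_def adj_uconj[OF Pc dg_carrier] by (simp add: mult.commute)
  moreover have "dg N (\<lambda>j. - f j) = - dg N f" for f by (rule eq_matI) auto
  ultimately have "A \<in> su N"
    using Pc tr by (simp add: su_def A_def uconj_uminus[of _ N])
  from preservesD[OF assms[OF this] _ X(2), of 1]
  have *: "emb N (uconj (uconj P (dg N (\<lambda>j. cis (\<theta> j - m)))) X) \<in> R"
    unfolding A_def using exp_op_comm[OF P X(1), of 1 "\<lambda>j. \<theta> j - m"] by (simp del: of_real_diff)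
  have Uc: "U \<in> carrier_mat N N" using U by auto
  have "uconj P (dg N (\<lambda>j. cis (\<theta> j - m))) = cis (- m) \<cdot>\<^sub>m U"
    unfolding UP uconj_smult_dg[OF Pc] by (simp add: cis_mult)
  moreover have "uconj (cis (- m) \<cdot>\<^sub>m U) X = (cis (- m) * cnj (cis (- m))) \<cdot>\<^sub>m uconj U X"
  proof -
    have "uconj (cis (- m) \<cdot>\<^sub>m U) X = cnj (cis (- m)) \<cdot>\<^sub>m (cis (- m) \<cdot>\<^sub>m uconj U X)"
      unfolding uconj_def adj_smult using Uc X
      by (simp add: mult_smult_distrib[of _ N N _ N] mult_smult_assoc_mat[of _ N N _ N])
    also have "\<dots> = (cis (- m) * cnj (cis (- m))) \<cdot>\<^sub>m uconj U X" by (rule eq_matI) auto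
    finally show ?thesis .
  qed
  moreover have "cis (- m) * cnj (cis (- m)) = 1" by (simp add: cis_cnj cis_mult)
  moreover have "1 \<cdot>\<^sub>m uconj U X = uconj U X" by (rule eq_matI) auto
  ultimately show "emb N (uconj U X) \<in> R" using * by simp
qed

section \<open>Mixing a state with a unitary conjugate, and the noise flow\<close>

definition mix :: "complex mat \<Rightarrow> real \<Rightarrow> complex mat \<Rightarrow> complex mat" where
  "mix Z p X = complex_of_real (1 - p) \<cdot>\<^sub>m X + complex_of_real p \<cdot>\<^sub>m uconj Z X"

text \<open>For unitary \<open>Z\<close> this is the Lindblad dissipator with jump operator
  \<open>Z\<close>, the anticommutator term being just \<open>X\<close>. The factor -1 is a real
  scalar so that \<open>superop_smult\<close> applies.\<close>

definition noise :: "complex mat \<Rightarrow> complex mat \<Rightarrow> complex mat" where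
  "noise Z X = uconj Z X + complex_of_real (-1) \<cdot>\<^sub>m X"

lemma superop_uconj: "U \<in> carrier_mat N N \<Longrightarrow> superop N (uconj U)"
  by (simp add: superop_def uconj_add[of _ N] uconj_smult[of _ N])

lemma superop_noise: "Z \<in> carrier_mat N N \<Longrightarrow> superop N (noise Z)"
  unfolding noise_def by (intro superop_add superop_uconj superop_smult superop_id)

lemma emb_mix:
  "Z \<in> carrier_mat N N \<Longrightarrow> X \<in> carrier_mat N N \<Longrightarrow>
    emb N (mix Z p X) = (1 - p) *\<^sub>R emb N X + p *\<^sub>R emb N (uconj Z X)"
  unfolding mix_def by (subst emb_add) (auto simp: emb_smult simp del: of_real_diff)

text \<open>As \<open>Z\<close> is an involution, the noise acts on the span of \<open>X\<close> and
  its conjugate: their sum is fixed and their difference decays at rate 2, whence the weight of the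
  conjugate.\<close>

lemma exp_op_noise:
  assumes Z: "unitary N Z" "Z * Z = 1\<^sub>m N" and X: "X \<in> carrier_mat N N" and t: "0 \<le> t"
  shows "app (exp (t *\<^sub>R op N (noise Z))) (emb N X) = emb N (mix Z ((1 - exp (- (2 * t))) / 2) X)"
proof -
  have Zc: "Z \<in> carrier_mat N N" using Z by auto
  define a where "a = emb N X"
  define b where "b = emb N (uconj Z X)"
  let ?L = "app (op N (noise Z))"
  have ZZ: "uconj Z (uconj Z X) = X" using Zc X Z by (simp add: uconj_uconj[of _ N])
  have noise_emb: "?L (emb N Y) = emb N (uconj Z Y) - emb N Y" if "Y \<in> carrier_mat N N" for Y
  proof -
    have "emb N (noise Z Y) = emb N (uconj Z Y) + (-1) *\<^sub>R emb N Y"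
      unfolding noise_def emb_smult[OF that, symmetric] by (rule emb_add) (use that Zc in auto)
    then show ?thesis using that Zc by (simp add: app_op superop_noise)
  qed
  have La: "?L a = b - a" and Lb: "?L b = a - b"
    using noise_emb[OF X] noise_emb[of "uconj Z X"] X Zc ZZ by (auto simp: a_def b_def)
  define g where "g s = (1/2) *\<^sub>R (a + b) + (exp ((-2) * s) / 2) *\<^sub>R (a - b)" for s :: real
  have "(g has_vector_derivative ?L (g s)) (at s within {0..t})" for s
  proof -
    have "((\<lambda>s. exp ((-2) * s) / 2) has_real_derivative - exp ((-2) * s)) (at s within {0..t})"
      by (auto intro!: derivative_eq_intros)
    from has_vector_derivative_add[OF has_vector_derivative_const has_vector_derivative_scaleR[OF this has_vector_derivative_const]]
    have "(g has_vector_derivative - (exp ((-2) * s) *\<^sub>R (a - b))) (at s within {0..t})" unfolding g_def by simp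
    moreover have "?L (g s) = - (exp ((-2) * s) *\<^sub>R (a - b))"
    proof -
      have "?L (g s) = (1/2) *\<^sub>R (?L a + ?L b) + (exp ((-2) * s) / 2) *\<^sub>R (?L a - ?L b)"
        by (simp add: g_def app.add_right app.scaleR_right app.diff_right)
      also have "\<dots> = (exp ((-2) * s) / 2) *\<^sub>R (- (2 *\<^sub>R (a - b)))"
        unfolding La Lb by (simp add: algebra_simps scaleR_2)
      finally show ?thesis by (simp only: scaleR_minus_right scaleR_scaleR) simp
    qed
    ultimately show ?thesis by simp
  qed
  from linear_ode_unique[OF this t] have "g t = app (exp (t *\<^sub>R op N (noise Z))) (g 0)" by simp
  moreover have "g 0 = a"
    by (simp add: g_def flip: scaleR_add_right)
  moreover have "g t = emb N (mix Z ((1 - exp (- (2 * t))) / 2) X)"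
  proof -
    have "g t = ((1 + exp (- (2 * t))) / 2) *\<^sub>R a + ((1 - exp (- (2 * t))) / 2) *\<^sub>R b"
      by (simp add: g_def algebra_simps add_divide_distrib diff_divide_distrib)
    moreover have "(1 + exp (- (2 * t))) / 2 = 1 - (1 - exp (- (2 * t))) / 2" by (simp add: field_simps)
    ultimately show ?thesis by (simp only: emb_mix[OF Zc X] a_def b_def)
  qed
  ultimately show ?thesis by (simp add: a_def)
qed

text \<open>Finite times give exactly the weights below 1/2; the weight 1/2 belongs to infinite
  noise time and comes from closedness of \<open>R\<close>.\<close>

lemma preserves_noise_imp_mix:
  assumes R: "closed R" and Z: "unitary N Z" "Z * Z = 1\<^sub>m N" and pres: "preserves R (op N (noise Z))"
    and X: "X \<in> carrier_mat N N" "emb N X \<in> R" and p: "0 \<le> p" "p \<le> 1/2"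
  shows "emb N (mix Z p X) \<in> R"
proof -
  have Zc: "Z \<in> carrier_mat N N" using Z by auto
  have lt: "emb N (mix Z q X) \<in> R" if q: "0 \<le> q" "q < 1/2" for q
  proof -
    define t where "t = - ln (1 - 2 * q) / 2"
    have "(1 - exp (- (2 * t))) / 2 = q" "0 \<le> t" using q by (auto simp: t_def)
    then show ?thesis using preservesD[OF pres \<open>0 \<le> t\<close> X(2)] exp_op_noise[OF Z X(1)] by simp
  qed
  \<comment> \<open>Weights that stay below 1/2 and tend to \<open>p\<close>, so that
    \<open>p = 1/2\<close> is covered as well.\<close>
  define q where "q k = p * (1 - 1 / real (Suc k))" for k
  have "q k < 1/2" "0 \<le> q k" for k
  proof -
    show "0 \<le> q k" using p by (simp add: q_def)
    show "q k < 1/2"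
    proof (cases "p = 0")
      case False
      then have "p * (1 - 1 / real (Suc k)) < p * 1" using p by (intro mult_strict_left_mono) auto
      then show ?thesis unfolding q_def using p by linarith
    qed (simp add: q_def)
  qed
  then have "\<And>k. (1 - q k) *\<^sub>R emb N X + q k *\<^sub>R emb N (uconj Z X) \<in> R"
    using lt emb_mix[OF Zc X(1)] by metis
  moreover have "q \<longlonglongrightarrow> p * (1 - 0)"
    unfolding q_def using LIMSEQ_inverse_real_of_nat by (intro tendsto_intros) (simp add: inverse_eq_divide)
  then have "(\<lambda>k. (1 - q k) *\<^sub>R emb N X + q k *\<^sub>R emb N (uconj Z X)) \<longlonglongrightarrow> (1 - p) *\<^sub>R emb N X + p *\<^sub>R emb N (uconj Z X)"
    by (intro tendsto_intros) auto
  ultimately show ?thesis unfolding emb_mix[OF Zc X(1)] by (rule closed_sequentially[OF R])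
qed

lemma mix_uconj:
  assumes "unitary N W" "Z \<in> carrier_mat N N" "X \<in> carrier_mat N N"
  shows "mix (uconj W Z) p X = uconj W (mix Z p (uconj (adj W) X))"
proof -
  have W: "W \<in> carrier_mat N N" "adj W \<in> carrier_mat N N" using assms by auto
  have "uconj (uconj W Z) X = uconj W (uconj Z (uconj (adj W) X))"
    unfolding uconj_def[of W Z] using W assms
    by (simp add: uconj_uconj[of _ N] assoc_mult_mat[of _ N N _ N _ N])
  then show ?thesis
    unfolding mix_def using W assms
    by (simp add: uconj_add[of _ N] uconj_smult[of _ N] uconj_inverse[OF assms(1,3)] uconj_carrier[of _ N N] del: of_real_diff)
qed

text \<open>Rotating by \<open>adj W\<close>, applying the noise and rotating back replaces
  \<open>Z\<close> by any of its unitary conjugates.\<close>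

lemma preserves_noise_imp_mix_uconj:
  assumes R: "closed R" "uinv N R" and Z: "unitary N Z" "Z * Z = 1\<^sub>m N" and pres: "preserves R (op N (noise Z))"
    and W: "unitary N W" and X: "X \<in> carrier_mat N N" "emb N X \<in> R" and p: "0 \<le> p" "p \<le> 1/2"
  shows "emb N (mix (uconj W Z) p X) \<in> R"
proof -
  have c: "Z \<in> carrier_mat N N" "adj W \<in> carrier_mat N N" using Z W by auto
  have "emb N (mix Z p (uconj (adj W) X)) \<in> R"
    by (rule preserves_noise_imp_mix[OF R(1) Z pres _ uinvD[OF R(2) unitary_adj[OF W] X] p]) (use c X in auto)
  moreover have "mix Z p (uconj (adj W) X) \<in> carrier_mat N N" using c X by (simp add: mix_def)
  ultimately show ?thesis
    unfolding mix_uconj[OF W c(1) X(1)] using uinvD[OF R(2) W] by blast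
qed

section \<open>The control system and the majorised states\<close>

text \<open>In the index convention of \<open>kron\<close> the last qubit is the lowest binary
  digit, so the bit flip exchanges \<open>2 * a\<close> and \<open>2 * a + 1\<close>.\<close>

definition flip :: "nat \<Rightarrow> nat" where
  "flip i = (if even i then Suc i else i - 1)"

lemma flip_flip [simp]: "flip (flip i) = i"
  by (auto simp: flip_def elim: oddE)

lemma flip_neq [simp]: "flip i \<noteq> i" "i \<noteq> flip i"
  by (auto simp: flip_def elim: oddE)

lemma flip_less: "even N \<Longrightarrow> i < N \<Longrightarrow> flip i < N"
  by (auto simp: flip_def elim!: evenE oddE)

lemma flip_iff: "j = flip i \<longleftrightarrow> i div 2 = j div 2 \<and> i mod 2 \<noteq> j mod 2"
proof (cases "even i")
  case True
  then obtain a where i: "i = 2 * a" by (elim evenE)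
  have "j = Suc (2 * a) \<longleftrightarrow> a = j div 2 \<and> odd j" by (auto elim: oddE)
  then show ?thesis using i by (auto simp: flip_def odd_iff_mod_2_eq_one)
next
  case False
  then obtain a where i: "i = 2 * a + 1" by (elim oddE)
  have "j = 2 * a \<longleftrightarrow> a = j div 2 \<and> even j" by (auto elim: evenE)
  then show ?thesis using i by (auto simp: flip_def even_iff_mod_2_eq_zero)
qed

definition flip_mat :: "nat \<Rightarrow> complex mat" where
  "flip_mat N = mat N N (\<lambda>(i,j). if j = flip i then 1 else 0)"

lemma flip_mat_carrier [simp]: "flip_mat N \<in> carrier_mat N N"
  by (simp add: flip_mat_def)

lemma flip_mat_index [simp]: "i < N \<Longrightarrow> j < N \<Longrightarrow> flip_mat N $$ (i,j) = (if j = flip i then 1 else 0)"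
  by (simp add: flip_mat_def)

lemma adj_flip_mat [simp]: "adj (flip_mat N) = flip_mat N"
  by (rule eq_matI) (auto simp: flip_mat_def)

lemma flip_mat_square:
  assumes "even N"
  shows "flip_mat N * flip_mat N = 1\<^sub>m N"
proof (rule eq_matI)
  fix i j assume "i < dim_row (1\<^sub>m N :: complex mat)" "j < dim_col (1\<^sub>m N :: complex mat)"
  then have ij: "i < N" "j < N" by auto
  have "(flip_mat N * flip_mat N) $$ (i,j) = (\<Sum>l<N. if l = flip i then (if i = j then 1 else 0) else 0)"
    unfolding mult_index[OF flip_mat_carrier flip_mat_carrier ij]
    by (intro sum.cong refl) (use ij in auto)
  then show "(flip_mat N * flip_mat N) $$ (i,j) = 1\<^sub>m N $$ (i,j)"
    using ij flip_less[OF assms] by simp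
qed (auto simp: flip_mat_def)

lemma unitary_flip_mat: "even N \<Longrightarrow> unitary N (flip_mat N)"
  by (simp add: unitary_def flip_mat_square)

lemma mtrace_flip_mat: "mtrace (flip_mat N) = 0"
  unfolding mtrace_def by (intro sum.neutral) (auto simp: flip_mat_def)

lemma V_b_eq:
  assumes "n \<ge> 1"
  shows "V_b n = complex_of_real (1 / sqrt 2) \<cdot>\<^sub>m flip_mat (2 ^ n)"
proof -
  have N: "2 ^ (n - 1) * 2 = (2::nat) ^ n" using assms by (cases n) auto
  have "kron (1\<^sub>m (2 ^ (n - 1))) pauliX = flip_mat (2 ^ n)"
  proof (rule eq_matI)
    fix i j assume "i < dim_row (flip_mat (2 ^ n))" "j < dim_col (flip_mat (2 ^ n))"
    then have ij: "i < 2 ^ n" "j < 2 ^ n" by (auto simp: flip_mat_def)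
    then have "i < 2 ^ (n - 1) * 2" "j < 2 ^ (n - 1) * 2" unfolding N .
    then show "kron (1\<^sub>m (2 ^ (n - 1))) pauliX $$ (i,j) = flip_mat (2 ^ n) $$ (i,j)"
      using ij by (auto simp: kron_def pauliX_def flip_iff)
  qed (use N in \<open>simp_all add: kron_def pauliX_def flip_mat_def\<close>)
  then show ?thesis by (simp add: V_b_def)
qed

text \<open>The bit flip is an involution, so \<open>adj (V_b n) * V_b n\<close> is half the
  identity. The two factors 1/sqrt 2 account for \<open>\<gamma> / 2\<close>.\<close>

lemma generator_eq:
  assumes n: "n \<ge> 1" and H: "H \<in> carrier_mat (2 ^ n) (2 ^ n)" and X: "X \<in> carrier_mat (2 ^ n) (2 ^ n)"
  shows "generator n H \<gamma> X
    = comm (- \<i> \<cdot>\<^sub>m H) X + complex_of_real (\<gamma> / 2) \<cdot>\<^sub>m noise (flip_mat (2 ^ n)) X"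
proof -
  define N where "N = (2::nat) ^ n"
  define Z where "Z = flip_mat N"
  have c: "H \<in> carrier_mat N N" "X \<in> carrier_mat N N" "Z \<in> carrier_mat N N"
    using H X by (simp_all add: N_def Z_def)
  have "even N" using n by (simp add: N_def)
  then have ZZ: "Z * Z = 1\<^sub>m N" by (simp add: Z_def flip_mat_square)
  have adjZ: "adj Z = Z" by (simp add: Z_def)
  define r where "r = complex_of_real (1 / sqrt 2)"
  have rr: "r * r = 1/2" "cnj r = r"
    unfolding r_def by (simp_all flip: of_real_mult)
  have V: "V_b n = r \<cdot>\<^sub>m Z" by (simp add: V_b_eq[OF n] r_def Z_def N_def)
  have aV: "adj (V_b n) = r \<cdot>\<^sub>m Z" unfolding V by (simp add: rr Z_def)
  have ss: "a \<cdot>\<^sub>m (b \<cdot>\<^sub>m M) = (a * b) \<cdot>\<^sub>m M" for a b :: complex and M by (rule eq_matI) auto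
  have 1: "V_b n * X * adj (V_b n) = (1/2) \<cdot>\<^sub>m uconj Z X"
    unfolding V aV using c
    by (simp add: mult_smult_distrib[of _ N N _ N] mult_smult_assoc_mat[of _ N N _ N] ss rr uconj_def Z_def)
  have 2: "adj (V_b n) * V_b n = (1/2) \<cdot>\<^sub>m 1\<^sub>m N"
    unfolding V aV using c
    by (simp add: mult_smult_distrib[of _ N N _ N] mult_smult_assoc_mat[of _ N N _ N] ss rr ZZ adjZ)
  have 3: "(1/2) \<cdot>\<^sub>m 1\<^sub>m N * X = (1/2) \<cdot>\<^sub>m X" "X * ((1/2) \<cdot>\<^sub>m 1\<^sub>m N) = (1/2) \<cdot>\<^sub>m X"
    using c by (simp_all add: mult_smult_distrib[of _ N N _ N] mult_smult_assoc_mat[of _ N N _ N])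
  have 4: "comm (- \<i> \<cdot>\<^sub>m H) X = - \<i> \<cdot>\<^sub>m comm H X" by (rule comm_smult_left[OF c(1,2)])
  have cc: "comm H X \<in> carrier_mat N N" "uconj Z X \<in> carrier_mat N N" using c by (auto intro: uconj_carrier[of _ N N])
  show ?thesis
    unfolding generator_def Gamma_b_def noise_def 1 2 3 4 N_def[symmetric] Z_def[symmetric]
    by (intro eq_matI) (use c(2) cc in \<open>auto simp: algebra_simps\<close>)
qed

lemma superop_cong:
  assumes "superop N M" "\<And>A. A \<in> carrier_mat N N \<Longrightarrow> M' A = M A"
  shows "superop N M'"
  using assms by (simp add: superop_def)

lemma superop_generator:
  assumes "n \<ge> 1" "H \<in> carrier_mat (2 ^ n) (2 ^ n)"
  shows "superop (2 ^ n) (generator n H \<gamma>)"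
  by (rule superop_cong[OF superop_add[OF superop_comm superop_smult[OF superop_noise]] generator_eq[OF assms]])
     (use assms in auto)

lemma op_generator:
  assumes "n \<ge> 1" "H \<in> carrier_mat (2 ^ n) (2 ^ n)"
  shows "op (2 ^ n) (generator n H \<gamma>)
    = op (2 ^ n) (comm (- \<i> \<cdot>\<^sub>m H)) + (\<gamma> / 2) *\<^sub>R op (2 ^ n) (noise (flip_mat (2 ^ n)))"
proof -
  have c: "superop (2 ^ n) (comm (- \<i> \<cdot>\<^sub>m H))" using assms(2) by (intro superop_comm) auto
  note nz = superop_noise[OF flip_mat_carrier, of "2 ^ n"]
  show ?thesis
    unfolding op_smult[OF nz, symmetric] op_add[OF c superop_smult[OF nz], symmetric]
    by (rule op_eqI[OF superop_generator[OF assms] superop_add[OF c superop_smult[OF nz]] generator_eq[OF assms]])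
qed

section \<open>Trajectories of the control system, closures and admissible Hamiltonians\<close>

lemma evolves_imp_exp:
  assumes L: "superop N L" and ev: "evolves N L t \<rho> \<rho>'"
  shows "\<rho> \<in> carrier_mat N N" "\<rho>' \<in> carrier_mat N N"
    "emb N \<rho>' = app (exp (t *\<^sub>R op N L)) (emb N \<rho>)"
proof -
  from ev obtain f where t: "0 \<le> t" and f: "f 0 = \<rho>" "f t = \<rho>'"
    "\<And>s. s \<in> {0..t} \<Longrightarrow> f s \<in> carrier_mat N N"
    "\<And>s i j. s \<in> {0..t} \<Longrightarrow> i < N \<Longrightarrow> j < N \<Longrightarrow>
      ((\<lambda>r. f r $$ (i,j)) has_vector_derivative (L (f s) $$ (i,j))) (at s within {0..t})"
    unfolding evolves_def by blast
  show "\<rho> \<in> carrier_mat N N" "\<rho>' \<in> carrier_mat N N" using f t by auto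
  have "((\<lambda>s. emb N (f s)) has_vector_derivative app (op N L) (emb N (f s))) (at s within {0..t})"
    if s: "s \<in> {0..t}" for s
    using has_vector_derivative_emb[OF f(4)[OF s]] f(3)[OF s] L by (simp add: app_op)
  from linear_ode_unique[OF this t] show "emb N \<rho>' = app (exp (t *\<^sub>R op N L)) (emb N \<rho>)"
    using f by simp
qed

lemma exp_imp_evolves:
  assumes L: "superop N L" and \<rho>: "\<rho> \<in> carrier_mat N N" and t: "0 \<le> t"
  shows "evolves N L t \<rho> (unemb N (app (exp (t *\<^sub>R op N L)) (emb N \<rho>)))"
proof -
  define f where "f s = unemb N (app (exp (s *\<^sub>R op N L)) (emb N \<rho>))" for s
  have "((\<lambda>r. f r $$ (i,j)) has_vector_derivative (L (f s) $$ (i,j))) (at s within {0..t})"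
    if "i < N" "j < N" for s i j
    using bounded_linear.has_vector_derivative[OF bounded_linear_apply_bcontfun[of "(i,j)"]
        app_exp_has_vector_derivative[of "op N L" "emb N \<rho>" s "{0..t}"]] that L
    by (simp add: f_def unemb_def app_op emb_apply)
  moreover have "f 0 = \<rho>" using \<rho> by (simp add: f_def)
  ultimately show ?thesis
    unfolding evolves_def using t
    by (intro conjI exI[of _ f]) (auto simp: f_def)
qed

lemma closed_blk: "closed (blk N)"
proof -
  have "blk N = {x. app (op N (\<lambda>A. A)) x = x}" by (simp add: blk_def app_op superop_id)
  also have "closed \<dots>" by (intro closed_Collect_eq continuous_intros app.continuous_on)
  finally show ?thesis .
qed

lemma emb_diff_entry_less:
  assumes "A \<in> carrier_mat N N" "B \<in> carrier_mat N N" "0 < e"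
  shows "dist (emb N A) (emb N B) < e \<Longrightarrow> i < N \<Longrightarrow> j < N \<Longrightarrow> cmod (A $$ (i,j) - B $$ (i,j)) < e"
  using norm_entry_le[of i N j "A - B"] assms by (simp add: dist_norm flip: emb_minus)

text \<open>Entrywise approximation is approximation in the sup norm, so the topological closure in
  \<open>cbfun\<close> can be used.\<close>

lemma mat_closure_eq:
  assumes "S \<subseteq> carrier_mat N N"
  shows "mat_closure N S = {\<rho> \<in> carrier_mat N N. emb N \<rho> \<in> closure (emb N ` S)}"
proof -
  have eq: "(\<forall>\<epsilon>>0. \<exists>\<sigma>\<in>S. \<forall>i<N. \<forall>j<N. cmod (\<sigma> $$ (i,j) - \<rho> $$ (i,j)) < \<epsilon>)
      \<longleftrightarrow> (\<forall>\<epsilon>>0. \<exists>\<sigma>\<in>S. dist (emb N \<sigma>) (emb N \<rho>) < \<epsilon>)" (is "?L \<longleftrightarrow> ?R")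
    if \<rho>: "\<rho> \<in> carrier_mat N N" for \<rho>
  proof
    assume ?L
    show ?R
    proof (intro allI impI)
      fix e :: real assume e: "0 < e"
      then obtain \<sigma> where \<sigma>: "\<sigma> \<in> S" "\<forall>i<N. \<forall>j<N. cmod (\<sigma> $$ (i,j) - \<rho> $$ (i,j)) < e / 2"
        using \<open>?L\<close> half_gt_zero by blast
      have "\<sigma> \<in> carrier_mat N N" using \<sigma>(1) assms by blast
      then have "dist (emb N \<sigma>) (emb N \<rho>) = norm (emb N (\<sigma> - \<rho>))" using \<rho> by (simp add: dist_norm emb_minus)
      also have "\<dots> \<le> e / 2"
        using \<sigma>(2) \<open>\<sigma> \<in> carrier_mat N N\<close> \<rho> e by (intro norm_emb_le) (auto intro: less_imp_le)
      finally show "\<exists>\<sigma>\<in>S. dist (emb N \<sigma>) (emb N \<rho>) < e" using \<sigma>(1) e by (intro bexI[of _ \<sigma>]) auto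
    qed
  next
    assume ?R
    show ?L
    proof (intro allI impI)
      fix e :: real assume e: "0 < e"
      then obtain \<sigma> where \<sigma>: "\<sigma> \<in> S" "dist (emb N \<sigma>) (emb N \<rho>) < e" using \<open>?R\<close> by blast
      have "\<sigma> \<in> carrier_mat N N" using \<sigma>(1) assms by blast
      from emb_diff_entry_less[OF this \<rho> e \<sigma>(2)]
      show "\<exists>\<sigma>\<in>S. \<forall>i<N. \<forall>j<N. cmod (\<sigma> $$ (i,j) - \<rho> $$ (i,j)) < e" using \<sigma>(1) by blast
    qed
  qed
  show ?thesis
    unfolding mat_closure_def closure_approachable bex_simps
    by (intro Collect_cong conj_cong refl eq)
qed

lemma preserves_closure:
  assumes "preserves S L"
  shows "preserves (closure S) L"
  unfolding preserves_def
proof (intro allI impI ballI)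
  fix t :: real and x assume t: "0 \<le> t" and "x \<in> closure S"
  then obtain f where f: "\<And>k::nat. f k \<in> S" "f \<longlonglongrightarrow> x" by (auto simp: closure_sequential)
  then have "(\<lambda>k. app (exp (t *\<^sub>R L)) (f k)) \<longlonglongrightarrow> app (exp (t *\<^sub>R L)) x"
    by (intro app.tendsto tendsto_const)
  then show "app (exp (t *\<^sub>R L)) x \<in> closure S"
    using preservesD[OF assms t f(1)]
    by (auto simp: closure_sequential intro!: exI[of _ "\<lambda>k. app (exp (t *\<^sub>R L)) (f k)"])
qed

lemma hermitian_ctrl_ham:
  assumes "hermitian N A" "\<forall>H\<in>set Hs. hermitian N H" "length us = length Hs"
  shows "hermitian N (ctrl_ham A Hs us)"
  using assms
proof (induction A Hs us rule: ctrl_ham.induct)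
  case (1 A H Hs u us)
  have "adj (A + complex_of_real u \<cdot>\<^sub>m H) = A + complex_of_real u \<cdot>\<^sub>m H"
    using 1(2,3) by (subst adj_add[of _ N N]) (auto simp: hermitian_def)
  then show ?case using 1 by (auto simp: hermitian_def)
qed auto

lemma ctrl_ham_zero:
  assumes "A \<in> carrier_mat N N" "\<forall>H\<in>set Hs. H \<in> carrier_mat N N"
  shows "ctrl_ham A Hs (replicate (length Hs) 0) = A"
  using assms(2)
proof (induction Hs)
  case (Cons H Hs)
  have "A + complex_of_real 0 \<cdot>\<^sub>m H = A" using assms(1) Cons(2) by (intro eq_matI) auto
  then show ?case using Cons by simp
qed simp

text \<open>Amplitude 1 at one occurrence of \<open>K\<close> and 0 elsewhere. It serves to isolate
  \<open>K\<close> as a difference of two admissible Hamiltonians.\<close>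

lemma ctrl_ham_single:
  assumes "A \<in> carrier_mat N N" "\<forall>H\<in>set Hs. H \<in> carrier_mat N N" "K \<in> set Hs"
  obtains us where "length us = length Hs" "ctrl_ham A Hs us = A + K"
  using assms(2,3)
proof (induction Hs arbitrary: thesis)
  case (Cons H Hs)
  have H: "H \<in> carrier_mat N N" using Cons by auto
  show ?case
  proof (cases "K = H")
    case True
    have "A + complex_of_real 1 \<cdot>\<^sub>m H = A + H" using assms(1) H by (intro eq_matI) auto
    then have "ctrl_ham A (H # Hs) (1 # replicate (length Hs) 0) = A + K"
      using ctrl_ham_zero[of "A + H" N Hs] assms(1) H Cons True by simp
    then show ?thesis by (intro Cons(2)[of "1 # replicate (length Hs) 0"]) simp_all
  next
    case False
    then obtain us where us: "length us = length Hs" "ctrl_ham A Hs us = A + K"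
      using Cons(1) Cons(3,4) by auto
    have "A + complex_of_real 0 \<cdot>\<^sub>m H = A" using assms(1) H by (intro eq_matI) auto
    then show ?thesis using us by (intro Cons(2)[of "0 # us"]) simp_all
  qed
qed simp

text \<open>A description of the majorised states that avoids eigenvalues of \<open>X\<close>. For
  fixed \<open>U\<close> each condition is affine and closed in \<open>X\<close>, which makes
  convexity and closedness visible; letting \<open>U\<close> run over the whole group gives unitary
  invariance.\<close>

definition ky_set :: "nat \<Rightarrow> (nat \<Rightarrow> real) \<Rightarrow> complex mat set" where
  "ky_set N a = {X \<in> pos1 N. \<forall>U k. unitary N U \<longrightarrow> k \<le> N \<longrightarrow> (\<Sum>i<k. Re (uconj U X $$ (i,i))) \<le> (\<Sum>j<k. a j)}"

lemma pos1_carrier: "X \<in> pos1 N \<Longrightarrow> X \<in> carrier_mat N N"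
  by (simp add: pos1_def psd_def hermitian_def)

lemma ky_set_carrier: "X \<in> ky_set N a \<Longrightarrow> X \<in> carrier_mat N N"
  by (simp add: ky_set_def pos1_carrier)

lemma ky_set_uconj:
  assumes X: "X \<in> ky_set N a" and U: "unitary N U"
  shows "uconj U X \<in> ky_set N a"
proof -
  have c: "X \<in> carrier_mat N N" "U \<in> carrier_mat N N" using X U by (auto intro: ky_set_carrier)
  have "uconj U X \<in> pos1 N"
    using X c by (simp add: ky_set_def pos1_def psd_uconj mtrace_uconj[OF U])
  moreover have "(\<Sum>i<k. Re (uconj V (uconj U X) $$ (i,i))) \<le> (\<Sum>j<k. a j)" if "unitary N V" "k \<le> N" for V k
    using X that c unitary_mult[OF that(1) U] uconj_uconj[OF unitary_carrier[OF that(1)] c(2,1)]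
    by (simp add: ky_set_def)
  ultimately show ?thesis by (simp add: ky_set_def)
qed

lemma ky_set_convex:
  assumes X: "X \<in> ky_set N a" and Y: "Y \<in> ky_set N a" and p: "0 \<le> p" "p \<le> 1"
  shows "complex_of_real (1 - p) \<cdot>\<^sub>m X + complex_of_real p \<cdot>\<^sub>m Y \<in> ky_set N a" (is "?M \<in> _")
proof -
  have c: "X \<in> carrier_mat N N" "Y \<in> carrier_mat N N" using X Y by (auto intro: ky_set_carrier)
  have h: "adj X = X" "adj Y = Y" using X Y by (auto simp: ky_set_def pos1_def psd_def hermitian_def)
  have M: "?M $$ (i,j) = complex_of_real (1 - p) * X $$ (i,j) + complex_of_real p * Y $$ (i,j)" if "i < N" "j < N" for i j
    using that c by simp
  have "adj ?M = ?M" using c h by (subst adj_add[of _ N N]) auto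
  moreover have "0 \<le> Re (\<Sum>i<N. \<Sum>j<N. cnj (v i) * ?M $$ (i,j) * v j)" for v
  proof -
    have "(\<Sum>i<N. \<Sum>j<N. cnj (v i) * ?M $$ (i,j) * v j)
        = (\<Sum>i<N. \<Sum>j<N. complex_of_real (1 - p) * (cnj (v i) * X $$ (i,j) * v j) + complex_of_real p * (cnj (v i) * Y $$ (i,j) * v j))"
      by (intro sum.cong refl) (simp add: M algebra_simps del: index_add_mat(1) of_real_diff)
    also have "\<dots> = complex_of_real (1 - p) * (\<Sum>i<N. \<Sum>j<N. cnj (v i) * X $$ (i,j) * v j)
        + complex_of_real p * (\<Sum>i<N. \<Sum>j<N. cnj (v i) * Y $$ (i,j) * v j)"
      by (simp only: sum.distrib sum_distrib_left)
    also have "Re \<dots> = (1 - p) * Re (\<Sum>i<N. \<Sum>j<N. cnj (v i) * X $$ (i,j) * v j)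
        + p * Re (\<Sum>i<N. \<Sum>j<N. cnj (v i) * Y $$ (i,j) * v j)"
    proof -
      have "Re (complex_of_real c * z + complex_of_real d * w) = c * Re z + d * Re w" for c d z w by simp
      then show ?thesis .
    qed
    also have "\<dots> \<ge> 0"
    proof (intro add_nonneg_nonneg mult_nonneg_nonneg)
      show "0 \<le> Re (\<Sum>i<N. \<Sum>j<N. cnj (v i) * X $$ (i,j) * v j)"
        using X unfolding ky_set_def pos1_def psd_def by blast
      show "0 \<le> Re (\<Sum>i<N. \<Sum>j<N. cnj (v i) * Y $$ (i,j) * v j)"
        using Y unfolding ky_set_def pos1_def psd_def by blast
    qed (use p in auto)
    finally show ?thesis .
  qed
  ultimately have "psd N ?M" using c by (simp add: psd_def hermitian_def)
  moreover have "mtrace ?M = 1"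
  proof -
    have "mtrace ?M = complex_of_real (1 - p) * mtrace X + complex_of_real p * mtrace Y"
      using c by (simp add: mtrace_def sum.distrib sum_distrib_left)
    then show ?thesis using X Y by (simp add: ky_set_def pos1_def)
  qed
  moreover have "(\<Sum>i<k. Re (uconj U ?M $$ (i,i))) \<le> (\<Sum>j<k. a j)" if U: "unitary N U" and k: "k \<le> N" for U k
  proof -
    have Uc: "U \<in> carrier_mat N N" using U by auto
    have "uconj U ?M = complex_of_real (1 - p) \<cdot>\<^sub>m uconj U X + complex_of_real p \<cdot>\<^sub>m uconj U Y"
      using Uc c by (simp add: uconj_add[of _ N] uconj_smult[of _ N] del: of_real_diff)
    moreover have "uconj U X \<in> carrier_mat N N" "uconj U Y \<in> carrier_mat N N"
      using Uc c by (auto intro: uconj_carrier[of _ N N])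
    ultimately have "Re (uconj U ?M $$ (i,i)) = (1 - p) * Re (uconj U X $$ (i,i)) + p * Re (uconj U Y $$ (i,i))" if "i < k" for i
      using that k by simp
    then have "(\<Sum>i<k. Re (uconj U ?M $$ (i,i))) = (1 - p) * (\<Sum>i<k. Re (uconj U X $$ (i,i))) + p * (\<Sum>i<k. Re (uconj U Y $$ (i,i)))"
      by (simp add: sum.distrib sum_distrib_left)
    also have "\<dots> \<le> (1 - p) * (\<Sum>j<k. a j) + p * (\<Sum>j<k. a j)"
      using X Y p U k by (intro add_mono mult_left_mono) (auto simp: ky_set_def)
    finally show ?thesis by (simp add: algebra_simps)
  qed
  ultimately show ?thesis by (simp add: ky_set_def pos1_def)
qed

lemma closed_emb_ky_set: "closed (emb N ` ky_set N a)"
  unfolding closed_sequential_limits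
proof (intro allI impI)
  fix y x assume *: "(\<forall>k. y k \<in> emb N ` ky_set N a) \<and> y \<longlonglongrightarrow> x"
  then have lim: "y \<longlonglongrightarrow> x" by blast
  have "\<forall>k. y k \<in> blk N"
  proof
    fix k
    obtain W where "W \<in> ky_set N a" "y k = emb N W" using * by blast
    then show "y k \<in> blk N" by (simp add: ky_set_carrier)
  qed
  then have "x \<in> blk N" using closed_sequentially[OF closed_blk _ lim] by blast
  then obtain X where X: "X \<in> carrier_mat N N" "x = emb N X" by (rule blkE)
  define Y where "Y k = unemb N (y k)" for k
  have Y: "Y k \<in> ky_set N a" "y k = emb N (Y k)" for k
  proof -
    obtain W where "W \<in> ky_set N a" "y k = emb N W" using * by blast
    then show "Y k \<in> ky_set N a" "y k = emb N (Y k)" by (simp_all add: Y_def ky_set_carrier)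
  qed
  have L: "(\<lambda>k. Y k $$ (i,j)) \<longlonglongrightarrow> X $$ (i,j)" if "i < N" "j < N" for i j
    using bounded_linear.tendsto[OF bounded_linear_apply_bcontfun[of "(i,j)"] lim] that
    by (simp add: X(2) Y(2) emb_apply)
  have Yc: "Y k \<in> carrier_mat N N" for k using Y(1) by (rule ky_set_carrier)
  have "X \<in> ky_set N a"
  proof -
    have herm: "adj X = X"
    proof (rule eq_matI)
      fix i j assume "i < dim_row X" "j < dim_col X"
      then have ij: "i < N" "j < N" using X by auto
      have "cnj (Y k $$ (j,i)) = Y k $$ (i,j)" for k
      proof -
        have "adj (Y k) = Y k" using Y(1)[of k] by (simp add: ky_set_def pos1_def psd_def hermitian_def)
        then show ?thesis using adj_index[of i "Y k" j] Yc[of k] ij by simp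
      qed
      then have "(\<lambda>k. Y k $$ (i,j)) \<longlonglongrightarrow> cnj (X $$ (j,i))" using tendsto_cnj[OF L[OF ij(2,1)]] by simp
      then show "adj X $$ (i,j) = X $$ (i,j)" using LIMSEQ_unique[OF _ L[OF ij]] X(1) ij by simp
    qed (use X in auto)
    moreover have "0 \<le> Re (\<Sum>i<N. \<Sum>j<N. cnj (v i) * X $$ (i,j) * v j)" for v
    proof (rule LIMSEQ_le_const)
      show "(\<lambda>k. Re (\<Sum>i<N. \<Sum>j<N. cnj (v i) * Y k $$ (i,j) * v j)) \<longlonglongrightarrow> Re (\<Sum>i<N. \<Sum>j<N. cnj (v i) * X $$ (i,j) * v j)"
        by (intro tendsto_Re tendsto_sum tendsto_mult tendsto_const L) auto
      show "\<exists>m. \<forall>k\<ge>m. 0 \<le> Re (\<Sum>i<N. \<Sum>j<N. cnj (v i) * Y k $$ (i,j) * v j)"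
        using Y(1) by (simp add: ky_set_def pos1_def psd_def)
    qed
    ultimately have "psd N X" using X(1) by (simp add: psd_def hermitian_def)
    moreover have "mtrace X = 1"
    proof (rule LIMSEQ_unique)
      show "(\<lambda>k. \<Sum>i<N. Y k $$ (i,i)) \<longlonglongrightarrow> mtrace X"
        using X(1) by (simp add: mtrace_def) (intro tendsto_sum L, auto)
      have "(\<Sum>i<N. Y k $$ (i,i)) = 1" for k
        using Y(1)[of k] Yc[of k] by (simp add: ky_set_def pos1_def mtrace_def)
      then show "(\<lambda>k. \<Sum>i<N. Y k $$ (i,i)) \<longlonglongrightarrow> 1" by simp
    qed
    moreover have "(\<Sum>i<k. Re (uconj U X $$ (i,i))) \<le> (\<Sum>j<k. a j)" if U: "unitary N U" and k: "k \<le> N" for U k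
    proof (rule LIMSEQ_le_const2)
      have "(\<lambda>m. Re (uconj U (Y m) $$ (i,i))) \<longlonglongrightarrow> Re (uconj U X $$ (i,i))" if "i < N" for i
        using that X(1) Yc unitary_carrier[OF U]
        by (simp add: uconj_index) (intro tendsto_intros L, auto)
      then show "(\<lambda>m. \<Sum>i<k. Re (uconj U (Y m) $$ (i,i))) \<longlonglongrightarrow> (\<Sum>i<k. Re (uconj U X $$ (i,i)))"
        using k by (intro tendsto_sum) auto
      show "\<exists>M. \<forall>m\<ge>M. (\<Sum>i<k. Re (uconj U (Y m) $$ (i,i))) \<le> (\<Sum>j<k. a j)"
        using Y(1) U k by (simp add: ky_set_def)
    qed
    ultimately show ?thesis by (simp add: ky_set_def pos1_def)
  qed
  then show "x \<in> emb N ` ky_set N a" using X(2) by blast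
qed

section \<open>Majorisation in terms of Ky Fan sums\<close>

lemma sum_list_take_eq: "k \<le> length xs \<Longrightarrow> sum_list (take k xs) = (\<Sum>i<k. xs ! i)"
  for xs :: "'a::comm_monoid_add list"
  by (simp add: sum_list_sum_nth lessThan_atLeast0)

lemma eigvals_desc_antimono:
  assumes "hermitian N A" "i \<le> j" "j < N"
  shows "eigvals_desc A ! j \<le> eigvals_desc A ! i"
proof (cases "i = j")
  case False
  obtain P where "unitary N P" "A = uconj P (dg N (\<lambda>i. complex_of_real (eigvals_desc A ! i)))"
    "length (eigvals_desc A) = N" "sorted_wrt (\<ge>) (eigvals_desc A)"
    by (rule eigvals_desc_hermitian[OF assms(1)])
  then show ?thesis using sorted_wrt_nth_less[of "(\<ge>)" "eigvals_desc A" i j] assms False by simp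
qed simp

lemma sum_eigvals_desc:
  assumes "A \<in> pos1 N"
  shows "(\<Sum>i<N. eigvals_desc A ! i) = 1"
proof -
  have h: "hermitian N A" "mtrace A = 1" using assms by (auto simp: pos1_def psd_def)
  obtain P where P: "unitary N P" "A = uconj P (dg N (\<lambda>i. complex_of_real (eigvals_desc A ! i)))"
    using eigvals_desc_hermitian[OF h(1)] by metis
  have "complex_of_real (\<Sum>i<N. eigvals_desc A ! i) = mtrace A"
    by (subst (2) P(2)) (simp add: mtrace_uconj[OF P(1)])
  then show ?thesis using h(2) of_real_eq_1_iff by metis
qed

text \<open>Both spectra have length \<open>N\<close> and, by the trace, total 1, which leaves the
  partial sums.\<close>

lemma majorised_iff:
  assumes "\<rho> \<in> pos1 N" "\<sigma> \<in> pos1 N"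
  shows "\<rho> \<prec> \<sigma> \<longleftrightarrow> (\<forall>k\<le>N. (\<Sum>i<k. eigvals_desc \<rho> ! i) \<le> (\<Sum>i<k. eigvals_desc \<sigma> ! i))"
proof -
  have "hermitian N \<rho>" "hermitian N \<sigma>" using assms by (auto simp: pos1_def psd_def)
  then have len: "length (eigvals_desc \<rho>) = N" "length (eigvals_desc \<sigma>) = N"
    by (metis eigvals_desc_hermitian)+
  have "sum_list (eigvals_desc \<rho>) = 1" "sum_list (eigvals_desc \<sigma>) = 1"
    using sum_eigvals_desc[OF assms(1)] sum_eigvals_desc[OF assms(2)] len
    by (simp_all add: sum_list_sum_nth lessThan_atLeast0)
  then show ?thesis
    unfolding majorised_def Let_def using len by (auto simp: sum_list_take_eq)
qed

text \<open>One direction is Ky Fan's inequality. For the other, the unitary that diagonalises the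
  state in decreasing order attains its partial sums on the diagonal.\<close>

lemma majorised_set_eq_ky_set:
  assumes "\<rho>0 \<in> pos1 N"
  shows "{\<rho> \<in> pos1 N. \<rho> \<prec> \<rho>0} = ky_set N (\<lambda>i. eigvals_desc \<rho>0 ! i)"
proof -
  have "\<rho> \<prec> \<rho>0 \<longleftrightarrow> (\<forall>U k. unitary N U \<longrightarrow> k \<le> N \<longrightarrow> (\<Sum>i<k. Re (uconj U \<rho> $$ (i,i))) \<le> (\<Sum>j<k. eigvals_desc \<rho>0 ! j))"
    (is "?L \<longleftrightarrow> ?R") if \<rho>: "\<rho> \<in> pos1 N" for \<rho>
  proof -
    have h: "hermitian N \<rho>" using \<rho> by (simp add: pos1_def psd_def)
    obtain P where P: "unitary N P" "\<rho> = uconj P (dg N (\<lambda>i. complex_of_real (eigvals_desc \<rho> ! i)))"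
      using eigvals_desc_hermitian[OF h] by metis
    show ?thesis
    proof
      assume ?L
      then have m: "\<And>k. k \<le> N \<Longrightarrow> (\<Sum>i<k. eigvals_desc \<rho> ! i) \<le> (\<Sum>i<k. eigvals_desc \<rho>0 ! i)"
        by (simp add: majorised_iff[OF \<rho> assms])
      have "(\<Sum>i<k. Re (uconj U \<rho> $$ (i,i))) \<le> (\<Sum>j<k. eigvals_desc \<rho> ! j)" if "unitary N U" "k \<le> N" for U k
      proof -
        have "(\<Sum>i<k. Re (uconj U (uconj P (dg N (\<lambda>i. complex_of_real (eigvals_desc \<rho> ! i)))) $$ (i,i)))
            \<le> (\<Sum>j<k. eigvals_desc \<rho> ! j)"
          by (rule ky_fan_le[OF P(1) that]) (rule eigvals_desc_antimono[OF h])
        then show ?thesis by (simp only: P(2)[symmetric])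
      qed
      with m show ?R by (meson order_trans)
    next
      assume R: ?R
      have "uconj (adj P) \<rho> = dg N (\<lambda>i. complex_of_real (eigvals_desc \<rho> ! i))"
        using uconj_inverse(1)[OF P(1) dg_carrier] P(2) by metis
      then have "(\<Sum>i<k. eigvals_desc \<rho> ! i) = (\<Sum>i<k. Re (uconj (adj P) \<rho> $$ (i,i)))" if "k \<le> N" for k
        using that by simp
      then show ?L using R unitary_adj[OF P(1)] by (simp add: majorised_iff[OF \<rho> assms])
    qed
  qed
  then show ?thesis by (auto simp: ky_set_def)
qed

section \<open>Reachability by averaging eigenvalues\<close>

text \<open>If \<open>f i < g i\<close>, then \<open>f\<close> is -1 from \<open>i\<close> on and
  \<open>g\<close> is 1 up to \<open>i\<close>, so \<open>f \<le> g\<close> everywhere and the sums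
  differ. The sequences will be the sorted spectra of two traceless involutions.\<close>

lemma sign_antimono_unique:
  fixes a b :: "nat \<Rightarrow> real"
  assumes a: "\<And>i. i < N \<Longrightarrow> a i = 1 \<or> a i = -1" "\<And>i j. i \<le> j \<Longrightarrow> j < N \<Longrightarrow> a j \<le> a i"
    and b: "\<And>i. i < N \<Longrightarrow> b i = 1 \<or> b i = -1" "\<And>i j. i \<le> j \<Longrightarrow> j < N \<Longrightarrow> b j \<le> b i"
    and sum: "(\<Sum>i<N. a i) = (\<Sum>i<N. b i)" and i: "i < N"
  shows "a i = b i"
proof -
  have less: False
    if f: "\<And>i. i < N \<Longrightarrow> f i = 1 \<or> f i = -1" "\<And>i j. i \<le> j \<Longrightarrow> j < N \<Longrightarrow> f j \<le> f i"
      and g: "\<And>i. i < N \<Longrightarrow> g i = 1 \<or> g i = -1" "\<And>i j. i \<le> j \<Longrightarrow> j < N \<Longrightarrow> g j \<le> g i"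
      and s: "(\<Sum>i<N. f i) = (\<Sum>i<N. g i)" and lt: "f i < g i" for f g :: "nat \<Rightarrow> real"
  proof -
    have fg: "f i = -1" "g i = 1" using lt f(1)[OF i] g(1)[OF i] by auto
    have "f j \<le> g j" if j: "j < N" for j
    proof (cases "j \<le> i")
      case True
      then have "g j = 1" using g(2)[OF True i] g(1)[OF j] fg by auto
      then show ?thesis using f(1)[OF j] by auto
    next
      case False
      then have "f j = -1" using f(2)[of i j] f(1)[OF j] fg j by auto
      then show ?thesis using g(1)[OF j] by auto
    qed
    then have "(\<Sum>i<N. f i) < (\<Sum>i<N. g i)" using i lt by (intro sum_strict_mono_ex1) auto
    with s show False by simp
  qed
  show ?thesis using less[OF a b sum] less[OF b a sum[symmetric]] by (meson linorder_neqE)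
qed

lemma involution_eigvals:
  assumes h: "hermitian N A" and sq: "A * A = 1\<^sub>m N" and i: "i < N"
  shows "eigvals_desc A ! i = 1 \<or> eigvals_desc A ! i = -1"
proof -
  define e where "e i = eigvals_desc A ! i" for i
  obtain P where P: "unitary N P" "A = uconj P (dg N (\<lambda>i. complex_of_real (e i)))"
    unfolding e_def by (rule eigvals_desc_hermitian[OF h])
  have c: "A \<in> carrier_mat N N" "adj P \<in> carrier_mat N N" using h P by (auto simp: hermitian_def)
  have "dg N (\<lambda>i. complex_of_real (e i)) = uconj (adj P) A"
    unfolding P(2) by (rule uconj_inverse(1)[OF P(1) dg_carrier, symmetric])
  then have "dg N (\<lambda>i. complex_of_real (e i)) * dg N (\<lambda>i. complex_of_real (e i)) = uconj (adj P) (1\<^sub>m N)"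
    using uconj_mult[OF unitary_adj[OF P(1)] c(1,1)] sq by simp
  also have "\<dots> = 1\<^sub>m N" using P by (simp add: uconj_def right_mult_one_mat[OF c(2)] unitary_adj_mult)
  finally have "complex_of_real (e i) * complex_of_real (e i) = 1"
    unfolding dg_mult using i by (metis dg_index index_one_mat(1))
  then have "e i * e i = 1" by (metis of_real_eq_1_iff of_real_mult)
  then show ?thesis unfolding e_def[symmetric] by (simp add: square_eq_1_iff)
qed

text \<open>Both spectra contain as many 1 as -1, so the sorted diagonal forms agree. It allows the
  bit flip to be replaced by an involution suited to a chosen pair of eigenvalues.\<close>

lemma traceless_involutions_equivalent:
  assumes A: "hermitian N A" "A * A = 1\<^sub>m N" "mtrace A = 0"
    and B: "hermitian N B" "B * B = 1\<^sub>m N" "mtrace B = 0"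
  obtains W where "unitary N W" "A = uconj W B"
proof -
  define a where "a i = eigvals_desc A ! i" for i
  define b where "b i = eigvals_desc B ! i" for i
  obtain P where P: "unitary N P" "A = uconj P (dg N (\<lambda>i. complex_of_real (a i)))"
    unfolding a_def by (rule eigvals_desc_hermitian[OF A(1)])
  obtain Q where Q: "unitary N Q" "B = uconj Q (dg N (\<lambda>i. complex_of_real (b i)))"
    unfolding b_def by (rule eigvals_desc_hermitian[OF B(1)])
  have "complex_of_real (\<Sum>i<N. a i) = 0" "complex_of_real (\<Sum>i<N. b i) = 0"
    using A(3) B(3) P(2) Q(2) mtrace_uconj[OF P(1) dg_carrier] mtrace_uconj[OF Q(1) dg_carrier] by simp_all
  then have sums: "(\<Sum>i<N. a i) = (\<Sum>i<N. b i)" by (metis of_real_eq_0_iff)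
  have ab: "a i = b i" if "i < N" for i
    using involution_eigvals[OF A(1,2)] eigvals_desc_antimono[OF A(1)]
      involution_eigvals[OF B(1,2)] eigvals_desc_antimono[OF B(1)] sums that
    unfolding a_def b_def by (rule sign_antimono_unique)
  then have D: "dg N (\<lambda>i. complex_of_real (a i)) = dg N (\<lambda>i. complex_of_real (b i))" by (auto intro: dg_cong)
  have c: "P \<in> carrier_mat N N" "adj Q \<in> carrier_mat N N" "B \<in> carrier_mat N N"
    using P Q B by (auto simp: hermitian_def)
  have "dg N (\<lambda>i. complex_of_real (b i)) = uconj (adj Q) B"
    unfolding Q(2) by (rule uconj_inverse(1)[OF Q(1) dg_carrier, symmetric])
  then have "A = uconj P (uconj (adj Q) B)" using P(2) D by simp
  also have "\<dots> = uconj (P * adj Q) B" by (rule uconj_uconj[OF c])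
  finally show ?thesis using that unitary_mult[OF P(1) unitary_adj[OF Q(1)]] by blast
qed

text \<open>Half of the other \<open>N - 2\<close> indices, an even number, receive the sign
  -1.\<close>

lemma balanced_signs:
  assumes N: "even N" and jk: "j < N" "k < N" "j \<noteq> k"
  obtains \<epsilon> :: "nat \<Rightarrow> real" where "\<And>i. \<epsilon> i = 1 \<or> \<epsilon> i = -1" "\<epsilon> j = 1" "\<epsilon> k = 1"
    "(\<Sum>i\<in>{..<N}-{j,k}. \<epsilon> i) = 0"
proof -
  define S where "S = {..<N} - {j,k}"
  have cS: "card S = N - 2" using jk by (simp add: S_def card_Diff_subset)
  have N2: "N \<ge> 2" using jk by linarith
  obtain m where m: "N - 2 = 2 * m" using N by (metis dvdE dvd_diff_nat dvd_refl)
  obtain B where B: "B \<subseteq> S" "card B = m" using obtain_subset_with_card_n[of m S] cS m by auto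
  define \<epsilon> :: "nat \<Rightarrow> real" where "\<epsilon> i = (if i \<in> S - B then -1 else 1)" for i
  have fin: "finite S" "finite B" using B(1) finite_subset[of B S] by (auto simp: S_def)
  have "(\<Sum>i\<in>S. \<epsilon> i) = (\<Sum>i\<in>S - B. \<epsilon> i) + (\<Sum>i\<in>B. \<epsilon> i)"
    by (rule sum.subset_diff[OF B(1) fin(1)])
  also have "\<dots> = - real (card (S - B)) + real (card B)"
    by (simp add: \<epsilon>_def)
  also have "\<dots> = 0" using B fin cS m by (simp add: card_Diff_subset)
  finally show ?thesis by (intro that[of \<epsilon>]) (auto simp: \<epsilon>_def S_def)
qed

text \<open>
  Averaging two eigenvalues. The reflection that swaps \<open>j\<close> and \<open>k\<close> can be completed by signs on the
  other basis vectors to a traceless one, which is unitarily equivalent to the bit flip.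
\<close>

lemma emb_average_two_in:
  assumes R: "closed R" "uinv N R" and N: "even N" and pres: "preserves R (op N (noise (flip_mat N)))"
    and s: "emb N (dg N (\<lambda>i. complex_of_real (s i))) \<in> R"
    and jk: "j < N" "k < N" "j \<noteq> k" and p: "0 \<le> p" "p \<le> 1/2"
  shows "emb N (dg N (\<lambda>i. complex_of_real ((s(j := (1 - p) * s j + p * s k, k := (1 - p) * s k + p * s j)) i))) \<in> R"
proof -
  obtain \<epsilon> :: "nat \<Rightarrow> real" where \<epsilon>: "\<And>i. \<epsilon> i = 1 \<or> \<epsilon> i = -1" "\<epsilon> j = 1" "\<epsilon> k = 1"
    "(\<Sum>i\<in>{..<N}-{j,k}. \<epsilon> i) = 0" using balanced_signs[OF N jk] by metis
  define \<pi> where "\<pi> i = (if i = j then k else if i = k then j else i)" for i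
  have \<pi>: "\<pi> (\<pi> i) = i" "i < N \<Longrightarrow> \<pi> i < N" "\<epsilon> (\<pi> i) = \<epsilon> i" "\<epsilon> i * \<epsilon> i = 1" for i
    using \<epsilon>(1)[of i] \<epsilon>(2,3) jk by (auto simp: \<pi>_def)
  have \<pi>_inj: "\<pi> a = \<pi> b \<longleftrightarrow> a = b" for a b using \<pi>(1) by metis
  \<comment> \<open>A signed permutation matrix. The signs at \<open>j\<close> and \<open>k\<close>
    agree, which makes it Hermitian with square 1.\<close>
  define Z where "Z = mat N N (\<lambda>(a,b). if b = \<pi> a then complex_of_real (\<epsilon> a) else 0)"
  have Zc: "Z \<in> carrier_mat N N" by (simp add: Z_def)
  have Zi: "Z $$ (a,b) = (if b = \<pi> a then complex_of_real (\<epsilon> a) else 0)" if "a < N" "b < N" for a b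
    using that by (simp add: Z_def)
  have "adj Z = Z"
  proof (rule eq_matI)
    fix a b assume "a < dim_row Z" "b < dim_col Z"
    then have ab: "a < N" "b < N" using Zc by auto
    have "a = \<pi> b \<longleftrightarrow> b = \<pi> a" using \<pi>(1) by metis
    then show "adj Z $$ (a,b) = Z $$ (a,b)" using ab Zc \<pi>(3)[of a] by (auto simp: Zi)
  qed (use Zc in auto)
  then have h: "hermitian N Z" using Zc by (simp add: hermitian_def)
  have ZZ: "Z * Z = 1\<^sub>m N"
  proof (rule eq_matI)
    fix a b assume "a < dim_row (1\<^sub>m N :: complex mat)" "b < dim_col (1\<^sub>m N :: complex mat)"
    then have ab: "a < N" "b < N" by auto
    have "(Z * Z) $$ (a,b) = (\<Sum>l<N. if l = \<pi> a then (if b = a then complex_of_real (\<epsilon> a * \<epsilon> a) else 0) else 0)"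
      unfolding mult_index[OF Zc Zc ab] by (intro sum.cong refl) (use ab \<pi> in \<open>auto simp: Zi simp flip: of_real_mult\<close>)
    then show "(Z * Z) $$ (a,b) = 1\<^sub>m N $$ (a,b)" using ab \<pi>(2,4) by simp
  qed (use Zc in auto)
  \<comment> \<open>The swapped indices contribute nothing to the diagonal, and the other signs are
    balanced.\<close>
  have "mtrace Z = (\<Sum>a<N. if a \<in> {j,k} then 0 else complex_of_real (\<epsilon> a))"
    unfolding mtrace_def using Zc jk
    by (intro sum.cong) (auto simp: Zi \<pi>_def)
  also have "\<dots> = complex_of_real (\<Sum>a\<in>{..<N}-{j,k}. \<epsilon> a)"
    unfolding of_real_sum by (rule sum.mono_neutral_cong_right) auto
  finally have tr: "mtrace Z = 0" using \<epsilon>(4) by simp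
  have hf: "hermitian N (flip_mat N)" by (simp add: hermitian_def)
  obtain W where W: "unitary N W" "Z = uconj W (flip_mat N)"
    using traceless_involutions_equivalent[OF h ZZ tr hf flip_mat_square[OF N] mtrace_flip_mat] by blast
  have in_R: "emb N (mix Z p (dg N (\<lambda>i. complex_of_real (s i)))) \<in> R"
    unfolding W(2)
    by (rule preserves_noise_imp_mix_uconj[OF R unitary_flip_mat[OF N] flip_mat_square[OF N] pres W(1) dg_carrier s p])
  have "mix Z p (dg N (\<lambda>i. complex_of_real (s i)))
      = dg N (\<lambda>i. complex_of_real ((s(j := (1 - p) * s j + p * s k, k := (1 - p) * s k + p * s j)) i))" (is "_ = dg N ?s")
  proof (rule eq_matI)
    fix a b assume "a < dim_row (dg N ?s)" "b < dim_col (dg N ?s)"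
    then have ab: "a < N" "b < N" by auto
    \<comment> \<open>The sign of each row enters twice and cancels, so conjugation by
      \<open>Z\<close> only permutes the diagonal.\<close>
    have "uconj Z (dg N (\<lambda>i. complex_of_real (s i))) $$ (a,b)
        = (\<Sum>l<N. if l = \<pi> a then (if a = b then complex_of_real (\<epsilon> a * \<epsilon> a * s (\<pi> a)) else 0) else 0)"
      unfolding uconj_dg_index[OF Zc ab] by (intro sum.cong refl) (use ab in \<open>auto simp: Zi \<pi>_inj mult_ac\<close>)
    then have u: "uconj Z (dg N (\<lambda>i. complex_of_real (s i))) $$ (a,b) = (if a = b then complex_of_real (s (\<pi> a)) else 0)"
      using ab \<pi>(2,4) by simp
    have "mix Z p (dg N (\<lambda>i. complex_of_real (s i))) $$ (a,b)
        = complex_of_real (1 - p) * dg N (\<lambda>i. complex_of_real (s i)) $$ (a,b)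
          + complex_of_real p * uconj Z (dg N (\<lambda>i. complex_of_real (s i))) $$ (a,b)"
      using ab Zc by (simp add: mix_def uconj_dim)
    then show "mix Z p (dg N (\<lambda>i. complex_of_real (s i))) $$ (a,b) = dg N ?s $$ (a,b)"
      unfolding u using ab jk(3) by (auto simp: \<pi>_def algebra_simps)
  qed (use Zc in \<open>auto simp: mix_def uconj_dim\<close>)
  then show ?thesis using in_R by simp
qed

text \<open>Induction on the number of places where \<open>s\<close> and \<open>r\<close> differ.
  Transferring \<open>d\<close> from an excess at \<open>j\<close> to a deficit at \<open>k\<close>
  repairs at least one of the two. Here \<open>k\<close> is the first deficit and \<open>j\<close>
  the last excess before it, so the sequence stays decreasing and is never re-sorted.\<close>

lemma majorisation_by_averaging:
  fixes r s :: "nat \<Rightarrow> real"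
  assumes avg: "\<And>s j k p. Q s \<Longrightarrow> j < N \<Longrightarrow> k < N \<Longrightarrow> j \<noteq> k \<Longrightarrow> 0 \<le> p \<Longrightarrow> p \<le> 1/2 \<Longrightarrow>
      Q (s(j := (1 - p) * s j + p * s k, k := (1 - p) * s k + p * s j))"
    and r: "\<And>i j. i \<le> j \<Longrightarrow> j < N \<Longrightarrow> r j \<le> r i"
  shows "Q s \<Longrightarrow> (\<And>i j. i \<le> j \<Longrightarrow> j < N \<Longrightarrow> s j \<le> s i) \<Longrightarrow>
    (\<And>m. m \<le> N \<Longrightarrow> (\<Sum>i<m. r i) \<le> (\<Sum>i<m. s i)) \<Longrightarrow> (\<Sum>i<N. r i) = (\<Sum>i<N. s i) \<Longrightarrow>
    \<exists>s'. Q s' \<and> (\<forall>i<N. s' i = r i)"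
proof (induction "card {i. i < N \<and> s i \<noteq> r i}" arbitrary: s rule: less_induct)
  case less
  note s = less(3) and part = less(4) and tot = less(5)
  show ?case
  proof (cases "\<forall>i<N. s i = r i")
    case True
    then show ?thesis using less(2) by blast
  next
    case False
    have "\<exists>k. k < N \<and> s k < r k"
    proof (rule ccontr)
      assume "\<nexists>k. k < N \<and> s k < r k"
      then have ge: "\<And>i. i < N \<Longrightarrow> r i \<le> s i" by (meson not_le)
      obtain i where "i < N" "r i < s i" using False ge by (metis order_le_less)
      then have "(\<Sum>i<N. r i) < (\<Sum>i<N. s i)" using ge by (intro sum_strict_mono_ex1) auto
      with tot show False by simp
    qed
    define k where "k = (LEAST k. k < N \<and> s k < r k)"
    have k: "k < N" "s k < r k" using LeastI_ex[OF \<open>\<exists>k. _\<close>] by (auto simp: k_def)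
    have kl: "r i \<le> s i" if "i < k" for i
      using not_less_Least[of i "\<lambda>k. k < N \<and> s k < r k"] that k(1) by (auto simp: k_def)
    \<comment> \<open>Without an earlier excess, the partial sum up to and including
      \<open>k\<close> would already violate the majorisation.\<close>
    have ne: "{j. j < k \<and> r j < s j} \<noteq> {}"
    proof (rule ccontr)
      assume "\<not> {j. j < k \<and> r j < s j} \<noteq> {}"
      then have "\<And>i. i < k \<Longrightarrow> \<not> r i < s i" by blast
      then have "\<And>i. i < k \<Longrightarrow> s i = r i" using kl by (meson antisym not_le)
      then have "(\<Sum>i<Suc k. s i) < (\<Sum>i<Suc k. r i)" using k(2) by simp
      with part[of "Suc k"] k(1) show False by simp
    qed
    define j where "j = Max {j. j < k \<and> r j < s j}"
    have fin: "finite {j. j < k \<and> r j < s j}" by simp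
    have j: "j < k" "r j < s j" using Max_in[OF fin ne] unfolding j_def by blast+
    have between: "s i = r i" if "j < i" "i < k" for i
    proof -
      have "\<not> r i < s i"
      proof
        assume "r i < s i"
        then have "i \<le> j" unfolding j_def using that(2) by (intro Max_ge[OF fin]) simp
        with that(1) show False by simp
      qed
      then show ?thesis using kl[OF that(2)] by simp
    qed
    define d where "d = min (s j - r j) (r k - s k)"
    have d: "0 < d" "d \<le> s j - r j" "d \<le> r k - s k" "d = s j - r j \<or> d = r k - s k"
      using j k by (auto simp: d_def)
    have rjk: "r k \<le> r j" using r[of j k] j k by simp
    \<comment> \<open>The weight for which averaging transfers exactly \<open>d\<close>. It is at
      most 1/2 because the gap \<open>s j - s k\<close> contains both the excess at \<open>j\<close>
      and the deficit at \<open>k\<close>, each at least \<open>d\<close>.\<close>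
    define p where "p = d / (s j - s k)"
    have sjk: "2 * d \<le> s j - s k" using d rjk by linarith
    have p: "0 \<le> p" "p \<le> 1/2" using d(1) sjk by (auto simp: p_def field_simps)
    have pd: "p * (s j - s k) = d" using d(1) sjk by (simp add: p_def)
    define s' where "s' = s(j := s j - d, k := s k + d)"
    have "s(j := (1 - p) * s j + p * s k, k := (1 - p) * s k + p * s j) = s'"
      using pd by (auto simp: s'_def fun_eq_iff algebra_simps)
    then have Qs': "Q s'" using avg[OF less(2), of j k p] j k p by simp
    have s'j: "s' j = s j - d" and s'k: "s' k = s k + d" and s'o: "\<And>i. i \<noteq> j \<Longrightarrow> i \<noteq> k \<Longrightarrow> s' i = s i"
      using j by (auto simp: s'_def)
    \<comment> \<open>The critical comparisons are with entries strictly between \<open>j\<close>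
      and \<open>k\<close>: these equal those of \<open>r\<close>, while \<open>s' j\<close> is
      still at least \<open>r j\<close> and \<open>s' k\<close> at most \<open>r k\<close>.\<close>
    have anti: "s' l \<le> s' i" if il: "i \<le> l" "l < N" for i l
    proof -
      consider "i = l" | "i < l" "i \<noteq> j" "i \<noteq> k" "l \<noteq> j" "l \<noteq> k" | "i < l" "l = j" | "i = j" "l < k" "i < l" | "i = j" "l = k"
        | "i = j" "k < l" | "i < j" "l = k" | "j < i" "i < k" "l = k" | "i = k" "k < l"
        using il by (metis nat_neq_iff order_le_less)
      then show ?thesis
      proof cases
        case 2
        then show ?thesis using s[OF il] by (simp add: s'o)
      next
        case 3
        then show ?thesis using s[OF il] d j by (simp add: s'j s'o)
      next
        case 4
        then show ?thesis using r[OF il] d between[of l] by (simp add: s'j s'o)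
      next
        case 5
        then show ?thesis using d rjk by (simp add: s'j s'k)
      next
        case 6
        then show ?thesis using s[of k l] il d sjk j by (simp add: s'j s'o)
      next
        case 7
        then show ?thesis using s[of i j] d sjk j k by (simp add: s'k s'o)
      next
        case 8
        then show ?thesis using r[OF il] d between[of i] by (simp add: s'k s'o)
      next
        case 9
        then show ?thesis using s[OF il] d j by (simp add: s'k s'o)
      qed auto
    qed
    have sum': "(\<Sum>i<m. s' i) = (\<Sum>i<m. s i) - (if j < m then d else 0) + (if k < m then d else 0)" for m
    proof -
      have "s' i = s i - (if i = j then d else 0) + (if i = k then d else 0)" for i
        using j by (auto simp: s'_def)
      then have "(\<Sum>i<m. s' i) = (\<Sum>i<m. s i) - (\<Sum>i<m. if i = j then d else 0) + (\<Sum>i<m. if i = k then d else 0)"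
        by (simp only: sum.distrib sum_subtractf)
      then show ?thesis by simp
    qed
    \<comment> \<open>Only the partial sums with \<open>j < m\<close> and \<open>m \<le> k\<close>
      lose \<open>d\<close>. Their slack is at least the excess at \<open>j\<close>, as
      \<open>s\<close> and \<open>r\<close> agree on the later indices below
      \<open>m\<close>.\<close>
    have part': "(\<Sum>i<m. r i) \<le> (\<Sum>i<m. s' i)" if m: "m \<le> N" for m
    proof (cases "j < m \<and> m \<le> k")
      case True
      have "(\<Sum>i<m. s i - r i) = (\<Sum>i<Suc j. s i - r i) + (\<Sum>i\<in>{Suc j..<m}. s i - r i)"
        using True sum.atLeastLessThan_concat[of 0 "Suc j" m "\<lambda>i. s i - r i"] by (simp add: lessThan_atLeast0)
      also have "(\<Sum>i\<in>{Suc j..<m}. s i - r i) = 0" using True between by (intro sum.neutral) auto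
      finally have "(\<Sum>i<m. s i) - (\<Sum>i<m. r i) = ((\<Sum>i<j. s i) - (\<Sum>i<j. r i)) + (s j - r j)"
        by (simp add: sum_subtractf)
      then show ?thesis using True part[of j] m d j by (simp add: sum')
    next
      case False
      then show ?thesis using part[OF m] j by (auto simp: sum')
    qed
    have tot': "(\<Sum>i<N. r i) = (\<Sum>i<N. s' i)" using tot j k by (simp add: sum')
    have "{i. i < N \<and> s' i \<noteq> r i} \<subset> {i. i < N \<and> s i \<noteq> r i}"
    proof
      show "{i. i < N \<and> s' i \<noteq> r i} \<subseteq> {i. i < N \<and> s i \<noteq> r i}"
        using j k by (auto simp: s'_def)
      have "s' j = r j \<or> s' k = r k" using d(4) by (auto simp: s'j s'k)
      then show "{i. i < N \<and> s' i \<noteq> r i} \<noteq> {i. i < N \<and> s i \<noteq> r i}"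
      proof
        assume "s' j = r j"
        moreover have "j \<in> {i. i < N \<and> s i \<noteq> r i}" using j k by simp
        ultimately show ?thesis by blast
      next
        assume "s' k = r k"
        moreover have "k \<in> {i. i < N \<and> s i \<noteq> r i}" using k by simp
        ultimately show ?thesis by blast
      qed
    qed
    then have "card {i. i < N \<and> s' i \<noteq> r i} < card {i. i < N \<and> s i \<noteq> r i}"
      by (intro psubset_card_mono) auto
    from less(1)[OF this Qs' anti part' tot'] show ?thesis .
  qed
qed

text \<open>Unitary invariance moves both states to diagonal form, so only the spectra remain to be
  compared, and averaging handles those.\<close>

lemma majorised_imp_in:
  fixes \<rho> \<rho>0 :: "complex mat"
  assumes R: "closed R" "uinv N R" and N: "even N" and pres: "preserves R (op N (noise (flip_mat N)))"
    and \<rho>0: "\<rho>0 \<in> pos1 N" "emb N \<rho>0 \<in> R" and \<rho>: "\<rho> \<in> pos1 N" "\<rho> \<prec> \<rho>0"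
  shows "emb N \<rho> \<in> R"
proof -
  have h: "hermitian N \<rho>0" "hermitian N \<rho>" using \<rho> \<rho>0 by (auto simp: pos1_def psd_def)
  define Q where "Q s \<longleftrightarrow> emb N (dg N (\<lambda>i. complex_of_real (s i))) \<in> R" for s
  obtain P where P: "unitary N P" "\<rho>0 = uconj P (dg N (\<lambda>i. complex_of_real (eigvals_desc \<rho>0 ! i)))"
    by (rule eigvals_desc_hermitian[OF h(1)])
  obtain P' where P': "unitary N P'" "\<rho> = uconj P' (dg N (\<lambda>i. complex_of_real (eigvals_desc \<rho> ! i)))"
    by (rule eigvals_desc_hermitian[OF h(2)])
  have "emb N (uconj (adj P) \<rho>0) \<in> R"
    by (rule uinvD[OF R(2) unitary_adj[OF P(1)] pos1_carrier[OF \<rho>0(1)] \<rho>0(2)])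
  moreover have "uconj (adj P) \<rho>0 = dg N (\<lambda>i. complex_of_real (eigvals_desc \<rho>0 ! i))"
    using uconj_inverse(1)[OF P(1) dg_carrier] P(2) by metis
  ultimately have "Q (\<lambda>i. eigvals_desc \<rho>0 ! i)" by (simp add: Q_def)
  moreover have "Q (s(j := (1 - p) * s j + p * s k, k := (1 - p) * s k + p * s j))"
    if "Q s" "j < N" "k < N" "j \<noteq> k" "0 \<le> p" "p \<le> 1/2" for s j k p
    using that emb_average_two_in[OF R N pres] unfolding Q_def by blast
  ultimately obtain s where s: "Q s" "\<forall>i<N. s i = eigvals_desc \<rho> ! i"
    using majorisation_by_averaging[of Q N "\<lambda>i. eigvals_desc \<rho> ! i" "\<lambda>i. eigvals_desc \<rho>0 ! i"]
      eigvals_desc_antimono[OF h(1)] eigvals_desc_antimono[OF h(2)] sum_eigvals_desc[OF \<rho>(1)] sum_eigvals_desc[OF \<rho>0(1)]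
      \<rho>(2)[unfolded majorised_iff[OF \<rho>(1) \<rho>0(1)]] by auto
  have "dg N (\<lambda>i. complex_of_real (s i)) = dg N (\<lambda>i. complex_of_real (eigvals_desc \<rho> ! i))"
    using s(2) by (intro dg_cong) simp
  then have "emb N (uconj P' (dg N (\<lambda>i. complex_of_real (eigvals_desc \<rho> ! i)))) \<in> R"
    using uinvD[OF R(2) P'(1) dg_carrier] s(1) by (simp add: Q_def)
  then show ?thesis using P'(2) by simp
qed

section \<open>Invariance of the majorised states under the system, and the equality of the two
  sets\<close>

lemma uinv_imp_preserves_comm:
  assumes R: "uinv N R" "R \<subseteq> blk N" and A: "A \<in> carrier_mat N N" "adj A = - A"
  shows "preserves R (op N (comm A))"
  unfolding preserves_def
proof (intro allI impI ballI)
  fix t :: real and x assume t: "0 \<le> t" and x: "x \<in> R"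
  obtain X where X: "X \<in> carrier_mat N N" "x = emb N X" using x R(2) by (blast elim: blkE)
  obtain P \<theta> where P: "unitary N P" "A = uconj P (dg N (\<lambda>j. \<i> * complex_of_real (\<theta> j)))"
    using skew_decomp[OF A] .
  have "unitary N (uconj P (dg N (\<lambda>j. cis (t * \<theta> j))))"
    unfolding uconj_def by (intro unitary_mult unitary_adj P(1) unitary_dg) simp
  from uinvD[OF R(1) this X(1)] show "app (exp (t *\<^sub>R op N (comm A))) x \<in> R"
    unfolding P(2) X(2) exp_op_comm[OF P(1) X(1) t] using x X(2) by blast
qed

text \<open>Along the noise flow a state is replaced by a convex combination of itself and a unitary
  conjugate.\<close>

lemma preserves_noise_ky_set:
  assumes Z: "unitary N Z" "Z * Z = 1\<^sub>m N"
  shows "preserves (emb N ` ky_set N a) (op N (noise Z))"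
  unfolding preserves_def
proof (intro allI impI ballI)
  fix t :: real and x assume t: "0 \<le> t" and "x \<in> emb N ` ky_set N a"
  then obtain X where X: "X \<in> ky_set N a" "x = emb N X" by blast
  have "mix Z ((1 - exp (- (2 * t))) / 2) X \<in> ky_set N a"
    unfolding mix_def
    by (rule ky_set_convex[OF X(1) ky_set_uconj[OF X(1) Z(1)]]) (use t in \<open>auto intro: order_trans[OF _ exp_ge_zero]\<close>)
  then show "app (exp (t *\<^sub>R op N (noise Z))) x \<in> emb N ` ky_set N a"
    unfolding X(2) exp_op_noise[OF Z ky_set_carrier[OF X(1)] t] by blast
qed

theorem theorem2:
  fixes n :: nat and H0 :: "complex mat" and Hs :: "complex mat list"
    and \<gamma>s :: real and \<rho>0 :: "complex mat"
  assumes "n \<ge> 1"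
    and "hermitian (2 ^ n) H0"
    and "\<forall>H\<in>set Hs. hermitian (2 ^ n) H"
    and "\<gamma>s > 0"
    and "lie_gen ((\<lambda>H. \<i> \<cdot>\<^sub>m H) ` set (H0 # Hs)) = su (2 ^ n)"
    and "\<rho>0 \<in> pos1 (2 ^ n)"
  shows "mat_closure (2 ^ n) (reach n H0 Hs \<gamma>s \<rho>0) = {\<rho> \<in> pos1 (2 ^ n). \<rho> \<prec> \<rho>0}"
proof -
  define N where "N = (2::nat) ^ n"
  note n = assms(1) and H0 = assms(2)[folded N_def] and Hs = assms(3)[folded N_def]
    and lie = assms(5)[folded N_def] and \<rho>0 = assms(6)[folded N_def]
  have evenN: "even N" using n by (simp add: N_def)
  define Z where "Z = flip_mat N"
  have Z: "unitary N Z" "Z * Z = 1\<^sub>m N" using evenN by (simp_all add: Z_def unitary_flip_mat flip_mat_square)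
  define Rch where "Rch = reach n H0 Hs \<gamma>s \<rho>0"
  define gen where "gen us \<gamma> = generator n (ctrl_ham H0 Hs us) \<gamma>" for us \<gamma>
  have hctrl: "hermitian N (ctrl_ham H0 Hs us)" if "length us = length Hs" for us
    by (rule hermitian_ctrl_ham[OF H0 Hs that])
  have skew: "- \<i> \<cdot>\<^sub>m H \<in> carrier_mat N N" "adj (- \<i> \<cdot>\<^sub>m H) = - (- \<i> \<cdot>\<^sub>m H)"
    "\<i> \<cdot>\<^sub>m H \<in> carrier_mat N N" "adj (\<i> \<cdot>\<^sub>m H) = - (\<i> \<cdot>\<^sub>m H)" if "hermitian N H" for H
    using that by (auto simp: hermitian_def intro!: eq_matI)
  have sgen: "superop N (gen us \<gamma>)"
    and opgen: "op N (gen us \<gamma>) = op N (comm (- \<i> \<cdot>\<^sub>m ctrl_ham H0 Hs us)) + (\<gamma> / 2) *\<^sub>R op N (noise Z)"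
    if "length us = length Hs" for us \<gamma>
  proof -
    have c: "ctrl_ham H0 Hs us \<in> carrier_mat (2 ^ n) (2 ^ n)" using hctrl[OF that] by (simp add: hermitian_def N_def)
    show "superop N (gen us \<gamma>)" unfolding gen_def N_def by (rule superop_generator[OF n c])
    show "op N (gen us \<gamma>) = op N (comm (- \<i> \<cdot>\<^sub>m ctrl_ham H0 Hs us)) + (\<gamma> / 2) *\<^sub>R op N (noise Z)"
      unfolding gen_def N_def Z_def by (rule op_generator[OF n c])
  qed
  define a where "a i = eigvals_desc \<rho>0 ! i" for i
  define K where "K = emb N ` ky_set N a"
  have K: "closed K" "K \<subseteq> blk N" "uinv N K"
  proof -
    show "closed K" unfolding K_def by (rule closed_emb_ky_set)
    show "K \<subseteq> blk N" by (auto simp: K_def ky_set_carrier)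
    show "uinv N K" unfolding uinv_def
    proof (intro allI impI)
      fix U X assume U: "unitary N U" and X: "X \<in> carrier_mat N N" "emb N X \<in> K"
      then have "X \<in> ky_set N a" unfolding K_def using emb_inject ky_set_carrier by blast
      then show "emb N (uconj U X) \<in> K" unfolding K_def using ky_set_uconj[OF _ U] by blast
    qed
  qed
  have K_gen: "preserves K (op N (gen us \<gamma>))" if "length us = length Hs" "0 \<le> \<gamma>" for us \<gamma>
    unfolding opgen[OF that(1)]
    using K uinv_imp_preserves_comm[OF K(3,2) skew(1,2)[OF hctrl[OF that(1)]]] preserves_noise_ky_set[OF Z, of a] that(2)
    by (intro preserves_add preserves_scaleR) (auto simp: K_def)
  have M: "{\<rho> \<in> pos1 N. \<rho> \<prec> \<rho>0} = ky_set N a"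
    using majorised_set_eq_ky_set[OF \<rho>0] by (simp add: a_def[abs_def])
  have \<rho>0K: "\<rho>0 \<in> ky_set N a" using \<rho>0 M majorised_iff[OF \<rho>0 \<rho>0] by blast
  have reach_K: "emb N \<rho> \<in> K \<and> \<rho> \<in> carrier_mat N N" if "\<rho> \<in> Rch" for \<rho>
    using that unfolding Rch_def
  proof induction
    case start
    then show ?case using \<rho>0K by (auto simp: K_def ky_set_carrier)
  next
    case (step \<rho> us \<gamma> t \<rho>')
    have ev: "evolves N (gen us \<gamma>) t \<rho> \<rho>'" using step(4) by (simp add: gen_def N_def)
    then have "0 \<le> t" by (simp add: evolves_def)
    moreover have "0 \<le> \<gamma>" using step(3) assms(4) by auto
    ultimately show ?case
      using evolves_imp_exp[OF sgen[OF step(2)] ev] preservesD[OF K_gen[OF step(2)]] step(5) by simp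
  qed
  define R where "R = closure (emb N ` Rch)"
  have R: "closed R" "R \<subseteq> blk N"
    using reach_K closure_minimal[OF _ closed_blk, of "emb N ` Rch" N] by (auto simp: R_def)
  have R_gen: "preserves R (op N (gen us \<gamma>))" if us: "length us = length Hs" and \<gamma>: "\<gamma> \<in> {0, \<gamma>s}" for us \<gamma>
    unfolding R_def
  proof (rule preserves_closure, unfold preserves_def, intro allI impI ballI)
    fix t :: real and x assume t: "0 \<le> t" and "x \<in> emb N ` Rch"
    then obtain \<rho> where \<rho>: "\<rho> \<in> Rch" "x = emb N \<rho>" by blast
    have c: "\<rho> \<in> carrier_mat N N" using reach_K \<rho> by blast
    let ?y = "app (exp (t *\<^sub>R op N (gen us \<gamma>))) x"
    have "evolves N (gen us \<gamma>) t \<rho> (unemb N ?y)"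
      unfolding \<rho>(2) by (rule exp_imp_evolves[OF sgen[OF us] c t])
    then have "unemb N ?y \<in> Rch"
      using reach.step[OF \<rho>(1)[unfolded Rch_def] us \<gamma>] by (simp add: Rch_def gen_def N_def)
    moreover have "?y = emb N (unemb N ?y)"
      using exp_op_blk[OF sgen[OF us] _ t, of x] c by (simp add: \<rho>(2) blk_def)
    ultimately show "?y \<in> emb N ` Rch" by blast
  qed
  \<comment> \<open>With the noise off, the system provides the negative sign; recurrence reverses
    it.\<close>
  have R_ctrl: "preserves R (op N (comm (\<i> \<cdot>\<^sub>m ctrl_ham H0 Hs us)))"
    "preserves R (op N (comm (- \<i> \<cdot>\<^sub>m ctrl_ham H0 Hs us)))" if us: "length us = length Hs" for us
  proof -
    note sk = skew[OF hctrl[OF us]]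
    show neg: "preserves R (op N (comm (- \<i> \<cdot>\<^sub>m ctrl_ham H0 Hs us)))"
      using R_gen[OF us, of 0] by (simp add: opgen[OF us])
    have "\<i> \<cdot>\<^sub>m ctrl_ham H0 Hs us = complex_of_real (-1) \<cdot>\<^sub>m (- \<i> \<cdot>\<^sub>m ctrl_ham H0 Hs us)"
      by (rule eq_matI) auto
    then have "op N (comm (\<i> \<cdot>\<^sub>m ctrl_ham H0 Hs us)) = - op N (comm (- \<i> \<cdot>\<^sub>m ctrl_ham H0 Hs us))"
      using op_comm_smult[OF sk(1), of "-1"] by simp
    then show "preserves R (op N (comm (\<i> \<cdot>\<^sub>m ctrl_ham H0 Hs us)))"
      using preserves_comm_uminus[OF R sk(1,2) neg] by simp
  qed
  have carr: "H0 \<in> carrier_mat N N" "\<forall>H\<in>set Hs. H \<in> carrier_mat N N"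
    using H0 Hs by (auto simp: hermitian_def)
  define us0 :: "real list" where "us0 = replicate (length Hs) 0"
  have us0: "length us0 = length Hs" "ctrl_ham H0 Hs us0 = H0"
    using ctrl_ham_zero[OF carr] by (simp_all add: us0_def)
  have R_iH: "preserves R (op N (comm (\<i> \<cdot>\<^sub>m H)))" if "H \<in> set (H0 # Hs)" for H
  proof (cases "H = H0")
    case True
    then show ?thesis using R_ctrl(1)[OF us0(1)] us0(2) by simp
  next
    case False
    then have H: "H \<in> set Hs" "H \<in> carrier_mat N N" using that carr by auto
    obtain us where us: "length us = length Hs" "ctrl_ham H0 Hs us = H0 + H"
      using ctrl_ham_single[OF carr H(1)] .
    \<comment> \<open>A control term is isolated by adding the reversed flow of
      \<open>H0 + H\<close> and the plain drift.\<close>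
    have "\<i> \<cdot>\<^sub>m H = \<i> \<cdot>\<^sub>m (H0 + H) + - \<i> \<cdot>\<^sub>m H0" using carr H by (intro eq_matI) (auto simp: algebra_simps)
    then have "op N (comm (\<i> \<cdot>\<^sub>m H)) = op N (comm (\<i> \<cdot>\<^sub>m (H0 + H))) + op N (comm (- \<i> \<cdot>\<^sub>m H0))"
      using carr H by (simp add: op_comm_add)
    then show ?thesis
      using preserves_add[OF R(1) R_ctrl(1)[OF us(1)] R_ctrl(2)[OF us0(1)]] by (simp add: us(2) us0(2))
  qed
  have "preserves R (op N (comm A))" if "A \<in> su N" for A
  proof -
    have "A \<in> lie_gen ((\<lambda>H. \<i> \<cdot>\<^sub>m H) ` set (H0 # Hs))" using that lie by simp
    moreover have "A \<in> carrier_mat N N \<and> adj A = - A \<and> preserves R (op N (comm A))"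
      if A: "A \<in> (\<lambda>H. \<i> \<cdot>\<^sub>m H) ` set (H0 # Hs)" for A
    proof -
      obtain H where H: "H \<in> set (H0 # Hs)" "A = \<i> \<cdot>\<^sub>m H" using A by blast
      then have "hermitian N H" using H0 Hs by auto
      from skew(3,4)[OF this] R_iH[OF H(1)] H(2) show ?thesis by blast
    qed
    ultimately show ?thesis using preserves_lie_gen[OF R] by blast
  qed
  then have uR: "uinv N R" by (rule preserves_su_imp_uinv)
  have "preserves R (op N (noise Z))"
  proof -
    have "op N (comm (\<i> \<cdot>\<^sub>m H0)) + op N (gen us0 \<gamma>s) = (\<gamma>s / 2) *\<^sub>R op N (noise Z)"
    proof -
      have "\<i> \<cdot>\<^sub>m H0 = complex_of_real (-1) \<cdot>\<^sub>m (- \<i> \<cdot>\<^sub>m H0)" by (rule eq_matI) auto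
      then have "op N (comm (\<i> \<cdot>\<^sub>m H0)) = - op N (comm (- \<i> \<cdot>\<^sub>m H0))"
        using op_comm_smult[OF skew(1)[OF H0], of "-1"] by simp
      then show ?thesis by (simp add: opgen[OF us0(1)] us0(2))
    qed
    moreover have "preserves R (op N (comm (\<i> \<cdot>\<^sub>m H0)) + op N (gen us0 \<gamma>s))"
      using R_iH[of H0] R_gen[OF us0(1), of \<gamma>s] by (intro preserves_add R(1)) auto
    ultimately have "preserves R ((\<gamma>s / 2) *\<^sub>R op N (noise Z))" by simp
    from preserves_scaleR[OF this, of "2 / \<gamma>s"] show ?thesis using assms(4) by simp
  qed
  moreover have "emb N \<rho>0 \<in> R"
    unfolding R_def Rch_def by (intro subsetD[OF closure_subset] imageI reach.start)
  ultimately have in_R: "emb N \<rho> \<in> R" if "\<rho> \<in> pos1 N" "\<rho> \<prec> \<rho>0" for \<rho> :: "complex mat"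
    using majorised_imp_in[OF R(1) uR evenN _ \<rho>0 _ that] by (simp add: Z_def)
  have in_K: "\<rho> \<in> ky_set N a" if "\<rho> \<in> carrier_mat N N" "emb N \<rho> \<in> R" for \<rho>
  proof -
    have "R \<subseteq> K" unfolding R_def using reach_K by (intro closure_minimal K(1)) auto
    then show ?thesis using that emb_inject ky_set_carrier unfolding K_def by blast
  qed
  have Rch_carrier: "Rch \<subseteq> carrier_mat N N" using reach_K by blast
  have "mat_closure N Rch = {\<rho> \<in> pos1 N. \<rho> \<prec> \<rho>0}"
    unfolding mat_closure_eq[OF Rch_carrier] R_def[symmetric]
  proof (intro equalityI subsetI)
    fix \<rho> assume "\<rho> \<in> {\<rho> \<in> carrier_mat N N. emb N \<rho> \<in> R}"
    then show "\<rho> \<in> {\<rho> \<in> pos1 N. \<rho> \<prec> \<rho>0}" unfolding M using in_K by blast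
  next
    fix \<rho> assume "\<rho> \<in> {\<rho> \<in> pos1 N. \<rho> \<prec> \<rho>0}"
    then show "\<rho> \<in> {\<rho> \<in> carrier_mat N N. emb N \<rho> \<in> R}" using in_R pos1_carrier by blast
  qed
  then show ?thesis by (simp add: N_def Rch_def)
qed

end
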